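(* Let $\mathbb{D}$ be a stable derivator and consider a functor $u\colon J\to K$ between small categories. Then finite coproducts and finite products in $\mathbb{D}(J)$ are canonically isomorphic. Moreover, these are preserved by $u^\ast$, $u_!$ and $u_\ast$.
   Context: **Derivators.** $\mathsf{Cat}$ is the 2-category of small categories, $\mathsf{CAT}$ that of not necessarily small categories, $e$ the terminal category. A prederivator is a strict 2-functor $\mathbb{D}\colon\mathsf{Cat}^{op}\to\mathsf{CAT}$ (contravariant on functors, covariant on natural transformations). Write $u^\ast=\mathbb{D}(u)\colon\mathbb{D}(K)\to\mathbb{D}(J)$ for $u\colon J\to K$, and $\alpha^\ast=\mathbb{D}(\alpha)$. For $k\in K$, viewed as $k\colon e\to K$, write $X_k=k^\ast X\in\mathbb{D}(e)$, $f_k=k^\ast f$. $\mathbb{D}$ is a derivator if: (Der1) for all $J_1,J_2$ the functor $\mathbb{D}(J_1\sqcup J_2)\to\mathbb{D}(J_1)\times\mathbb{D}(J_2)$ induced by the inclusions is an equivalence, and $\mathbb{D}(\emptyset)$ is not the empty category; (Der2) a morphism $f$ in $\mathbb{D}(J)$ is an isomorphism iff $f_j$ is an isomorphism in $\mathbb{D}(e)$ for all $j\in J$; (Der3) every $u^\ast$ has a left adjoint $u_!$ and a right adjoint $u_\ast$ (homotopy left/right Kan extension); (Der4) for $u\colon J\to K$ and $k\in K$ let $J_{/k}$ be the category of pairs $(j,f\colon u(j)\to k)$ and $J_{k/}$ that of pairs $(j,f\colon k\to u(j))$, with projections $\mathrm{pr}$ to $J$ and $p$ to $e$, and let $\alpha\colon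 u\circ\mathrm{pr}\to k\circ p$, resp. $\alpha\colon k\circ p\to u\circ\mathrm{pr}$, be the transformation with components $f$. Then the maps $p_!\mathrm{pr}^\ast\xrightarrow{\eta}p_!\mathrm{pr}^\ast u^\ast u_!\xrightarrow{\alpha^\ast}p_!p^\ast k^\ast u_!\xrightarrow{\epsilon}k^\ast u_!$ and $k^\ast u_\ast\xrightarrow{\eta}p_\ast p^\ast k^\ast u_\ast\xrightarrow{\alpha^\ast}p_\ast\mathrm{pr}^\ast u^\ast u_\ast\xrightarrow{\epsilon}p_\ast\mathrm{pr}^\ast$ are isomorphisms. **Stable derivators.** $[1]$ is the category $0\to1$ and $\square=[1]\times[1]$; $i_{\ulcorner}\colon\ulcorner\to\square$ is the full subposet on $(0,0),(1,0),(0,1)$ and $i_{\lrcorner}\colon\lrcorner\to\square$ the full subposet on $(1,0),(0,1),(1,1)$. $X\in\mathbb{D}(\square)$ is coCartesian (Cartesian) if it lies in the essential image of $(i_{\ulcorner})_!$ (of $(i_{\lrcorner})_\ast$). $\mathbb{D}$ is pointed if $\mathbb{D}(e)$ has a zero object. $\mathbb{D}$ is strong if for each small $J$ the functor $\mathbb{D}([1]\times J)\to\mathbb{D}(J)^{[1]}$, sending $X$ to the morphism $(0\times\mathrm{id}_J)^\ast X\to(1\times\mathrm{id}_J)^\ast X$ induced by $0\to1$, is full and essentially surjective. $\mathbb{D}$ is stable if it is strong, pointed, and an object of $\mathbb{D}(\square)$ is coCartesian iff it is Cartesian. For any derivator, each $\mathbb{D}(J)$ has finite coproducts and finite products; for a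 pointed derivator each $\mathbb{D}(J)$ has a zero object. The first assertion of the claim is the semi-additivity of $\mathbb{D}(J)$, i.e. that $\mathbb{D}(J)$ has finite biproducts. *)

theory Defs
  imports "HOL-Library.FuncSet"
begin

section \<open>Categories, functors, natural transformations\<close>

record ('o, 'm) cat =
  Obj :: "'o set"
  Arr :: "'m set"
  Dom :: "'m \<Rightarrow> 'o"
  Cod :: "'m \<Rightarrow> 'o"
  Ide :: "'o \<Rightarrow> 'm"
  Comp :: "'m \<Rightarrow> 'm \<Rightarrow> 'm"  \<comment> \<open>\<open>Comp C g f\<close> is \<open>g \<circ> f\<close>\<close>

definition Hom :: "('o, 'm) cat \<Rightarrow> 'o \<Rightarrow> 'o \<Rightarrow> 'm set" where
  "Hom C x y = {f \<in> Arr C. Dom C f = x \<and> Cod C f = y}"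

definition category :: "('o, 'm) cat \<Rightarrow> bool" where
  "category C \<longleftrightarrow>
     (\<forall>f \<in> Arr C. Dom C f \<in> Obj C \<and> Cod C f \<in> Obj C) \<and>
     (\<forall>x \<in> Obj C. Ide C x \<in> Hom C x x) \<and>
     (\<forall>f \<in> Arr C. \<forall>g \<in> Arr C. Cod C f = Dom C g \<longrightarrow> Comp C g f \<in> Hom C (Dom C f) (Cod C g)) \<and>
     (\<forall>f \<in> Arr C. Comp C f (Ide C (Dom C f)) = f \<and> Comp C (Ide C (Cod C f)) f = f) \<and>
     (\<forall>f \<in> Arr C. \<forall>g \<in> Arr C. \<forall>h \<in> Arr C. Cod C f = Dom C g \<longrightarrow> Cod C g = Dom C h \<longrightarrow>
        Comp C h (Comp C g f) = Comp C (Comp C h g) f)"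

definition is_iso :: "('o, 'm) cat \<Rightarrow> 'm \<Rightarrow> bool" where
  "is_iso C f \<longleftrightarrow> f \<in> Arr C \<and>
     (\<exists>g \<in> Hom C (Cod C f) (Dom C f).
        Comp C g f = Ide C (Dom C f) \<and> Comp C f g = Ide C (Cod C f))"

definition isomorphic :: "('o, 'm) cat \<Rightarrow> 'o \<Rightarrow> 'o \<Rightarrow> bool" where
  "isomorphic C x y \<longleftrightarrow> (\<exists>f \<in> Hom C x y. is_iso C f)"

text \<open>The maps of a functor and the components of a transformation are extensional
  (undefined outside the carriers), so that equality of functors and of transformations
  is equality in HOL and strict 2-functoriality can be stated with it.\<close>

record ('o, 'm, 'p, 'n) fctr =
  Src :: "('o, 'm) cat"
  Tgt :: "('p, 'n) cat"
  OMap :: "'o \<Rightarrow> 'p"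
  AMap :: "'m \<Rightarrow> 'n"

definition is_functor :: "('o, 'm, 'p, 'n) fctr \<Rightarrow> bool" where
  "is_functor F \<longleftrightarrow>
     category (Src F) \<and> category (Tgt F) \<and>
     OMap F \<in> Obj (Src F) \<rightarrow>\<^sub>E Obj (Tgt F) \<and>
     AMap F \<in> Arr (Src F) \<rightarrow>\<^sub>E Arr (Tgt F) \<and>
     (\<forall>f \<in> Arr (Src F). Dom (Tgt F) (AMap F f) = OMap F (Dom (Src F) f) \<and>
        Cod (Tgt F) (AMap F f) = OMap F (Cod (Src F) f)) \<and>
     (\<forall>x \<in> Obj (Src F). AMap F (Ide (Src F) x) = Ide (Tgt F) (OMap F x)) \<and>
     (\<forall>f \<in> Arr (Src F). \<forall>g \<in> Arr (Src F). Cod (Src F) f = Dom (Src F) g \<longrightarrow>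
        AMap F (Comp (Src F) g f) = Comp (Tgt F) (AMap F g) (AMap F f))"

definition functors :: "('o, 'm) cat \<Rightarrow> ('p, 'n) cat \<Rightarrow> ('o, 'm, 'p, 'n) fctr set" where
  "functors C D = {F. is_functor F \<and> Src F = C \<and> Tgt F = D}"

definition mk_fctr ::
    "('o, 'm) cat \<Rightarrow> ('p, 'n) cat \<Rightarrow> ('o \<Rightarrow> 'p) \<Rightarrow> ('m \<Rightarrow> 'n) \<Rightarrow> ('o, 'm, 'p, 'n) fctr" where
  "mk_fctr C D fo fm =
     \<lparr>Src = C, Tgt = D, OMap = restrict fo (Obj C), AMap = restrict fm (Arr C)\<rparr>"

definition id_fctr :: "('o, 'm) cat \<Rightarrow> ('o, 'm, 'o, 'm) fctr" where
  "id_fctr C = mk_fctr C C (\<lambda>x. x) (\<lambda>f. f)"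

definition comp_fctr ::
    "('p, 'n, 'q, 'k) fctr \<Rightarrow> ('o, 'm, 'p, 'n) fctr \<Rightarrow> ('o, 'm, 'q, 'k) fctr"
    (infixr "\<odot>" 70) where
  "G \<odot> F = mk_fctr (Src F) (Tgt G) (\<lambda>x. OMap G (OMap F x)) (\<lambda>f. AMap G (AMap F f))"

record ('o, 'm, 'p, 'n) ntrans =
  NSrc :: "('o, 'm, 'p, 'n) fctr"
  NTgt :: "('o, 'm, 'p, 'n) fctr"
  Cmp :: "'o \<Rightarrow> 'n"

definition is_ntrans :: "('o, 'm, 'p, 'n) ntrans \<Rightarrow> bool" where
  "is_ntrans a \<longleftrightarrow> is_functor (NSrc a) \<and> is_functor (NTgt a) \<and>
     Src (NSrc a) = Src (NTgt a) \<and> Tgt (NSrc a) = Tgt (NTgt a) \<and>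
     Cmp a \<in> extensional (Obj (Src (NSrc a))) \<and>
     (\<forall>x \<in> Obj (Src (NSrc a)).
        Cmp a x \<in> Hom (Tgt (NSrc a)) (OMap (NSrc a) x) (OMap (NTgt a) x)) \<and>
     (\<forall>f \<in> Arr (Src (NSrc a)).
        Comp (Tgt (NSrc a)) (AMap (NTgt a) f) (Cmp a (Dom (Src (NSrc a)) f)) =
        Comp (Tgt (NSrc a)) (Cmp a (Cod (Src (NSrc a)) f)) (AMap (NSrc a) f))"

definition ntranss ::
    "('o, 'm, 'p, 'n) fctr \<Rightarrow> ('o, 'm, 'p, 'n) fctr \<Rightarrow> ('o, 'm, 'p, 'n) ntrans set" where
  "ntranss F G = {a. is_ntrans a \<and> NSrc a = F \<and> NTgt a = G}"

definition mk_ntrans ::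
    "('o, 'm, 'p, 'n) fctr \<Rightarrow> ('o, 'm, 'p, 'n) fctr \<Rightarrow> ('o \<Rightarrow> 'n) \<Rightarrow> ('o, 'm, 'p, 'n) ntrans" where
  "mk_ntrans F G c = \<lparr>NSrc = F, NTgt = G, Cmp = restrict c (Obj (Src F))\<rparr>"

definition id_ntrans :: "('o, 'm, 'p, 'n) fctr \<Rightarrow> ('o, 'm, 'p, 'n) ntrans" where
  "id_ntrans F = mk_ntrans F F (\<lambda>x. Ide (Tgt F) (OMap F x))"

definition vcomp ::
    "('o, 'm, 'p, 'n) ntrans \<Rightarrow> ('o, 'm, 'p, 'n) ntrans \<Rightarrow> ('o, 'm, 'p, 'n) ntrans" where
  "vcomp b a = mk_ntrans (NSrc a) (NTgt b) (\<lambda>x. Comp (Tgt (NSrc a)) (Cmp b x) (Cmp a x))"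

text \<open>\<open>hcomp b a\<close> is the horizontal composite \<open>G \<odot> F \<Rightarrow> G' \<odot> F'\<close> of \<open>a : F \<Rightarrow> F'\<close> and
  \<open>b : G \<Rightarrow> G'\<close>.\<close>

definition hcomp ::
    "('p, 'n, 'q, 'k) ntrans \<Rightarrow> ('o, 'm, 'p, 'n) ntrans \<Rightarrow> ('o, 'm, 'q, 'k) ntrans" where
  "hcomp b a = mk_ntrans (NSrc b \<odot> NSrc a) (NTgt b \<odot> NTgt a)
     (\<lambda>x. Comp (Tgt (NSrc b)) (Cmp b (OMap (NTgt a) x)) (AMap (NSrc b) (Cmp a x)))"

definition is_niso :: "('o, 'm, 'p, 'n) ntrans \<Rightarrow> bool" where
  "is_niso a \<longleftrightarrow> is_ntrans a \<and> (\<forall>x \<in> Obj (Src (NSrc a)). is_iso (Tgt (NSrc a)) (Cmp a x))"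

definition is_equivalence :: "('o, 'm, 'p, 'n) fctr \<Rightarrow> bool" where
  "is_equivalence F \<longleftrightarrow> is_functor F \<and>
     (\<exists>G \<in> functors (Tgt F) (Src F).
        (\<exists>a \<in> ntranss (id_fctr (Src F)) (G \<odot> F). is_niso a) \<and>
        (\<exists>b \<in> ntranss (F \<odot> G) (id_fctr (Tgt F)). is_niso b))"

definition full :: "('o, 'm, 'p, 'n) fctr \<Rightarrow> bool" where
  "full F \<longleftrightarrow> (\<forall>x \<in> Obj (Src F). \<forall>y \<in> Obj (Src F).
     \<forall>g \<in> Hom (Tgt F) (OMap F x) (OMap F y). \<exists>f \<in> Hom (Src F) x y. AMap F f = g)"

definition essentially_surjective :: "('o, 'm, 'p, 'n) fctr \<Rightarrow> bool" where
  "essentially_surjective F \<longleftrightarrow>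
     (\<forall>y \<in> Obj (Tgt F). \<exists>x \<in> Obj (Src F). isomorphic (Tgt F) (OMap F x) y)"

definition adjunction ::
    "('o, 'm, 'p, 'n) fctr \<Rightarrow> ('p, 'n, 'o, 'm) fctr \<Rightarrow>
     ('o, 'm, 'o, 'm) ntrans \<Rightarrow> ('p, 'n, 'p, 'n) ntrans \<Rightarrow> bool" where
  "adjunction L R \<eta> \<epsilon> \<longleftrightarrow>
     is_functor L \<and> R \<in> functors (Tgt L) (Src L) \<and>
     \<eta> \<in> ntranss (id_fctr (Src L)) (R \<odot> L) \<and> \<epsilon> \<in> ntranss (L \<odot> R) (id_fctr (Tgt L)) \<and>
     (\<forall>x \<in> Obj (Src L).
        Comp (Tgt L) (Cmp \<epsilon> (OMap L x)) (AMap L (Cmp \<eta> x)) = Ide (Tgt L) (OMap L x)) \<and>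
     (\<forall>y \<in> Obj (Tgt L).
        Comp (Src L) (AMap R (Cmp \<epsilon> y)) (Cmp \<eta> (OMap R y)) = Ide (Src L) (OMap R y))"

definition left_adjoint_of :: "('o, 'm, 'p, 'n) fctr \<Rightarrow> ('p, 'n, 'o, 'm) fctr \<Rightarrow> bool" where
  "left_adjoint_of L R \<longleftrightarrow> (\<exists>\<eta> \<epsilon>. adjunction L R \<eta> \<epsilon>)"

definition right_adjoint_of :: "('p, 'n, 'o, 'm) fctr \<Rightarrow> ('o, 'm, 'p, 'n) fctr \<Rightarrow> bool" where
  "right_adjoint_of R L \<longleftrightarrow> (\<exists>\<eta> \<epsilon>. adjunction L R \<eta> \<epsilon>)"

definition in_essential_image :: "('o, 'm, 'p, 'n) fctr \<Rightarrow> 'p \<Rightarrow> bool" where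
  "in_essential_image F y \<longleftrightarrow> y \<in> Obj (Tgt F) \<and> (\<exists>x \<in> Obj (Src F). isomorphic (Tgt F) (OMap F x) y)"

definition prod_cat :: "('o, 'm) cat \<Rightarrow> ('p, 'n) cat \<Rightarrow> ('o \<times> 'p, 'm \<times> 'n) cat" where
  "prod_cat C D =
     \<lparr>Obj = Obj C \<times> Obj D, Arr = Arr C \<times> Arr D,
      Dom = (\<lambda>h. (Dom C (fst h), Dom D (snd h))),
      Cod = (\<lambda>h. (Cod C (fst h), Cod D (snd h))),
      Ide = (\<lambda>x. (Ide C (fst x), Ide D (snd x))),
      Comp = (\<lambda>k h. (Comp C (fst k) (fst h), Comp D (snd k) (snd h)))\<rparr>"

definition pair_fctr ::
    "('o, 'm, 'p, 'n) fctr \<Rightarrow> ('o, 'm, 'q, 'k) fctr \<Rightarrow> ('o, 'm, 'p \<times> 'q, 'n \<times> 'k) fctr" where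
  "pair_fctr F G = mk_fctr (Src F) (prod_cat (Tgt F) (Tgt G))
     (\<lambda>x. (OMap F x, OMap G x)) (\<lambda>f. (AMap F f, AMap G f))"

text \<open>The arrow category \<open>C\<^sup>[\<^sup>1\<^sup>]\<close>: an arrow from \<open>f\<close> to \<open>g\<close> is \<open>((f, g), (a, b))\<close> with
  \<open>b \<circ> f = g \<circ> a\<close>.\<close>

definition arrow_cat :: "('o, 'm) cat \<Rightarrow> ('m, ('m \<times> 'm) \<times> ('m \<times> 'm)) cat" where
  "arrow_cat C =
     \<lparr>Obj = Arr C,
      Arr = {((f, g), (a, b)) | f g a b. f \<in> Arr C \<and> g \<in> Arr C \<and>
               a \<in> Hom C (Dom C f) (Dom C g) \<and> b \<in> Hom C (Cod C f) (Cod C g) \<and>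
               Comp C b f = Comp C g a},
      Dom = (\<lambda>h. fst (fst h)),
      Cod = (\<lambda>h. snd (fst h)),
      Ide = (\<lambda>f. ((f, f), (Ide C (Dom C f), Ide C (Cod C f)))),
      Comp = (\<lambda>k h. ((fst (fst h), snd (fst k)),
               (Comp C (fst (snd k)) (fst (snd h)), Comp C (snd (snd k)) (snd (snd h)))))\<rparr>"


section \<open>Finite products, coproducts and biproducts\<close>

definition initial :: "('o, 'm) cat \<Rightarrow> 'o \<Rightarrow> bool" where
  "initial C z \<longleftrightarrow> z \<in> Obj C \<and> (\<forall>x \<in> Obj C. \<exists>!f. f \<in> Hom C z x)"

definition terminal :: "('o, 'm) cat \<Rightarrow> 'o \<Rightarrow> bool" where
  "terminal C z \<longleftrightarrow> z \<in> Obj C \<and> (\<forall>x \<in> Obj C. \<exists>!f. f \<in> Hom C x z)"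

definition zero_object :: "('o, 'm) cat \<Rightarrow> 'o \<Rightarrow> bool" where
  "zero_object C z \<longleftrightarrow> initial C z \<and> terminal C z"

definition zero_arrow :: "('o, 'm) cat \<Rightarrow> 'm \<Rightarrow> bool" where
  "zero_arrow C f \<longleftrightarrow> f \<in> Arr C \<and> (\<exists>z a b. zero_object C z \<and>
     a \<in> Hom C (Dom C f) z \<and> b \<in> Hom C z (Cod C f) \<and> f = Comp C b a)"

text \<open>The family \<open>X\<close> is indexed by \<open>{0, \<dots>, n - 1}\<close>; its values elsewhere are irrelevant.\<close>

definition is_coproduct ::
    "('o, 'm) cat \<Rightarrow> nat \<Rightarrow> (nat \<Rightarrow> 'o) \<Rightarrow> 'o \<Rightarrow> (nat \<Rightarrow> 'm) \<Rightarrow> bool" where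
  "is_coproduct C n X c \<iota> \<longleftrightarrow>
     c \<in> Obj C \<and> (\<forall>i<n. X i \<in> Obj C \<and> \<iota> i \<in> Hom C (X i) c) \<and>
     (\<forall>y \<in> Obj C. \<forall>t. (\<forall>i<n. t i \<in> Hom C (X i) y) \<longrightarrow>
        (\<exists>!h. h \<in> Hom C c y \<and> (\<forall>i<n. Comp C h (\<iota> i) = t i)))"

definition is_product ::
    "('o, 'm) cat \<Rightarrow> nat \<Rightarrow> (nat \<Rightarrow> 'o) \<Rightarrow> 'o \<Rightarrow> (nat \<Rightarrow> 'm) \<Rightarrow> bool" where
  "is_product C n X p \<pi> \<longleftrightarrow>
     p \<in> Obj C \<and> (\<forall>i<n. X i \<in> Obj C \<and> \<pi> i \<in> Hom C p (X i)) \<and>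
     (\<forall>y \<in> Obj C. \<forall>t. (\<forall>i<n. t i \<in> Hom C y (X i)) \<longrightarrow>
        (\<exists>!h. h \<in> Hom C y p \<and> (\<forall>i<n. Comp C (\<pi> i) h = t i)))"

definition is_biproduct ::
    "('o, 'm) cat \<Rightarrow> nat \<Rightarrow> (nat \<Rightarrow> 'o) \<Rightarrow> 'o \<Rightarrow> (nat \<Rightarrow> 'm) \<Rightarrow> (nat \<Rightarrow> 'm) \<Rightarrow> bool" where
  "is_biproduct C n X b \<iota> \<pi> \<longleftrightarrow> is_coproduct C n X b \<iota> \<and> is_product C n X b \<pi> \<and>
     (\<forall>i<n. \<forall>j<n. if i = j then Comp C (\<pi> i) (\<iota> j) = Ide C (X i)
        else zero_arrow C (Comp C (\<pi> i) (\<iota> j)))"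

definition semiadditive :: "('o, 'm) cat \<Rightarrow> bool" where
  "semiadditive C \<longleftrightarrow> category C \<and> (\<exists>z. zero_object C z) \<and>
     (\<forall>n X. (\<forall>i<n. X i \<in> Obj C) \<longrightarrow> (\<exists>b \<iota> \<pi>. is_biproduct C n X b \<iota> \<pi>))"

text \<open>The canonical map from a coproduct to a product of the same family, given by the
  identity matrix.\<close>

definition canonical_map ::
    "('o, 'm) cat \<Rightarrow> nat \<Rightarrow> (nat \<Rightarrow> 'o) \<Rightarrow> 'o \<Rightarrow> (nat \<Rightarrow> 'm) \<Rightarrow> 'o \<Rightarrow> (nat \<Rightarrow> 'm) \<Rightarrow> 'm \<Rightarrow> bool" where
  "canonical_map C n X c \<iota> p \<pi> \<phi> \<longleftrightarrow> \<phi> \<in> Hom C c p \<and>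
     (\<forall>i<n. \<forall>j<n. if i = j then Comp C (\<pi> i) (Comp C \<phi> (\<iota> j)) = Ide C (X i)
        else zero_arrow C (Comp C (\<pi> i) (Comp C \<phi> (\<iota> j))))"

definition coproducts_canonically_products :: "('o, 'm) cat \<Rightarrow> bool" where
  "coproducts_canonically_products C \<longleftrightarrow>
     (\<forall>n X c \<iota> p \<pi>. is_coproduct C n X c \<iota> \<longrightarrow> is_product C n X p \<pi> \<longrightarrow>
        (\<exists>!\<phi>. canonical_map C n X c \<iota> p \<pi> \<phi>) \<and>
        (\<forall>\<phi>. canonical_map C n X c \<iota> p \<pi> \<phi> \<longrightarrow> is_iso C \<phi>))"

definition preserves_finite_coproducts :: "('o, 'm, 'p, 'n) fctr \<Rightarrow> bool" where
  "preserves_finite_coproducts F \<longleftrightarrow> (\<forall>n X c \<iota>. is_coproduct (Src F) n X c \<iota> \<longrightarrow>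
     is_coproduct (Tgt F) n (\<lambda>i. OMap F (X i)) (OMap F c) (\<lambda>i. AMap F (\<iota> i)))"

definition preserves_finite_products :: "('o, 'm, 'p, 'n) fctr \<Rightarrow> bool" where
  "preserves_finite_products F \<longleftrightarrow> (\<forall>n X p \<pi>. is_product (Src F) n X p \<pi> \<longrightarrow>
     is_product (Tgt F) n (\<lambda>i. OMap F (X i)) (OMap F p) (\<lambda>i. AMap F (\<pi> i)))"

definition preserves_finite_biproducts :: "('o, 'm, 'p, 'n) fctr \<Rightarrow> bool" where
  "preserves_finite_biproducts F \<longleftrightarrow> (\<forall>n X b \<iota> \<pi>. is_biproduct (Src F) n X b \<iota> \<pi> \<longrightarrow>
     is_biproduct (Tgt F) n (\<lambda>i. OMap F (X i)) (OMap F b)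
       (\<lambda>i. AMap F (\<iota> i)) (\<lambda>i. AMap F (\<pi> i)))"


section \<open>Small categories\<close>

text \<open>HOL has no type of all sets, so small categories live in a type closed under pairing:
  \<open>'a code\<close> consists of the atoms from an arbitrary type \<open>'a\<close>, a point and all iterated
  ordered pairs. Which subsets of it count as small is a parameter \<open>S\<close>, subject to the closure
  properties of a universe that the theory of derivators uses (replacement and small unions; closure
  under subsets and binary products follows). For \<open>'a\<close> a Grothendieck universe and \<open>S\<close> the sets of
  smaller cardinality than \<open>'a\<close> this is smallness in the usual sense.\<close>

datatype 'a code = Atom 'a | Pt | Tup (tfst: "'a code") (tsnd: "'a code")

definition smallness :: "('a code set \<Rightarrow> bool) \<Rightarrow> bool" where
  "smallness S \<longleftrightarrow>
     (\<forall>A. finite A \<longrightarrow> S A) \<and>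
     (\<forall>A f. S A \<longrightarrow> S (f ` A)) \<and>
     (\<forall>A B. S A \<longrightarrow> (\<forall>a \<in> A. S (B a)) \<longrightarrow> S (\<Union>a \<in> A. B a))"

type_synonym 'a scat = "('a code, 'a code) cat"
type_synonym 'a sfctr = "('a code, 'a code, 'a code, 'a code) fctr"
type_synonym 'a sntrans = "('a code, 'a code, 'a code, 'a code) ntrans"

definition small_cat :: "('a code set \<Rightarrow> bool) \<Rightarrow> 'a scat \<Rightarrow> bool" where
  "small_cat S J \<longleftrightarrow> category J \<and> S (Obj J) \<and> S (Arr J)"

definition poset_cat :: "'a code set \<Rightarrow> ('a code \<Rightarrow> 'a code \<Rightarrow> bool) \<Rightarrow> 'a scat" where
  "poset_cat P le =
     \<lparr>Obj = P, Arr = {Tup x y | x y. x \<in> P \<and> y \<in> P \<and> le x y},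
      Dom = tfst, Cod = tsnd, Ide = (\<lambda>x. Tup x x), Comp = (\<lambda>g f. Tup (tfst f) (tsnd g))\<rparr>"

definition v0 :: "'a code" where "v0 = Pt"
definition v1 :: "'a code" where "v1 = Tup Pt Pt"

definition empty_cat :: "'a scat" where "empty_cat = poset_cat {} (=)"
definition point_cat :: "'a scat" where "point_cat = poset_cat {Pt} (=)"
definition interval_cat :: "'a scat" where
  "interval_cat = poset_cat {v0, v1} (\<lambda>x y. x = y \<or> x = v0 \<and> y = v1)"

definition sprod_cat :: "'a scat \<Rightarrow> 'a scat \<Rightarrow> 'a scat" where
  "sprod_cat J K =
     \<lparr>Obj = {Tup x y | x y. x \<in> Obj J \<and> y \<in> Obj K},
      Arr = {Tup f g | f g. f \<in> Arr J \<and> g \<in> Arr K},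
      Dom = (\<lambda>h. Tup (Dom J (tfst h)) (Dom K (tsnd h))),
      Cod = (\<lambda>h. Tup (Cod J (tfst h)) (Cod K (tsnd h))),
      Ide = (\<lambda>x. Tup (Ide J (tfst x)) (Ide K (tsnd x))),
      Comp = (\<lambda>k h. Tup (Comp J (tfst k) (tfst h)) (Comp K (tsnd k) (tsnd h)))\<rparr>"

text \<open>Disjoint union; the label \<open>v0\<close> or \<open>v1\<close> in the first entry marks the summand.\<close>

definition sum_cat :: "'a scat \<Rightarrow> 'a scat \<Rightarrow> 'a scat" where
  "sum_cat J K =
     \<lparr>Obj = Tup v0 ` Obj J \<union> Tup v1 ` Obj K,
      Arr = Tup v0 ` Arr J \<union> Tup v1 ` Arr K,
      Dom = (\<lambda>h. Tup (tfst h) (if tfst h = v0 then Dom J (tsnd h) else Dom K (tsnd h))),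
      Cod = (\<lambda>h. Tup (tfst h) (if tfst h = v0 then Cod J (tsnd h) else Cod K (tsnd h))),
      Ide = (\<lambda>x. Tup (tfst x) (if tfst x = v0 then Ide J (tsnd x) else Ide K (tsnd x))),
      Comp = (\<lambda>k h. Tup (tfst h)
        (if tfst h = v0 then Comp J (tsnd k) (tsnd h) else Comp K (tsnd k) (tsnd h)))\<rparr>"

definition sum_inl :: "'a scat \<Rightarrow> 'a scat \<Rightarrow> 'a sfctr" where
  "sum_inl J K = mk_fctr J (sum_cat J K) (Tup v0) (Tup v0)"

definition sum_inr :: "'a scat \<Rightarrow> 'a scat \<Rightarrow> 'a sfctr" where
  "sum_inr J K = mk_fctr K (sum_cat J K) (Tup v1) (Tup v1)"

definition const_fctr :: "'a scat \<Rightarrow> 'a scat \<Rightarrow> 'a code \<Rightarrow> 'a sfctr" where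
  "const_fctr J K k = mk_fctr J K (\<lambda>_. k) (\<lambda>_. Ide K k)"

definition obj_fctr :: "'a scat \<Rightarrow> 'a code \<Rightarrow> 'a sfctr" where
  "obj_fctr K k = const_fctr point_cat K k"

definition to_point :: "'a scat \<Rightarrow> 'a sfctr" where
  "to_point J = const_fctr J point_cat Pt"

definition full_subcat :: "'a scat \<Rightarrow> 'a code set \<Rightarrow> 'a scat" where
  "full_subcat J A =
     J\<lparr>Obj := Obj J \<inter> A, Arr := {f \<in> Arr J. Dom J f \<in> A \<and> Cod J f \<in> A}\<rparr>"

definition inclusion :: "'a scat \<Rightarrow> 'a code set \<Rightarrow> 'a sfctr" where
  "inclusion J A = mk_fctr (full_subcat J A) J (\<lambda>x. x) (\<lambda>f. f)"

text \<open>For \<open>u : J \<rightarrow> K\<close>: objects of \<open>J\<^sub>/\<^sub>k\<close> are \<open>Tup j f\<close> with \<open>f : u j \<rightarrow> k\<close>, objects of \<open>J\<^sub>k\<^sub>/\<close> are \<open>Tup j f\<close>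
  with \<open>f : k \<rightarrow> u j\<close>. In both cases an arrow \<open>x \<rightarrow> y\<close> over \<open>g\<close> is encoded as \<open>Tup (Tup x y) g\<close>.\<close>

definition comma_cat ::
    "'a scat \<Rightarrow> 'a code set \<Rightarrow> ('a code \<Rightarrow> 'a code \<Rightarrow> 'a code \<Rightarrow> bool) \<Rightarrow> 'a scat" where
  "comma_cat J Ob over =
     \<lparr>Obj = Ob,
      Arr = {Tup (Tup x y) g | x y g. x \<in> Ob \<and> y \<in> Ob \<and> g \<in> Hom J (tfst x) (tfst y) \<and> over x y g},
      Dom = (\<lambda>h. tfst (tfst h)),
      Cod = (\<lambda>h. tsnd (tfst h)),
      Ide = (\<lambda>x. Tup (Tup x x) (Ide J (tfst x))),
      Comp = (\<lambda>k h. Tup (Tup (tfst (tfst h)) (tsnd (tfst k))) (Comp J (tsnd k) (tsnd h)))\<rparr>"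

definition over_slice :: "'a sfctr \<Rightarrow> 'a code \<Rightarrow> 'a scat" \<comment> \<open>\<open>J\<^sub>/\<^sub>k\<close>\<close> where
  "over_slice u k = comma_cat (Src u)
     {Tup j f | j f. j \<in> Obj (Src u) \<and> f \<in> Hom (Tgt u) (OMap u j) k}
     (\<lambda>x y g. Comp (Tgt u) (tsnd y) (AMap u g) = tsnd x)"

definition under_slice :: "'a sfctr \<Rightarrow> 'a code \<Rightarrow> 'a scat" \<comment> \<open>\<open>J\<^sub>k\<^sub>/\<close>\<close> where
  "under_slice u k = comma_cat (Src u)
     {Tup j f | j f. j \<in> Obj (Src u) \<and> f \<in> Hom (Tgt u) k (OMap u j)}
     (\<lambda>x y g. Comp (Tgt u) (AMap u g) (tsnd x) = tsnd y)"

definition slice_pr :: "'a scat \<Rightarrow> 'a scat \<Rightarrow> 'a sfctr" where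
  "slice_pr C J = mk_fctr C J tfst tsnd"

definition over_slice_2cell :: "'a sfctr \<Rightarrow> 'a code \<Rightarrow> 'a sntrans" where
  "over_slice_2cell u k = mk_ntrans
     (u \<odot> slice_pr (over_slice u k) (Src u)) (obj_fctr (Tgt u) k \<odot> to_point (over_slice u k)) tsnd"

definition under_slice_2cell :: "'a sfctr \<Rightarrow> 'a code \<Rightarrow> 'a sntrans" where
  "under_slice_2cell u k = mk_ntrans
     (obj_fctr (Tgt u) k \<odot> to_point (under_slice u k)) (u \<odot> slice_pr (under_slice u k) (Src u)) tsnd"


section \<open>Derivators\<close>

text \<open>\<open>Val \<D> J\<close> is the category \<open>\<D>(J)\<close>, \<open>Pull \<D> u\<close> is \<open>u\<^sup>*\<close> and \<open>Pull2 \<D> \<alpha>\<close> is \<open>\<alpha>\<^sup>*\<close>.\<close>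

record ('a, 'o, 'm) prederiv =
  Val :: "'a scat \<Rightarrow> ('o, 'm) cat"
  Pull :: "'a sfctr \<Rightarrow> ('o, 'm, 'o, 'm) fctr"
  Pull2 :: "'a sntrans \<Rightarrow> ('o, 'm, 'o, 'm) ntrans"

definition prederivator :: "('a code set \<Rightarrow> bool) \<Rightarrow> ('a, 'o, 'm) prederiv \<Rightarrow> bool" where
  "prederivator S \<D> \<longleftrightarrow>
     (\<forall>J. small_cat S J \<longrightarrow> category (Val \<D> J)) \<and>
     (\<forall>J K. small_cat S J \<longrightarrow> small_cat S K \<longrightarrow>
        (\<forall>u \<in> functors J K. Pull \<D> u \<in> functors (Val \<D> K) (Val \<D> J)) \<and>
        (\<forall>u \<in> functors J K. \<forall>v \<in> functors J K. \<forall>a \<in> ntranss u v.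
           Pull2 \<D> a \<in> ntranss (Pull \<D> u) (Pull \<D> v)) \<and>
        (\<forall>u \<in> functors J K. Pull2 \<D> (id_ntrans u) = id_ntrans (Pull \<D> u)) \<and>
        (\<forall>u \<in> functors J K. \<forall>v \<in> functors J K. \<forall>w \<in> functors J K.
           \<forall>a \<in> ntranss u v. \<forall>b \<in> ntranss v w.
           Pull2 \<D> (vcomp b a) = vcomp (Pull2 \<D> b) (Pull2 \<D> a))) \<and>
     (\<forall>J. small_cat S J \<longrightarrow> Pull \<D> (id_fctr J) = id_fctr (Val \<D> J)) \<and>
     (\<forall>J K L. small_cat S J \<longrightarrow> small_cat S K \<longrightarrow> small_cat S L \<longrightarrow>
        (\<forall>u \<in> functors J K. \<forall>v \<in> functors K L. Pull \<D> (v \<odot> u) = Pull \<D> u \<odot> Pull \<D> v) \<and>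
        (\<forall>u \<in> functors J K. \<forall>u' \<in> functors J K. \<forall>v \<in> functors K L. \<forall>v' \<in> functors K L.
           \<forall>a \<in> ntranss u u'. \<forall>b \<in> ntranss v v'.
           Pull2 \<D> (hcomp b a) = hcomp (Pull2 \<D> a) (Pull2 \<D> b)))"

definition Der1 :: "('a code set \<Rightarrow> bool) \<Rightarrow> ('a, 'o, 'm) prederiv \<Rightarrow> bool" where
  "Der1 S \<D> \<longleftrightarrow>
     (\<forall>J K. small_cat S J \<longrightarrow> small_cat S K \<longrightarrow>
        is_equivalence (pair_fctr (Pull \<D> (sum_inl J K)) (Pull \<D> (sum_inr J K)))) \<and>
     Obj (Val \<D> empty_cat) \<noteq> {}"

definition Der2 :: "('a code set \<Rightarrow> bool) \<Rightarrow> ('a, 'o, 'm) prederiv \<Rightarrow> bool" where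
  "Der2 S \<D> \<longleftrightarrow> (\<forall>J. small_cat S J \<longrightarrow> (\<forall>f \<in> Arr (Val \<D> J).
     is_iso (Val \<D> J) f \<longleftrightarrow>
     (\<forall>j \<in> Obj J. is_iso (Val \<D> point_cat) (AMap (Pull \<D> (obj_fctr J j)) f))))"

definition Der3 :: "('a code set \<Rightarrow> bool) \<Rightarrow> ('a, 'o, 'm) prederiv \<Rightarrow> bool" where
  "Der3 S \<D> \<longleftrightarrow> (\<forall>J K. small_cat S J \<longrightarrow> small_cat S K \<longrightarrow> (\<forall>u \<in> functors J K.
     (\<exists>L. left_adjoint_of L (Pull \<D> u)) \<and> (\<exists>R. right_adjoint_of R (Pull \<D> u))))"

text \<open>The two mates are required to be isomorphisms for every choice of adjoints, units and
  counits.\<close>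

definition Der4_left :: "('a code set \<Rightarrow> bool) \<Rightarrow> ('a, 'o, 'm) prederiv \<Rightarrow> bool" where
  "Der4_left S \<D> \<longleftrightarrow> (\<forall>J K u k. small_cat S J \<longrightarrow> small_cat S K \<longrightarrow> u \<in> functors J K \<longrightarrow> k \<in> Obj K \<longrightarrow>
     (let E = Val \<D> point_cat;
          p_star = Pull \<D> (to_point (over_slice u k));
          pr_star = Pull \<D> (slice_pr (over_slice u k) J);
          k_star = Pull \<D> (obj_fctr K k);
          \<alpha>_star = Pull2 \<D> (over_slice_2cell u k)
      in \<forall>u_sh \<eta> \<epsilon> p_sh \<eta>' \<epsilon>'.
           adjunction u_sh (Pull \<D> u) \<eta> \<epsilon> \<longrightarrow> adjunction p_sh p_star \<eta>' \<epsilon>' \<longrightarrow>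
           (\<forall>X \<in> Obj (Val \<D> J).
              is_iso E
                (Comp E (Cmp \<epsilon>' (OMap k_star (OMap u_sh X)))
                (Comp E (AMap p_sh (Cmp \<alpha>_star (OMap u_sh X)))
                        (AMap p_sh (AMap pr_star (Cmp \<eta> X))))))))"

definition Der4_right :: "('a code set \<Rightarrow> bool) \<Rightarrow> ('a, 'o, 'm) prederiv \<Rightarrow> bool" where
  "Der4_right S \<D> \<longleftrightarrow> (\<forall>J K u k. small_cat S J \<longrightarrow> small_cat S K \<longrightarrow> u \<in> functors J K \<longrightarrow> k \<in> Obj K \<longrightarrow>
     (let E = Val \<D> point_cat;
          p_star = Pull \<D> (to_point (under_slice u k));
          pr_star = Pull \<D> (slice_pr (under_slice u k) J);
          k_star = Pull \<D> (obj_fctr K k);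
          \<alpha>_star = Pull2 \<D> (under_slice_2cell u k)
      in \<forall>u_lst \<eta> \<epsilon> p_lst \<eta>' \<epsilon>'.
           adjunction (Pull \<D> u) u_lst \<eta> \<epsilon> \<longrightarrow> adjunction p_star p_lst \<eta>' \<epsilon>' \<longrightarrow>
           (\<forall>X \<in> Obj (Val \<D> J).
              is_iso E
                (Comp E (AMap p_lst (AMap pr_star (Cmp \<epsilon> X)))
                (Comp E (AMap p_lst (Cmp \<alpha>_star (OMap u_lst X)))
                        (Cmp \<eta>' (OMap k_star (OMap u_lst X))))))))"

definition derivator :: "('a code set \<Rightarrow> bool) \<Rightarrow> ('a, 'o, 'm) prederiv \<Rightarrow> bool" where
  "derivator S \<D> \<longleftrightarrow>
     prederivator S \<D> \<and> Der1 S \<D> \<and> Der2 S \<D> \<and> Der3 S \<D> \<and> Der4_left S \<D> \<and> Der4_right S \<D>"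


section \<open>Stable derivators\<close>

definition square_cat :: "'a scat" where
  "square_cat = sprod_cat interval_cat interval_cat"

definition span_incl :: "'a sfctr" where
  "span_incl = inclusion square_cat {Tup v0 v0, Tup v1 v0, Tup v0 v1}"

definition cospan_incl :: "'a sfctr" where
  "cospan_incl = inclusion square_cat {Tup v1 v0, Tup v0 v1, Tup v1 v1}"

definition coCartesian :: "('a, 'o, 'm) prederiv \<Rightarrow> 'o \<Rightarrow> bool" where
  "coCartesian \<D> X \<longleftrightarrow> (\<exists>L. left_adjoint_of L (Pull \<D> span_incl) \<and> in_essential_image L X)"

definition Cartesian :: "('a, 'o, 'm) prederiv \<Rightarrow> 'o \<Rightarrow> bool" where
  "Cartesian \<D> X \<longleftrightarrow> (\<exists>R. right_adjoint_of R (Pull \<D> cospan_incl) \<and> in_essential_image R X)"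

definition pointed :: "('a, 'o, 'm) prederiv \<Rightarrow> bool" where
  "pointed \<D> \<longleftrightarrow> (\<exists>z. zero_object (Val \<D> point_cat) z)"

text \<open>\<open>end_fctr v J\<close> is \<open>v \<times> id : J \<cong> e \<times> J \<rightarrow> [1] \<times> J\<close>.\<close>

definition end_fctr :: "'a code \<Rightarrow> 'a scat \<Rightarrow> 'a sfctr" where
  "end_fctr v J = mk_fctr J (sprod_cat interval_cat J) (Tup v) (Tup (Ide interval_cat v))"

definition end_2cell :: "'a scat \<Rightarrow> 'a sntrans" where
  "end_2cell J = mk_ntrans (end_fctr v0 J) (end_fctr v1 J) (\<lambda>j. Tup (Tup v0 v1) (Ide J j))"

definition dia_fctr ::
    "('a, 'o, 'm) prederiv \<Rightarrow> 'a scat \<Rightarrow> ('o, 'm, 'm, ('m \<times> 'm) \<times> ('m \<times> 'm)) fctr" where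
  "dia_fctr \<D> J =
     (let I = Val \<D> (sprod_cat interval_cat J);
          \<kappa> = Pull2 \<D> (end_2cell J)
      in mk_fctr I (arrow_cat (Val \<D> J)) (Cmp \<kappa>)
           (\<lambda>f. ((Cmp \<kappa> (Dom I f), Cmp \<kappa> (Cod I f)),
                 (AMap (Pull \<D> (end_fctr v0 J)) f, AMap (Pull \<D> (end_fctr v1 J)) f))))"

definition strong :: "('a code set \<Rightarrow> bool) \<Rightarrow> ('a, 'o, 'm) prederiv \<Rightarrow> bool" where
  "strong S \<D> \<longleftrightarrow> (\<forall>J. small_cat S J \<longrightarrow>
     full (dia_fctr \<D> J) \<and> essentially_surjective (dia_fctr \<D> J))"

definition stable_derivator :: "('a code set \<Rightarrow> bool) \<Rightarrow> ('a, 'o, 'm) prederiv \<Rightarrow> bool" where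
  "stable_derivator S \<D> \<longleftrightarrow> derivator S \<D> \<and> strong S \<D> \<and> pointed \<D> \<and>
     (\<forall>X \<in> Obj (Val \<D> square_cat). coCartesian \<D> X \<longleftrightarrow> Cartesian \<D> X)"

definition preserves_all_finite :: "('o, 'm, 'p, 'n) fctr \<Rightarrow> bool" where
  "preserves_all_finite F \<longleftrightarrow> preserves_finite_coproducts F \<and> preserves_finite_products F \<and>
     preserves_finite_biproducts F"

end

theory Submission
  imports Defs
begin

text \<open>
  In a derivator every restriction \<open>u\<^sup>*\<close> has adjoints on both sides, so it preserves all coproducts
  and products that exist. Two consequences: the inverse image of a zero object of \<open>\<D>(e)\<close> is a
  zero object of \<open>\<D>(J)\<close>; and the canonical map from a coproduct to a product in \<open>\<D>(J)\<close> is sent by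
  \<open>j\<^sup>*\<close> to the canonical map in \<open>\<D>(e)\<close>, so that by Der2 it is enough to show that the latter is
  invertible. Binary coproducts and products exist because \<open>\<D>(J \<squnion> J)\<close> is \<open>\<D>(J) \<times> \<D>(J)\<close> and
  restriction along the fold functor is the diagonal (\<open>fold_decomposition\<close>).

  The heart is the case of \<open>\<D>(e)\<close>, and it uses stability through one observation. Let \<open>A\<close> and \<open>B\<close>
  be squares that are both Cartesian and coCartesian. Their coproduct is again coCartesian, since
  left adjoints preserve coproducts; their product is Cartesian, since right adjoints preserve
  products, and therefore coCartesian. As \<open>(i\<^sub>\<ulcorner>)\<^sub>!\<close> is full and faithful, a map of coCartesian squares
  is invertible once its restriction to the span \<open>\<ulcorner>\<close> is. So the canonical map at the corner \<open>(1,1)\<close>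
  is invertible as soon as it is so at the other three corners
  (\<open>biCartesian_canonical_iso\<close>), which is the case if at each of them \<open>A\<close> or \<open>B\<close> vanishes. Given \<open>X\<close>
  and \<open>Y\<close> in \<open>\<D>(e)\<close>, suitable squares are
  \<open>B = (0 \<rightarrow> X, 0 \<rightarrow> X)\<close>, constant in the second direction, which is coCartesian
  (\<open>projected_edge_coCartesian\<close>), and the Cartesian square \<open>A\<close> on the cospan \<open>0 \<rightarrow> Y \<leftarrow> 0\<close>
  (\<open>cospan_Cartesian\<close>). The former vanishes at \<open>(0,0)\<close> and \<open>(0,1)\<close>, the latter at \<open>(1,0)\<close> and \<open>(0,1)\<close>,
  and at \<open>(1,1)\<close> they are \<open>X\<close> and \<open>Y\<close>. In other words, with \<open>Y = \<Sigma> Y'\<close>: the cofibre of \<open>Y' \<rightarrow> 0\<close> is \<open>\<Sigma> Y'\<close>, that of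
  \<open>0 \<rightarrow> X\<close> is \<open>X\<close>, the canonical map for these two arrows is invertible for trivial reasons, and in a
  stable derivator the cofibre preserves products as well as coproducts.

  Strongness provides an object of \<open>\<D>([1])\<close> with underlying arrow \<open>0 \<rightarrow> X\<close> (\<open>edge_exists\<close>), and Der4
  shows that \<open>u\<^sub>!\<close> is full and faithful if \<open>u\<close> is (\<open>full_faithful_unit_iso\<close>). Finally, a
  functor between semiadditive categories that preserves finite coproducts preserves biproducts and
  products too (\<open>preserves_all_finite_of_coproducts\<close>); together with its dual this gives the
  assertions about \<open>u\<^sup>*\<close>, \<open>u\<^sub>!\<close> and \<open>u\<^sub>*\<close>.
\<close>


section \<open>Arrows, isomorphisms and functors\<close>

lemma HomD:
  assumes "f \<in> Hom C x y"
  shows "f \<in> Arr C" "Dom C f = x" "Cod C f = y"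
  using assms by (auto simp: Hom_def)

lemma hom_self: "f \<in> Arr C \<Longrightarrow> f \<in> Hom C (Dom C f) (Cod C f)"
  by (simp add: Hom_def)

lemma categoryI:
  assumes "\<And>f x y. f \<in> Hom C x y \<Longrightarrow> x \<in> Obj C \<and> y \<in> Obj C"
    and "\<And>x. x \<in> Obj C \<Longrightarrow> Ide C x \<in> Hom C x x"
    and "\<And>f g x y z. f \<in> Hom C x y \<Longrightarrow> g \<in> Hom C y z \<Longrightarrow> Comp C g f \<in> Hom C x z"
    and "\<And>f x y. f \<in> Hom C x y \<Longrightarrow> Comp C f (Ide C x) = f"
    and "\<And>f x y. f \<in> Hom C x y \<Longrightarrow> Comp C (Ide C y) f = f"
    and "\<And>f g h x y z w. f \<in> Hom C x y \<Longrightarrow> g \<in> Hom C y z \<Longrightarrow> h \<in> Hom C z w \<Longrightarrow>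
      Comp C h (Comp C g f) = Comp C (Comp C h g) f"
  shows "category C"
  unfolding category_def
proof (intro conjI ballI impI)
  fix f g h assume "f \<in> Arr C" "g \<in> Arr C" "h \<in> Arr C" "Cod C f = Dom C g" "Cod C g = Dom C h"
  then show "Comp C h (Comp C g f) = Comp C (Comp C h g) f"
    by (intro assms(6)[where x = "Dom C f" and y = "Cod C f" and z = "Cod C g" and w = "Cod C h"])
      (simp_all add: Hom_def)
next
  fix f g assume "f \<in> Arr C" "g \<in> Arr C" "Cod C f = Dom C g"
  then show "Comp C g f \<in> Hom C (Dom C f) (Cod C g)"
    by (intro assms(3)[where y = "Cod C f"]) (simp_all add: Hom_def)
qed (use assms(1)[OF hom_self] assms(2) assms(4)[OF hom_self] assms(5)[OF hom_self] in simp_all)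

context
  fixes C :: "('o, 'm) cat"
  assumes C: "category C"
begin

lemma hom_obj:
  assumes "f \<in> Hom C x y" shows "x \<in> Obj C" "y \<in> Obj C"
  using C assms unfolding category_def Hom_def by auto

lemma comp_hom: "f \<in> Hom C x y \<Longrightarrow> g \<in> Hom C y z \<Longrightarrow> Comp C g f \<in> Hom C x z"
  using C unfolding category_def Hom_def by auto

lemma ide_hom: "x \<in> Obj C \<Longrightarrow> Ide C x \<in> Hom C x x"
  using C unfolding category_def by auto

lemma comp_ide_right: "f \<in> Hom C x y \<Longrightarrow> Comp C f (Ide C x) = f"
  using C unfolding category_def Hom_def by auto

lemma comp_ide_left: "f \<in> Hom C x y \<Longrightarrow> Comp C (Ide C y) f = f"
  using C unfolding category_def Hom_def by auto

lemma comp_assoc: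
  "f \<in> Hom C x y \<Longrightarrow> g \<in> Hom C y z \<Longrightarrow> h \<in> Hom C z w \<Longrightarrow>
    Comp C (Comp C h g) f = Comp C h (Comp C g f)"
  using C unfolding category_def Hom_def by auto

lemma is_isoE:
  assumes "is_iso C f" "f \<in> Hom C x y"
  obtains g where "g \<in> Hom C y x" "Comp C g f = Ide C x" "Comp C f g = Ide C y" "is_iso C g"
  using assms unfolding is_iso_def Hom_def by auto

lemma is_isoI:
  assumes "f \<in> Hom C x y" "g \<in> Hom C y x" "Comp C g f = Ide C x" "Comp C f g = Ide C y"
  shows "is_iso C f"
  using assms unfolding is_iso_def Hom_def by auto

lemma iso_ide: "x \<in> Obj C \<Longrightarrow> is_iso C (Ide C x)"
  using ide_hom comp_ide_left is_isoI by metis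

lemma iso_comp:
  assumes f: "f \<in> Hom C x y" "is_iso C f" and g: "g \<in> Hom C y z" "is_iso C g"
  shows "is_iso C (Comp C g f)"
proof -
  obtain f' where f': "f' \<in> Hom C y x" "Comp C f' f = Ide C x" "Comp C f f' = Ide C y"
    using is_isoE f by metis
  obtain g' where g': "g' \<in> Hom C z y" "Comp C g' g = Ide C y" "Comp C g g' = Ide C z"
    using is_isoE g by metis
  have "Comp C (Comp C f' g') (Comp C g f) = Comp C f' (Comp C (Comp C g' g) f)"
    by (simp add: comp_assoc[OF f(1) g(1) g'(1)] comp_assoc[OF comp_hom[OF f(1) g(1)] g'(1) f'(1)])
  also have "\<dots> = Ide C x" by (simp add: f'(2) g'(2) comp_ide_left[OF f(1)])
  finally have 1: "Comp C (Comp C f' g') (Comp C g f) = Ide C x" .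
  have "Comp C (Comp C g f) (Comp C f' g') = Comp C g (Comp C (Comp C f f') g')"
    by (simp add: comp_assoc[OF g'(1) f'(1) f(1)] comp_assoc[OF comp_hom[OF g'(1) f'(1)] f(1) g(1)])
  also have "\<dots> = Ide C z" by (simp add: f'(3) g'(3) comp_ide_left[OF g'(1)])
  finally have 2: "Comp C (Comp C g f) (Comp C f' g') = Ide C z" .
  show ?thesis by (rule is_isoI[OF comp_hom[OF f(1) g(1)] comp_hom[OF g'(1) f'(1)] 1 2])
qed

lemma epi_iso:
  assumes f: "f \<in> Hom C x y" "is_iso C f" and gh: "g \<in> Hom C y z" "h \<in> Hom C y z"
    and eq: "Comp C g f = Comp C h f"
  shows "g = h"
proof -
  obtain f' where f': "f' \<in> Hom C y x" "Comp C f f' = Ide C y"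
    using is_isoE f by metis
  have "Comp C (Comp C k f) f' = k" if "k \<in> Hom C y z" for k
    using comp_assoc[OF f'(1) f(1) that] comp_ide_right[OF that] f'(2) by simp
  then show ?thesis using gh eq by metis
qed

lemma mono_iso:
  assumes f: "f \<in> Hom C x y" "is_iso C f" and gh: "g \<in> Hom C z x" "h \<in> Hom C z x"
    and eq: "Comp C f g = Comp C f h"
  shows "g = h"
proof -
  obtain f' where f': "f' \<in> Hom C y x" "Comp C f' f = Ide C x"
    using is_isoE f by metis
  have "Comp C f' (Comp C f k) = k" if "k \<in> Hom C z x" for k
    using comp_assoc[OF that f(1) f'(1)] comp_ide_left[OF that] f'(2) by simp
  then show ?thesis using gh eq by metis
qed

lemma iso_cancel_right:
  assumes f: "f \<in> Hom C x y" "is_iso C f" and g: "g \<in> Hom C y z" "is_iso C (Comp C g f)"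
  shows "is_iso C g"
proof -
  obtain f' where f': "f' \<in> Hom C y x" "Comp C f f' = Ide C y" "is_iso C f'"
    using is_isoE f by metis
  have "g = Comp C (Comp C g f) f'"
    using comp_assoc[OF f'(1) f(1) g(1)] comp_ide_right[OF g(1)] f'(2) by simp
  then show ?thesis using iso_comp[OF f'(1,3) comp_hom[OF f(1) g(1)] g(2)] by simp
qed

lemma iso_cancel_left:
  assumes f: "f \<in> Hom C x y" and g: "g \<in> Hom C y z" "is_iso C g" "is_iso C (Comp C g f)"
  shows "is_iso C f"
proof -
  obtain g' where g': "g' \<in> Hom C z y" "Comp C g' g = Ide C y" "is_iso C g'"
    using is_isoE g by metis
  have "f = Comp C g' (Comp C g f)"
    using comp_assoc[OF f g(1) g'(1)] comp_ide_left[OF f] g'(2) by simp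
  then show ?thesis using iso_comp[OF comp_hom[OF f g(1)] g(3) g'(1,3)] by simp
qed

lemma isomorphic_sym: "isomorphic C x y \<Longrightarrow> isomorphic C y x"
  unfolding isomorphic_def using is_isoE by metis

lemma isomorphic_trans: "isomorphic C x y \<Longrightarrow> isomorphic C y z \<Longrightarrow> isomorphic C x z"
  unfolding isomorphic_def by (meson iso_comp comp_hom)

text \<open>By the Yoneda lemma, an arrow is invertible if composition with it is bijective on all sets of
  arrows; its inverse is the preimage of the identity.\<close>

lemma iso_by_representability:
  assumes f: "f \<in> Hom C x y"
    and bij: "\<And>w g. g \<in> Hom C w y \<Longrightarrow> \<exists>!m. m \<in> Hom C w x \<and> Comp C f m = g"
  shows "is_iso C f"
proof -
  have y: "y \<in> Obj C" "x \<in> Obj C" using hom_obj f by auto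
  obtain m where m: "m \<in> Hom C y x" "Comp C f m = Ide C y" using bij ide_hom y by metis
  have "Comp C f (Comp C m f) = Comp C f (Ide C x)"
    using comp_assoc[OF f m(1) f] m(2) comp_ide_left[OF f] comp_ide_right[OF f] by simp
  then have "Comp C m f = Ide C x"
    using bij[OF f] comp_hom[OF f m(1)] ide_hom[OF y(2)] comp_ide_right[OF f] by metis
  then show ?thesis using is_isoI f m by blast
qed

end

context
  fixes C :: "('o, 'm) cat" and D :: "('p, 'n) cat" and F
  assumes F: "F \<in> functors C D"
begin

lemma fctr_cat: "category C" "category D"
  using F unfolding functors_def is_functor_def by auto

lemma fctr_src: "Src F = C" "Tgt F = D"
  using F unfolding functors_def by auto

lemma fctr_obj: "x \<in> Obj C \<Longrightarrow> OMap F x \<in> Obj D"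
  using F unfolding functors_def is_functor_def by auto

lemma fctr_hom: "f \<in> Hom C x y \<Longrightarrow> AMap F f \<in> Hom D (OMap F x) (OMap F y)"
  using F unfolding functors_def is_functor_def Hom_def by auto

lemma fctr_ide: "x \<in> Obj C \<Longrightarrow> AMap F (Ide C x) = Ide D (OMap F x)"
  using F unfolding functors_def is_functor_def by auto

lemma fctr_comp:
  "f \<in> Hom C x y \<Longrightarrow> g \<in> Hom C y z \<Longrightarrow> AMap F (Comp C g f) = Comp D (AMap F g) (AMap F f)"
  using F unfolding functors_def is_functor_def Hom_def by auto

lemma fctr_iso:
  assumes "is_iso C f" shows "is_iso D (AMap F f)"
proof -
  have f: "f \<in> Hom C (Dom C f) (Cod C f)" using assms unfolding is_iso_def Hom_def by auto
  obtain g where g: "g \<in> Hom C (Cod C f) (Dom C f)" "Comp C g f = Ide C (Dom C f)"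
      "Comp C f g = Ide C (Cod C f)"
    using is_isoE[OF fctr_cat(1) assms f] by metis
  show ?thesis
    using is_isoI[OF fctr_cat(2) fctr_hom[OF f] fctr_hom[OF g(1)]] g f
      fctr_comp fctr_ide hom_obj[OF fctr_cat(1)] by metis
qed

lemma fctr_isomorphic: "isomorphic C x y \<Longrightarrow> isomorphic D (OMap F x) (OMap F y)"
  unfolding isomorphic_def using fctr_iso fctr_hom by metis

end

lemma functorsI:
  assumes "category C" "category D" "Src F = C" "Tgt F = D"
    and "OMap F \<in> extensional (Obj C)" "AMap F \<in> extensional (Arr C)"
    and "\<And>x. x \<in> Obj C \<Longrightarrow> OMap F x \<in> Obj D"
    and "\<And>f x y. f \<in> Hom C x y \<Longrightarrow> AMap F f \<in> Hom D (OMap F x) (OMap F y)"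
    and "\<And>x. x \<in> Obj C \<Longrightarrow> AMap F (Ide C x) = Ide D (OMap F x)"
    and "\<And>f g x y z. f \<in> Hom C x y \<Longrightarrow> g \<in> Hom C y z \<Longrightarrow>
      AMap F (Comp C g f) = Comp D (AMap F g) (AMap F f)"
  shows "F \<in> functors C D"
proof -
  have h: "\<forall>f\<in>Arr C. AMap F f \<in> Hom D (OMap F (Dom C f)) (OMap F (Cod C f))"
    using assms(8) hom_self by metis
  show ?thesis
    unfolding functors_def is_functor_def
    using assms h by (auto simp: Hom_def PiE_def)
qed

lemma mk_fctr_functors:
  assumes "category C" "category D"
    and "\<And>x. x \<in> Obj C \<Longrightarrow> fo x \<in> Obj D"
    and "\<And>f x y. f \<in> Hom C x y \<Longrightarrow> fm f \<in> Hom D (fo x) (fo y)"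
    and "\<And>x. x \<in> Obj C \<Longrightarrow> fm (Ide C x) = Ide D (fo x)"
    and "\<And>f g x y z. f \<in> Hom C x y \<Longrightarrow> g \<in> Hom C y z \<Longrightarrow> fm (Comp C g f) = Comp D (fm g) (fm f)"
  shows "mk_fctr C D fo fm \<in> functors C D"
proof (rule functorsI)
  fix x assume "x \<in> Obj C"
  then show "AMap (mk_fctr C D fo fm) (Ide C x) = Ide D (OMap (mk_fctr C D fo fm) x)"
    using assms(5) ide_hom[OF assms(1)] by (simp add: mk_fctr_def Hom_def)
next
  fix f g x y z assume fg: "f \<in> Hom C x y" "g \<in> Hom C y z"
  then have "Comp C g f \<in> Arr C" using comp_hom[OF assms(1)] HomD by metis
  then show "AMap (mk_fctr C D fo fm) (Comp C g f) =
      Comp D (AMap (mk_fctr C D fo fm) g) (AMap (mk_fctr C D fo fm) f)"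
    using assms(6)[OF fg] fg by (simp add: mk_fctr_def Hom_def)
next
  fix f x y assume f: "f \<in> Hom C x y"
  then show "AMap (mk_fctr C D fo fm) f \<in>
      Hom D (OMap (mk_fctr C D fo fm) x) (OMap (mk_fctr C D fo fm) y)"
    using assms(4)[OF f] hom_obj[OF assms(1) f] by (simp add: mk_fctr_def HomD[OF f])
qed (use assms in \<open>auto simp: mk_fctr_def\<close>)

lemma id_fctr_functors: "category C \<Longrightarrow> id_fctr C \<in> functors C C"
  unfolding id_fctr_def by (rule mk_fctr_functors) auto

lemma comp_fctr_functors:
  assumes F: "F \<in> functors C D" and G: "G \<in> functors D E"
  shows "G \<odot> F \<in> functors C E"
  unfolding comp_fctr_def fctr_src[OF F] fctr_src[OF G]
proof (rule mk_fctr_functors[OF fctr_cat(1)[OF F] fctr_cat(2)[OF G]])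
  fix f g x y z assume f: "f \<in> Hom C x y" and g: "g \<in> Hom C y z"
  show "AMap G (AMap F (Comp C g f)) = Comp E (AMap G (AMap F g)) (AMap G (AMap F f))"
    using fctr_comp[OF F f g] fctr_comp[OF G fctr_hom[OF F f] fctr_hom[OF F g]] by simp
qed (simp_all add: fctr_obj[OF F] fctr_obj[OF G] fctr_hom[OF F] fctr_hom[OF G] fctr_ide[OF F]
    fctr_ide[OF G])

lemma id_fctr_simps [simp]:
  "x \<in> Obj C \<Longrightarrow> OMap (id_fctr C) x = x"
  "f \<in> Arr C \<Longrightarrow> AMap (id_fctr C) f = f"
  "Src (id_fctr C) = C" "Tgt (id_fctr C) = C"
  by (auto simp: id_fctr_def mk_fctr_def)

lemma comp_fctr_obj: "x \<in> Obj (Src F) \<Longrightarrow> OMap (G \<odot> F) x = OMap G (OMap F x)"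
  by (simp add: comp_fctr_def mk_fctr_def)

lemma comp_fctr_arr: "f \<in> Arr (Src F) \<Longrightarrow> AMap (G \<odot> F) f = AMap G (AMap F f)"
  by (simp add: comp_fctr_def mk_fctr_def)

lemma fctr_eqI:
  fixes F G :: "('o, 'm, 'p, 'n) fctr"
  assumes F: "F \<in> functors C D" and G: "G \<in> functors C D"
    and o: "\<And>x. x \<in> Obj C \<Longrightarrow> OMap F x = OMap G x"
    and m: "\<And>f. f \<in> Arr C \<Longrightarrow> AMap F f = AMap G f"
  shows "F = G"
proof -
  have "OMap F = OMap G"
    using F G o unfolding functors_def is_functor_def PiE_def
    by (intro extensionalityI[of _ "Obj C"]) auto
  moreover have "AMap F = AMap G"
    using F G m unfolding functors_def is_functor_def PiE_def
    by (intro extensionalityI[of _ "Arr C"]) auto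
  ultimately show ?thesis using fctr_src[OF F] fctr_src[OF G] by simp
qed

lemma comp_id_fctr:
  assumes F: "F \<in> functors C D"
  shows "F \<odot> id_fctr C = F" "id_fctr D \<odot> F = F"
proof -
  note c = fctr_cat[OF F]
  show "F \<odot> id_fctr C = F"
    by (rule fctr_eqI[OF comp_fctr_functors[OF id_fctr_functors[OF c(1)] F] F])
      (simp_all add: comp_fctr_obj comp_fctr_arr)
  show "id_fctr D \<odot> F = F"
    using fctr_obj[OF F] fctr_hom[OF F]
    by (intro fctr_eqI[OF comp_fctr_functors[OF F id_fctr_functors[OF c(2)]] F])
      (auto simp: comp_fctr_obj comp_fctr_arr fctr_src[OF F] Hom_def)
qed

lemma comp_fctr_assoc:
  assumes F: "F \<in> functors C D" and G: "G \<in> functors D E" and H: "H \<in> functors E A"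
  shows "(H \<odot> G) \<odot> F = H \<odot> (G \<odot> F)"
proof -
  have "AMap F f \<in> Arr D" if "f \<in> Arr C" for f
    using fctr_hom[OF F hom_self[OF that]] by (simp add: Hom_def)
  then show ?thesis
  using fctr_obj[OF F]
  by (intro fctr_eqI[OF comp_fctr_functors[OF F comp_fctr_functors[OF G H]]
        comp_fctr_functors[OF comp_fctr_functors[OF F G] H]])
    (auto simp: comp_fctr_obj comp_fctr_arr fctr_src[OF F] fctr_src[OF G]
        fctr_src[OF comp_fctr_functors[OF F G]])
qed

section \<open>Natural transformations\<close>

context
  fixes C :: "('o, 'm) cat" and D :: "('p, 'n) cat" and F G a
  assumes a: "a \<in> ntranss F G" and F: "F \<in> functors C D"
begin

lemma ntrans_tgt: "G \<in> functors C D"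
  using a F unfolding ntranss_def is_ntrans_def functors_def by auto

lemma ntrans_src: "NSrc a = F" "NTgt a = G"
  using a unfolding ntranss_def by auto

lemma ntrans_hom: "x \<in> Obj C \<Longrightarrow> Cmp a x \<in> Hom D (OMap F x) (OMap G x)"
  using a F unfolding ntranss_def is_ntrans_def functors_def by auto

lemma ntrans_nat:
  "f \<in> Hom C x y \<Longrightarrow> Comp D (AMap G f) (Cmp a x) = Comp D (Cmp a y) (AMap F f)"
  using a F unfolding ntranss_def is_ntrans_def functors_def Hom_def by auto

lemma ntrans_ext: "Cmp a \<in> extensional (Obj C)"
  using a F unfolding ntranss_def is_ntrans_def functors_def by auto

end

lemma ntranssI:
  assumes F: "F \<in> functors C D" and G: "G \<in> functors C D" and "NSrc a = F" "NTgt a = G"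
    and "Cmp a \<in> extensional (Obj C)"
    and "\<And>x. x \<in> Obj C \<Longrightarrow> Cmp a x \<in> Hom D (OMap F x) (OMap G x)"
    and "\<And>f x y. f \<in> Hom C x y \<Longrightarrow> Comp D (AMap G f) (Cmp a x) = Comp D (Cmp a y) (AMap F f)"
  shows "a \<in> ntranss F G"
  using assms unfolding ntranss_def is_ntrans_def functors_def by (auto simp: Hom_def)

lemma mk_ntrans_ntranss:
  assumes F: "F \<in> functors C D" and G: "G \<in> functors C D"
    and "\<And>x. x \<in> Obj C \<Longrightarrow> c x \<in> Hom D (OMap F x) (OMap G x)"
    and "\<And>f x y. f \<in> Hom C x y \<Longrightarrow> Comp D (AMap G f) (c x) = Comp D (c y) (AMap F f)"
  shows "mk_ntrans F G c \<in> ntranss F G"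
  using assms hom_obj[OF fctr_cat(1)[OF F]]
  by (intro ntranssI[OF F G]) (auto simp: mk_ntrans_def fctr_src[OF F])

lemma mk_ntrans_cmp: "x \<in> Obj (Src F) \<Longrightarrow> Cmp (mk_ntrans F G c) x = c x"
  by (simp add: mk_ntrans_def)

lemma ntrans_eqI:
  fixes a b :: "('o, 'm, 'p, 'n) ntrans"
  assumes F: "F \<in> functors C D" and a: "a \<in> ntranss F G" and b: "b \<in> ntranss F G"
    and eq: "\<And>x. x \<in> Obj C \<Longrightarrow> Cmp a x = Cmp b x"
  shows "a = b"
  using extensionalityI[OF ntrans_ext[OF a F] ntrans_ext[OF b F] eq]
    ntrans_src[OF a F] ntrans_src[OF b F] by simp

lemma id_ntrans_ntranss:
  assumes F: "F \<in> functors C D" shows "id_ntrans F \<in> ntranss F F"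
  unfolding id_ntrans_def fctr_src[OF F]
  using comp_ide_left[OF fctr_cat(2)[OF F] fctr_hom[OF F]]
    comp_ide_right[OF fctr_cat(2)[OF F] fctr_hom[OF F]]
  by (intro mk_ntrans_ntranss[OF F F]) (simp_all add: ide_hom[OF fctr_cat(2)[OF F]] fctr_obj[OF F])

lemma id_ntrans_cmp: "x \<in> Obj (Src F) \<Longrightarrow> Cmp (id_ntrans F) x = Ide (Tgt F) (OMap F x)"
  by (simp add: id_ntrans_def mk_ntrans_def)

lemma vcomp_ntranss:
  assumes F: "F \<in> functors C D" and a: "a \<in> ntranss F G" and b: "b \<in> ntranss G H"
  shows "vcomp b a \<in> ntranss F H"
proof -
  have G: "G \<in> functors C D" using ntrans_tgt[OF a F] .
  have H: "H \<in> functors C D" using ntrans_tgt[OF b G] .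
  have D: "category D" using fctr_cat[OF F] by simp
  show ?thesis
    unfolding vcomp_def ntrans_src[OF a F] ntrans_src[OF b G] fctr_src[OF F]
  proof (rule mk_ntrans_ntranss[OF F H])
    show "Comp D (Cmp b x) (Cmp a x) \<in> Hom D (OMap F x) (OMap H x)" if "x \<in> Obj C" for x
      using comp_hom[OF D] ntrans_hom[OF a F that] ntrans_hom[OF b G that] by blast
    fix f x y assume f: "f \<in> Hom C x y"
    have xy: "x \<in> Obj C" "y \<in> Obj C" using hom_obj[OF fctr_cat(1)[OF F] f] by auto
    note h = ntrans_hom[OF a F xy(1)] ntrans_hom[OF a F xy(2)] ntrans_hom[OF b G xy(1)]
      ntrans_hom[OF b G xy(2)] fctr_hom[OF F f] fctr_hom[OF G f] fctr_hom[OF H f]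
    show "Comp D (AMap H f) (Comp D (Cmp b x) (Cmp a x)) =
        Comp D (Comp D (Cmp b y) (Cmp a y)) (AMap F f)"
      using comp_assoc[OF D h(1) h(3) h(7)] comp_assoc[OF D h(1) h(6) h(4)]
        comp_assoc[OF D h(5) h(2) h(4)] ntrans_nat[OF a F f] ntrans_nat[OF b G f] by simp
  qed
qed

lemma hcomp_ntranss:
  assumes F: "F \<in> functors C D" and a: "a \<in> ntranss F F'"
    and G: "G \<in> functors D E" and b: "b \<in> ntranss G G'"
  shows "hcomp b a \<in> ntranss (G \<odot> F) (G' \<odot> F')"
proof -
  have F': "F' \<in> functors C D" using ntrans_tgt[OF a F] .
  have G': "G' \<in> functors D E" using ntrans_tgt[OF b G] .
  have E: "category E" using fctr_cat[OF G] by simp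
  note GF = comp_fctr_functors[OF F G] and GF' = comp_fctr_functors[OF F' G']
  note src = fctr_src[OF F] fctr_src[OF F'] fctr_src[OF G] fctr_src[OF G']
  show ?thesis
    unfolding hcomp_def ntrans_src[OF a F] ntrans_src[OF b G] src
  proof (rule mk_ntrans_ntranss[OF GF GF'])
    fix x assume x: "x \<in> Obj C"
    show "Comp E (Cmp b (OMap F' x)) (AMap G (Cmp a x)) \<in> Hom E (OMap (G \<odot> F) x) (OMap (G' \<odot> F') x)"
      using comp_hom[OF E fctr_hom[OF G ntrans_hom[OF a F x]] ntrans_hom[OF b G fctr_obj[OF F' x]]]
      by (simp add: comp_fctr_obj src x)
  next
    fix f x y assume f: "f \<in> Hom C x y"
    have xy: "x \<in> Obj C" "y \<in> Obj C" using hom_obj[OF fctr_cat(1)[OF F] f] by auto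
    note ax = ntrans_hom[OF a F xy(1)] and ay = ntrans_hom[OF a F xy(2)]
    note bx = ntrans_hom[OF b G fctr_obj[OF F' xy(1)]] and b_y = ntrans_hom[OF b G fctr_obj[OF F' xy(2)]]
    have "Comp E (AMap G' (AMap F' f)) (Comp E (Cmp b (OMap F' x)) (AMap G (Cmp a x))) =
       Comp E (Comp E (AMap G' (AMap F' f)) (Cmp b (OMap F' x))) (AMap G (Cmp a x))"
      using comp_assoc[OF E fctr_hom[OF G ax] bx fctr_hom[OF G' fctr_hom[OF F' f]]] by simp
    also have "\<dots> = Comp E (Comp E (Cmp b (OMap F' y)) (AMap G (AMap F' f))) (AMap G (Cmp a x))"
      using ntrans_nat[OF b G fctr_hom[OF F' f]] by simp
    also have "\<dots> = Comp E (Cmp b (OMap F' y)) (Comp E (AMap G (AMap F' f)) (AMap G (Cmp a x)))"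
      using comp_assoc[OF E fctr_hom[OF G ax] fctr_hom[OF G fctr_hom[OF F' f]] b_y] by simp
    also have "\<dots> = Comp E (Cmp b (OMap F' y)) (Comp E (AMap G (Cmp a y)) (AMap G (AMap F f)))"
      using fctr_comp[OF G ax fctr_hom[OF F' f]] fctr_comp[OF G fctr_hom[OF F f] ay]
        ntrans_nat[OF a F f] by simp
    also have "\<dots> = Comp E (Comp E (Cmp b (OMap F' y)) (AMap G (Cmp a y))) (AMap G (AMap F f))"
      using comp_assoc[OF E fctr_hom[OF G fctr_hom[OF F f]] fctr_hom[OF G ay] b_y] by simp
    finally show "Comp E (AMap (G' \<odot> F') f) (Comp E (Cmp b (OMap F' x)) (AMap G (Cmp a x))) =
       Comp E (Comp E (Cmp b (OMap F' y)) (AMap G (Cmp a y))) (AMap (G \<odot> F) f)"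
      using f by (simp add: comp_fctr_arr src Hom_def)
  qed
qed

lemma vcomp_cmp:
  assumes F: "F \<in> functors C D" and a: "a \<in> ntranss F G" and x: "x \<in> Obj C"
  shows "Cmp (vcomp b a) x = Comp D (Cmp b x) (Cmp a x)"
  using x unfolding vcomp_def by (simp add: mk_ntrans_cmp ntrans_src[OF a F] fctr_src[OF F])

lemma hcomp_cmp:
  assumes F: "F \<in> functors C D" and a: "a \<in> ntranss F F'"
    and G: "G \<in> functors D E" and b: "b \<in> ntranss G G'" and x: "x \<in> Obj C"
  shows "Cmp (hcomp b a) x = Comp E (Cmp b (OMap F' x)) (AMap G (Cmp a x))"
  using x unfolding hcomp_def
  by (simp add: mk_ntrans_cmp ntrans_src[OF a F] ntrans_src[OF b G] fctr_src[OF F] fctr_src[OF G]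
      fctr_src[OF comp_fctr_functors[OF F G]])

lemma whisker_left_cmp:
  assumes F: "F \<in> functors C D" and a: "a \<in> ntranss F F'" and G: "G \<in> functors D E" and x: "x \<in> Obj C"
  shows "Cmp (hcomp (id_ntrans G) a) x = AMap G (Cmp a x)"
  using hcomp_cmp[OF F a G id_ntrans_ntranss[OF G] x] fctr_obj[OF ntrans_tgt[OF a F] x]
    comp_ide_left[OF fctr_cat(2)[OF G] fctr_hom[OF G ntrans_hom[OF a F x]]]
  by (simp add: id_ntrans_cmp fctr_src[OF G])

lemma whisker_right_cmp:
  assumes F: "F \<in> functors C D" and G: "G \<in> functors D E" and b: "b \<in> ntranss G G'" and x: "x \<in> Obj C"
  shows "Cmp (hcomp b (id_ntrans F)) x = Cmp b (OMap F x)"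
  using hcomp_cmp[OF F id_ntrans_ntranss[OF F] G b x] fctr_obj[OF F x] x
    comp_ide_right[OF fctr_cat(2)[OF G] ntrans_hom[OF b G fctr_obj[OF F x]]] fctr_ide[OF G]
  by (simp add: id_ntrans_cmp fctr_src[OF F])

section \<open>Duality\<close>

definition op_cat :: "('o, 'm) cat \<Rightarrow> ('o, 'm) cat" where
  "op_cat C = \<lparr>Obj = Obj C, Arr = Arr C, Dom = Cod C, Cod = Dom C, Ide = Ide C,
     Comp = (\<lambda>g f. Comp C f g)\<rparr>"

definition op_fctr :: "('o, 'm, 'p, 'n) fctr \<Rightarrow> ('o, 'm, 'p, 'n) fctr" where
  "op_fctr F = \<lparr>Src = op_cat (Src F), Tgt = op_cat (Tgt F), OMap = OMap F, AMap = AMap F\<rparr>"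

definition op_ntrans :: "('o, 'm, 'p, 'n) ntrans \<Rightarrow> ('o, 'm, 'p, 'n) ntrans" where
  "op_ntrans a = \<lparr>NSrc = op_fctr (NTgt a), NTgt = op_fctr (NSrc a), Cmp = Cmp a\<rparr>"

lemma op_cat_simps [simp]:
  "Obj (op_cat C) = Obj C" "Arr (op_cat C) = Arr C" "Dom (op_cat C) = Cod C" "Cod (op_cat C) = Dom C"
  "Ide (op_cat C) = Ide C" "Comp (op_cat C) g f = Comp C f g" "Hom (op_cat C) x y = Hom C y x"
  by (auto simp: op_cat_def Hom_def)

lemma op_op_cat [simp]: "op_cat (op_cat C) = C"
  by (simp add: op_cat_def)

lemma op_fctr_simps [simp]:
  "Src (op_fctr F) = op_cat (Src F)" "Tgt (op_fctr F) = op_cat (Tgt F)"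
  "OMap (op_fctr F) = OMap F" "AMap (op_fctr F) = AMap F"
  by (auto simp: op_fctr_def)

lemma op_op_fctr [simp]: "op_fctr (op_fctr F) = F"
  by (simp add: op_fctr_def)

lemma category_op:
  assumes "category C" shows "category (op_cat C)"
  using assms unfolding category_def by (auto simp: Hom_def)

lemma category_op_iff [simp]: "category (op_cat C) \<longleftrightarrow> category C"
  using category_op[of C] category_op[of "op_cat C"] by auto

lemma is_iso_op [simp]: "is_iso (op_cat C) f \<longleftrightarrow> is_iso C f"
  unfolding is_iso_def by auto

lemma isomorphic_op: "category C \<Longrightarrow> isomorphic (op_cat C) x y \<longleftrightarrow> isomorphic C x y"
  using isomorphic_sym[of C] unfolding isomorphic_def by (auto; metis)

lemma op_functors:
  assumes F: "F \<in> functors C D" shows "op_fctr F \<in> functors (op_cat C) (op_cat D)"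
  using F unfolding functors_def is_functor_def by auto

lemma op_comp_fctr: "op_fctr (G \<odot> F) = op_fctr G \<odot> op_fctr F"
  by (simp add: op_fctr_def comp_fctr_def mk_fctr_def)

lemma op_id_fctr: "op_fctr (id_fctr C) = id_fctr (op_cat C)"
  by (simp add: op_fctr_def id_fctr_def mk_fctr_def)

lemma op_ntranss:
  assumes F: "F \<in> functors C D" and a: "a \<in> ntranss F G"
  shows "op_ntrans a \<in> ntranss (op_fctr G) (op_fctr F)"
proof (rule ntranssI[OF op_functors[OF ntrans_tgt[OF a F]] op_functors[OF F]])
  show "Comp (op_cat D) (AMap (op_fctr F) f) (Cmp (op_ntrans a) x) =
      Comp (op_cat D) (Cmp (op_ntrans a) y) (AMap (op_fctr G) f)"
    if "f \<in> Hom (op_cat C) x y" for f x y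
    using ntrans_nat[OF a F] that by (simp add: op_ntrans_def)
qed (use ntrans_src[OF a F] ntrans_hom[OF a F] ntrans_ext[OF a F] in \<open>auto simp: op_ntrans_def\<close>)

lemma zero_object_op [simp]: "zero_object (op_cat C) z \<longleftrightarrow> zero_object C z"
  unfolding zero_object_def initial_def terminal_def by auto

lemma zero_arrow_op [simp]: "zero_arrow (op_cat C) f \<longleftrightarrow> zero_arrow C f"
  unfolding zero_arrow_def by auto

lemma is_product_op: "is_product C n X p \<pi> \<longleftrightarrow> is_coproduct (op_cat C) n X p \<pi>"
  unfolding is_product_def is_coproduct_def by simp

lemma is_coproduct_op: "is_coproduct C n X p \<pi> \<longleftrightarrow> is_product (op_cat C) n X p \<pi>"
  unfolding is_product_def is_coproduct_def by simp

section \<open>Zero objects and zero arrows\<close>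

lemma zero_object_hom_unique:
  assumes "zero_object C z"
  shows "f \<in> Hom C x z \<Longrightarrow> g \<in> Hom C x z \<Longrightarrow> x \<in> Obj C \<Longrightarrow> f = g"
    "f \<in> Hom C z x \<Longrightarrow> g \<in> Hom C z x \<Longrightarrow> x \<in> Obj C \<Longrightarrow> f = g"
  using assms unfolding zero_object_def initial_def terminal_def by auto

lemma zero_object_hom_ex:
  assumes "zero_object C z" "x \<in> Obj C"
  shows "\<exists>f. f \<in> Hom C x z" "\<exists>f. f \<in> Hom C z x"
  using assms unfolding zero_object_def initial_def terminal_def by auto

context
  fixes C :: "('o, 'm) cat"
  assumes C: "category C"
begin

lemma initial_isomorphic:
  assumes "initial C z" "isomorphic C z w" shows "initial C w"
proof -
  obtain e where e: "e \<in> Hom C z w" "is_iso C e" using assms(2) unfolding isomorphic_def by auto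
  obtain e' where e': "e' \<in> Hom C w z" "Comp C e e' = Ide C w"
    using is_isoE[OF C e(2,1)] by metis
  have "\<exists>!f. f \<in> Hom C w x" if x: "x \<in> Obj C" for x
  proof -
    obtain f where f: "f \<in> Hom C z x" using assms(1) x unfolding initial_def by auto
    have "g = h" if "g \<in> Hom C w x" "h \<in> Hom C w x" for g h
      using epi_iso[OF C e that] comp_hom[OF C e(1)] that assms(1) x unfolding initial_def by metis
    then show ?thesis using comp_hom[OF C e'(1) f] by blast
  qed
  then show ?thesis using hom_obj[OF C e(1)] unfolding initial_def by auto
qed

lemma initial_unique:
  assumes "initial C z" "initial C w" shows "isomorphic C z w"
proof -
  obtain f g where f: "f \<in> Hom C z w" and g: "g \<in> Hom C w z"
    using assms unfolding initial_def by blast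
  have "Comp C g f = Ide C z" "Comp C f g = Ide C w"
    using comp_hom[OF C f g] comp_hom[OF C g f] ide_hom[OF C] assms unfolding initial_def by metis+
  then show ?thesis using is_isoI[OF C f g] f unfolding isomorphic_def by auto
qed

end

lemma terminal_isomorphic:
  assumes "category C" "terminal C z" "isomorphic C z w" shows "terminal C w"
  using initial_isomorphic[of "op_cat C" z w] assms isomorphic_op[of C]
  unfolding initial_def terminal_def by simp

lemma zero_object_isomorphic:
  assumes "category C" "zero_object C z" "isomorphic C z w" shows "zero_object C w"
  using assms initial_isomorphic terminal_isomorphic unfolding zero_object_def by metis

lemma initial_is_zero:
  assumes "category C" "zero_object C z" "initial C w" shows "zero_object C w"
  using assms initial_unique zero_object_isomorphic unfolding zero_object_def by metis

context
  fixes C :: "('o, 'm) cat" and z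
  assumes C: "category C" and z: "zero_object C z"
begin

lemma zero_arrow_ex:
  assumes "x \<in> Obj C" "y \<in> Obj C"
  shows "\<exists>f \<in> Hom C x y. zero_arrow C f"
proof -
  obtain a b where ab: "a \<in> Hom C x z" "b \<in> Hom C z y"
    using zero_object_hom_ex[OF z] assms by blast
  then have "Comp C b a \<in> Hom C x y" "zero_arrow C (Comp C b a)"
    using comp_hom[OF C ab] z unfolding zero_arrow_def by (auto simp: Hom_def)
  then show ?thesis by auto
qed

text \<open>Factorizations through two zero objects are compared along the unique arrow between them.\<close>

lemma zero_arrow_unique:
  assumes f: "f \<in> Hom C x y" "zero_arrow C f" and g: "g \<in> Hom C x y" "zero_arrow C g"
  shows "f = g"
proof -
  obtain w a b where 1: "zero_object C w" "a \<in> Hom C x w" "b \<in> Hom C w y" "f = Comp C b a"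
    using f unfolding zero_arrow_def by (auto simp: Hom_def)
  obtain w' a' b' where 2: "zero_object C w'" "a' \<in> Hom C x w'" "b' \<in> Hom C w' y" "g = Comp C b' a'"
    using g unfolding zero_arrow_def by (auto simp: Hom_def)
  have xy: "x \<in> Obj C" "y \<in> Obj C" using hom_obj[OF C f(1)] by auto
  obtain k where k: "k \<in> Hom C w w'"
    using zero_object_hom_ex(1)[OF 2(1)] hom_obj[OF C 1(2)] by auto
  have "Comp C k a = a'" "Comp C b' k = b"
    using zero_object_hom_unique[OF 1(1)] zero_object_hom_unique[OF 2(1)] xy 1 2 k
      comp_hom[OF C 1(2) k] comp_hom[OF C k 2(3)] by auto
  then show ?thesis using 1(4) 2(4) comp_assoc[OF C 1(2) k 2(3)] by simp
qed

lemma zero_arrow_comp_right: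
  assumes f: "f \<in> Hom C x y" "zero_arrow C f" and g: "g \<in> Hom C y w"
  shows "zero_arrow C (Comp C g f)"
proof -
  obtain v a b where 1: "zero_object C v" "a \<in> Hom C x v" "b \<in> Hom C v y" "f = Comp C b a"
    using f unfolding zero_arrow_def by (auto simp: Hom_def)
  have "Comp C g f = Comp C (Comp C g b) a" using comp_assoc[OF C 1(2,3) g] 1(4) by simp
  moreover have "Comp C g b \<in> Hom C v w" "Comp C g f \<in> Hom C x w"
    using comp_hom[OF C 1(3) g] comp_hom[OF C f(1) g] by auto
  ultimately show ?thesis using 1 unfolding zero_arrow_def Hom_def by auto
qed

lemma zero_arrow_zero_object:
  assumes "f \<in> Hom C x y" "zero_object C x \<or> zero_object C y"
  shows "zero_arrow C f"
proof -
  have xy: "x \<in> Obj C" "y \<in> Obj C" using hom_obj[OF C assms(1)] by auto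
  from assms(2) show ?thesis
  proof
    assume "zero_object C x"
    then show ?thesis using assms(1) ide_hom[OF C xy(1)] comp_ide_right[OF C assms(1)]
      unfolding zero_arrow_def by (auto simp: Hom_def; metis)
  next
    assume "zero_object C y"
    then show ?thesis using assms(1) ide_hom[OF C xy(2)] comp_ide_left[OF C assms(1)]
      unfolding zero_arrow_def by (auto simp: Hom_def; metis)
  qed
qed

end

lemma zero_arrow_comp_left:
  assumes C: "category C" and z: "zero_object C z"
    and f: "f \<in> Hom C x y" "zero_arrow C f" and g: "g \<in> Hom C w x"
  shows "zero_arrow C (Comp C f g)"
  using zero_arrow_comp_right[of "op_cat C" z f y x g w] assms by simp

section \<open>Coproducts and products\<close>

lemma is_coproductD:
  assumes "is_coproduct C n X c \<iota>"
  shows "c \<in> Obj C" "\<And>i. i < n \<Longrightarrow> X i \<in> Obj C" "\<And>i. i < n \<Longrightarrow> \<iota> i \<in> Hom C (X i) c"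
  using assms unfolding is_coproduct_def by auto

lemma coproduct_ex:
  assumes "is_coproduct C n X c \<iota>" "y \<in> Obj C" "\<And>i. i < n \<Longrightarrow> t i \<in> Hom C (X i) y"
  obtains h where "h \<in> Hom C c y" "\<And>i. i < n \<Longrightarrow> Comp C h (\<iota> i) = t i"
  using assms unfolding is_coproduct_def by metis

lemma coproduct_eq:
  assumes "category C" "is_coproduct C n X c \<iota>" "h \<in> Hom C c y" "h' \<in> Hom C c y"
    and "\<And>i. i < n \<Longrightarrow> Comp C h (\<iota> i) = Comp C h' (\<iota> i)"
  shows "h = h'"
proof -
  have "\<exists>!k. k \<in> Hom C c y \<and> (\<forall>i<n. Comp C k (\<iota> i) = Comp C h (\<iota> i))"
    using assms(2) hom_obj[OF assms(1,3)] comp_hom[OF assms(1) _ assms(3)]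
    unfolding is_coproduct_def by simp
  then show ?thesis using assms(3-5) by (metis (no_types, lifting))
qed

lemma is_coproductI:
  assumes "category C" "c \<in> Obj C" "\<And>i. i < n \<Longrightarrow> \<iota> i \<in> Hom C (X i) c"
    and ex: "\<And>y t. y \<in> Obj C \<Longrightarrow> (\<And>i. i < n \<Longrightarrow> t i \<in> Hom C (X i) y) \<Longrightarrow>
      \<exists>h \<in> Hom C c y. \<forall>i<n. Comp C h (\<iota> i) = t i"
    and eq: "\<And>y h h'. h \<in> Hom C c y \<Longrightarrow> h' \<in> Hom C c y \<Longrightarrow>
      (\<And>i. i < n \<Longrightarrow> Comp C h (\<iota> i) = Comp C h' (\<iota> i)) \<Longrightarrow> h = h'"
  shows "is_coproduct C n X c \<iota>"
proof -
  have "\<exists>!h. h \<in> Hom C c y \<and> (\<forall>i<n. Comp C h (\<iota> i) = t i)"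
    if y: "y \<in> Obj C" and t: "\<forall>i<n. t i \<in> Hom C (X i) y" for y t
  proof -
    obtain h where "h \<in> Hom C c y" "\<forall>i<n. Comp C h (\<iota> i) = t i" using ex[OF y] t by blast
    then show ?thesis using eq by (intro ex1I[of _ h]) auto
  qed
  then show ?thesis using assms(2,3) hom_obj[OF assms(1)] unfolding is_coproduct_def by blast
qed

context
  fixes C :: "('o, 'm) cat"
  assumes C: "category C"
begin

lemma coproduct_change_vertex:
  assumes c: "is_coproduct C n X c \<iota>" and e: "e \<in> Hom C c d" "is_iso C e"
  shows "is_coproduct C n X d (\<lambda>i. Comp C e (\<iota> i))"
proof -
  note D = is_coproductD[OF c]
  obtain e' where e': "e' \<in> Hom C d c" "Comp C e' e = Ide C c" using is_isoE[OF C e(2,1)] by metis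
  show ?thesis
  proof (rule is_coproductI[OF C])
    show "d \<in> Obj C" using hom_obj[OF C e(1)] by simp
    show "Comp C e (\<iota> i) \<in> Hom C (X i) d" if "i < n" for i using comp_hom[OF C D(3)[OF that] e(1)] .
  next
    fix y t assume y: "y \<in> Obj C" and t: "\<And>i. i < n \<Longrightarrow> t i \<in> Hom C (X i) y"
    obtain h where h: "h \<in> Hom C c y" "\<And>i. i < n \<Longrightarrow> Comp C h (\<iota> i) = t i"
      using coproduct_ex[OF c y t] by blast
    have "Comp C (Comp C h e') (Comp C e (\<iota> i)) = t i" if "i < n" for i
      using comp_assoc[OF C comp_hom[OF C D(3)[OF that] e(1)] e'(1) h(1)]
        comp_assoc[OF C D(3)[OF that] e(1) e'(1)] e'(2) comp_ide_left[OF C D(3)[OF that]] h(2)[OF that]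
      by simp
    then show "\<exists>h\<in>Hom C d y. \<forall>i<n. Comp C h (Comp C e (\<iota> i)) = t i"
      using comp_hom[OF C e'(1) h(1)] by blast
  next
    fix y h h' assume h: "h \<in> Hom C d y" and h': "h' \<in> Hom C d y"
      and eq: "\<And>i. i < n \<Longrightarrow> Comp C h (Comp C e (\<iota> i)) = Comp C h' (Comp C e (\<iota> i))"
    have "Comp C h e = Comp C h' e"
      using eq comp_assoc[OF C D(3) e(1) h] comp_assoc[OF C D(3) e(1) h']
      by (intro coproduct_eq[OF C c comp_hom[OF C e(1) h] comp_hom[OF C e(1) h']]) simp
    then show "h = h'" using epi_iso[OF C e h h'] by simp
  qed
qed

lemma coproduct_change_family:
  assumes c: "is_coproduct C n X c \<iota>"
    and e: "\<And>i. i < n \<Longrightarrow> e i \<in> Hom C (Y i) (X i)" "\<And>i. i < n \<Longrightarrow> is_iso C (e i)"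
  shows "is_coproduct C n Y c (\<lambda>i. Comp C (\<iota> i) (e i))"
proof (rule is_coproductI[OF C])
  note D = is_coproductD[OF c]
  show "c \<in> Obj C" using D by simp
  show "Comp C (\<iota> i) (e i) \<in> Hom C (Y i) c" if "i < n" for i
    using comp_hom[OF C e(1)[OF that] D(3)[OF that]] .
  fix y t assume y: "y \<in> Obj C" and t: "\<And>i. i < n \<Longrightarrow> t i \<in> Hom C (Y i) y"
  have "\<forall>i. \<exists>e'. i < n \<longrightarrow> e' \<in> Hom C (X i) (Y i) \<and> Comp C e' (e i) = Ide C (Y i)"
    using is_isoE[OF C e(2) e(1)] by metis
  then obtain e' where e': "\<And>i. i < n \<Longrightarrow> e' i \<in> Hom C (X i) (Y i)"
      "\<And>i. i < n \<Longrightarrow> Comp C (e' i) (e i) = Ide C (Y i)" by metis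
  obtain h where h: "h \<in> Hom C c y" "\<And>i. i < n \<Longrightarrow> Comp C h (\<iota> i) = Comp C (t i) (e' i)"
    using coproduct_ex[OF c y, of "\<lambda>i. Comp C (t i) (e' i)"] comp_hom[OF C e'(1) t] by metis
  have "Comp C h (Comp C (\<iota> i) (e i)) = t i" if "i < n" for i
    using comp_assoc[OF C e(1)[OF that] D(3)[OF that] h(1)]
      comp_assoc[OF C e(1)[OF that] e'(1)[OF that] t[OF that]] e'(2)[OF that]
      comp_ide_right[OF C t[OF that]] h(2)[OF that] by simp
  then show "\<exists>h\<in>Hom C c y. \<forall>i<n. Comp C h (Comp C (\<iota> i) (e i)) = t i" using h(1) by blast
next
  note D = is_coproductD[OF c]
  fix y h h' assume h: "h \<in> Hom C c y" and h': "h' \<in> Hom C c y"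
    and eq: "\<And>i. i < n \<Longrightarrow> Comp C h (Comp C (\<iota> i) (e i)) = Comp C h' (Comp C (\<iota> i) (e i))"
  show "h = h'"
  proof (rule coproduct_eq[OF C c h h'])
    fix i assume i: "i < n"
    show "Comp C h (\<iota> i) = Comp C h' (\<iota> i)"
      using eq[OF i] comp_assoc[OF C e(1)[OF i] D(3)[OF i] h] comp_assoc[OF C e(1)[OF i] D(3)[OF i] h']
      by (intro epi_iso[OF C e(1)[OF i] e(2)[OF i] comp_hom[OF C D(3)[OF i] h]
            comp_hom[OF C D(3)[OF i] h']]) simp
  qed
qed

lemma coproduct_unique:
  assumes c: "is_coproduct C n X c \<iota>" and d: "is_coproduct C n X d \<kappa>"
  obtains e where "e \<in> Hom C c d" "is_iso C e" "\<And>i. i < n \<Longrightarrow> Comp C e (\<iota> i) = \<kappa> i"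
proof -
  note Dc = is_coproductD[OF c] and Dd = is_coproductD[OF d]
  obtain e where e: "e \<in> Hom C c d" "\<And>i. i < n \<Longrightarrow> Comp C e (\<iota> i) = \<kappa> i"
    using coproduct_ex[OF c Dd(1) Dd(3)] by blast
  obtain e' where e': "e' \<in> Hom C d c" "\<And>i. i < n \<Longrightarrow> Comp C e' (\<kappa> i) = \<iota> i"
    using coproduct_ex[OF d Dc(1) Dc(3)] by blast
  have "Comp C e' e = Ide C c"
    using comp_assoc[OF C Dc(3) e(1) e'(1)] e(2) e'(2) comp_ide_left[OF C Dc(3)]
    by (intro coproduct_eq[OF C c comp_hom[OF C e(1) e'(1)] ide_hom[OF C Dc(1)]]) simp
  moreover have "Comp C e e' = Ide C d"
    using comp_assoc[OF C Dd(3) e'(1) e(1)] e(2) e'(2) comp_ide_left[OF C Dd(3)]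
    by (intro coproduct_eq[OF C d comp_hom[OF C e'(1) e(1)] ide_hom[OF C Dd(1)]]) simp
  ultimately show ?thesis using that e is_isoI[OF C e(1) e'(1)] by blast
qed

lemma coproduct_Suc:
  assumes b: "is_coproduct C n X b \<iota>" and c: "is_coproduct C 2 Y c \<kappa>"
    and Y: "Y 0 = b" "Y 1 = X n"
  shows "is_coproduct C (Suc n) X c (\<lambda>i. if i < n then Comp C (\<kappa> 0) (\<iota> i) else \<kappa> 1)"
proof (rule is_coproductI[OF C])
  note Db = is_coproductD[OF b] and Dc = is_coproductD[OF c]
  have k: "\<kappa> 0 \<in> Hom C b c" "\<kappa> 1 \<in> Hom C (X n) c" using Dc(3)[of 0] Dc(3)[of 1] Y by auto
  show "c \<in> Obj C" using Dc by simp
  show "(if i < n then Comp C (\<kappa> 0) (\<iota> i) else \<kappa> 1) \<in> Hom C (X i) c" if "i < Suc n" for i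
    using comp_hom[OF C Db(3) k(1)] k(2) that by (auto simp: less_Suc_eq)
  fix y t assume y: "y \<in> Obj C" and t: "\<And>i. i < Suc n \<Longrightarrow> t i \<in> Hom C (X i) y"
  obtain g where g: "g \<in> Hom C b y" "\<And>i. i < n \<Longrightarrow> Comp C g (\<iota> i) = t i"
    using coproduct_ex[OF b y, of t] t by auto
  have "(if i = 0 then g else t n) \<in> Hom C (Y i) y" if "i < 2" for i
    using that Y g(1) t[of n] by (auto simp: less_2_cases_iff)
  from coproduct_ex[OF c y this] obtain h where h: "h \<in> Hom C c y"
      "\<And>i. i < 2 \<Longrightarrow> Comp C h (\<kappa> i) = (if i = 0 then g else t n)" by blast
  have "Comp C h (if i < n then Comp C (\<kappa> 0) (\<iota> i) else \<kappa> 1) = t i" if "i < Suc n" for i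
    using that h(2)[of 0] h(2)[of 1] g(2) comp_assoc[OF C Db(3) k(1) h(1)] by (auto simp: less_Suc_eq)
  then show "\<exists>h\<in>Hom C c y. \<forall>i<Suc n. Comp C h (if i < n then Comp C (\<kappa> 0) (\<iota> i) else \<kappa> 1) = t i"
    using h(1) by blast
next
  note Db = is_coproductD[OF b] and Dc = is_coproductD[OF c]
  have k: "\<kappa> 0 \<in> Hom C b c" "\<kappa> 1 \<in> Hom C (X n) c" using Dc(3)[of 0] Dc(3)[of 1] Y by auto
  fix y h h' assume h: "h \<in> Hom C c y" and h': "h' \<in> Hom C c y"
    and eq: "\<And>i. i < Suc n \<Longrightarrow> Comp C h (if i < n then Comp C (\<kappa> 0) (\<iota> i) else \<kappa> 1) =
      Comp C h' (if i < n then Comp C (\<kappa> 0) (\<iota> i) else \<kappa> 1)"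
  have 0: "Comp C h (\<kappa> 0) = Comp C h' (\<kappa> 0)"
  proof (rule coproduct_eq[OF C b comp_hom[OF C k(1) h] comp_hom[OF C k(1) h']])
    fix i assume i: "i < n"
    then show "Comp C (Comp C h (\<kappa> 0)) (\<iota> i) = Comp C (Comp C h' (\<kappa> 0)) (\<iota> i)"
      using eq[of i] comp_assoc[OF C Db(3)[OF i] k(1) h] comp_assoc[OF C Db(3)[OF i] k(1) h'] by simp
  qed
  have 1: "Comp C h (\<kappa> 1) = Comp C h' (\<kappa> 1)" using eq[of n] by simp
  have "Comp C h (\<kappa> i) = Comp C h' (\<kappa> i)" if "i < 2" for i
    using that 0 1 by (auto simp: less_2_cases_iff)
  then show "h = h'" using coproduct_eq[OF C c h h'] by blast
qed

text \<open>There is only one arrow from a zero object to any target, so an arrow out of the coproduct is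
  determined by its restriction to the \<open>j\<close>-th summand, and that restriction is arbitrary.\<close>

lemma coproduct_zero_summands:
  assumes c: "is_coproduct C n X c \<iota>" and j: "j < n"
    and z: "\<And>i. i < n \<Longrightarrow> i \<noteq> j \<Longrightarrow> zero_object C (X i)"
  shows "is_iso C (\<iota> j)"
proof -
  note D = is_coproductD[OF c]
  have "\<forall>i. \<exists>t. i < n \<longrightarrow> t \<in> Hom C (X i) (X j) \<and> (i = j \<longrightarrow> t = Ide C (X j))"
    using zero_object_hom_ex(2)[OF z D(2)[OF j]] ide_hom[OF C D(2)[OF j]] by metis
  then obtain t where t: "\<And>i. i < n \<Longrightarrow> t i \<in> Hom C (X i) (X j)" "t j = Ide C (X j)"
    using j by metis
  obtain h where h: "h \<in> Hom C c (X j)" "\<And>i. i < n \<Longrightarrow> Comp C h (\<iota> i) = t i"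
    using coproduct_ex[OF c D(2)[OF j] t(1)] by blast
  have "Comp C (\<iota> j) h = Ide C c"
  proof (rule coproduct_eq[OF C c comp_hom[OF C h(1) D(3)[OF j]] ide_hom[OF C D(1)]])
    fix i assume i: "i < n"
    have m: "Comp C (Comp C (\<iota> j) h) (\<iota> i) \<in> Hom C (X i) c"
      using comp_hom[OF C D(3)[OF i] comp_hom[OF C h(1) D(3)[OF j]]] .
    show "Comp C (Comp C (\<iota> j) h) (\<iota> i) = Comp C (Ide C c) (\<iota> i)"
    proof (cases "i = j")
      case True
      then show ?thesis
        using comp_assoc[OF C D(3)[OF i] h(1) D(3)[OF j]] h(2)[OF i] t(2)
          comp_ide_right[OF C D(3)[OF j]] comp_ide_left[OF C D(3)[OF j]] by simp
    next
      case False
      then show ?thesis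
        using zero_object_hom_unique(2)[OF z[OF i False] m D(3)[OF i] D(1)]
          comp_ide_left[OF C D(3)[OF i]] by simp
    qed
  qed
  then show ?thesis using is_isoI[OF C D(3)[OF j] h(1)] h(2)[OF j] t(2) by simp
qed

end

lemma is_productD:
  assumes "is_product C n X p \<pi>"
  shows "p \<in> Obj C" "\<And>i. i < n \<Longrightarrow> X i \<in> Obj C" "\<And>i. i < n \<Longrightarrow> \<pi> i \<in> Hom C p (X i)"
  using assms unfolding is_product_def by auto

lemma product_ex:
  assumes "is_product C n X p \<pi>" "y \<in> Obj C" "\<And>i. i < n \<Longrightarrow> t i \<in> Hom C y (X i)"
  obtains h where "h \<in> Hom C y p" "\<And>i. i < n \<Longrightarrow> Comp C (\<pi> i) h = t i"
  using assms unfolding is_product_def by metis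

lemma product_eq:
  assumes "category C" "is_product C n X p \<pi>" "h \<in> Hom C y p" "h' \<in> Hom C y p"
    and "\<And>i. i < n \<Longrightarrow> Comp C (\<pi> i) h = Comp C (\<pi> i) h'"
  shows "h = h'"
  using coproduct_eq[of "op_cat C" n X p \<pi> h y h'] assms by (simp add: is_product_op)

lemma product_change_vertex:
  assumes C: "category C" and p: "is_product C n X p \<pi>" and e: "e \<in> Hom C q p" "is_iso C e"
  shows "is_product C n X q (\<lambda>i. Comp C (\<pi> i) e)"
  using coproduct_change_vertex[of "op_cat C" n X p \<pi> e q] assms by (simp add: is_product_op)

lemma product_change_family:
  assumes C: "category C" and p: "is_product C n X p \<pi>"
    and e: "\<And>i. i < n \<Longrightarrow> e i \<in> Hom C (X i) (Y i)" "\<And>i. i < n \<Longrightarrow> is_iso C (e i)"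
  shows "is_product C n Y p (\<lambda>i. Comp C (e i) (\<pi> i))"
  using coproduct_change_family[of "op_cat C" n X p \<pi> e Y] assms by (simp add: is_product_op)

lemma product_unique:
  assumes C: "category C" and p: "is_product C n X p \<pi>" and q: "is_product C n X q \<rho>"
  obtains e where "e \<in> Hom C p q" "is_iso C e" "\<And>i. i < n \<Longrightarrow> Comp C (\<rho> i) e = \<pi> i"
  using coproduct_unique[of "op_cat C" n X q \<rho> p \<pi>] assms by (auto simp: is_product_op)

lemma product_Suc:
  assumes C: "category C" and b: "is_product C n X b \<pi>" and c: "is_product C 2 Y c \<rho>"
    and Y: "Y 0 = b" "Y 1 = X n"
  shows "is_product C (Suc n) X c (\<lambda>i. if i < n then Comp C (\<pi> i) (\<rho> 0) else \<rho> 1)"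
  using coproduct_Suc[of "op_cat C" n X b \<pi> Y c \<rho>] assms by (simp add: is_product_op cong: if_cong)

lemma product_zero_factors:
  assumes C: "category C" and p: "is_product C n X p \<pi>" and j: "j < n"
    and z: "\<And>i. i < n \<Longrightarrow> i \<noteq> j \<Longrightarrow> zero_object C (X i)"
  shows "is_iso C (\<pi> j)"
  using coproduct_zero_summands[of "op_cat C" n X p \<pi> j] assms by (simp add: is_product_op)

section \<open>Biproducts and semiadditive categories\<close>

text \<open>The entry \<open>M i j\<close> is an arrow \<open>X j \<rightarrow> X i\<close>. This is the common condition in the definitions of
  biproducts and of the canonical map; zero arrows are unique, so it determines \<open>M\<close>.\<close>

definition identity_matrix ::
    "('o, 'm) cat \<Rightarrow> nat \<Rightarrow> (nat \<Rightarrow> 'o) \<Rightarrow> (nat \<Rightarrow> nat \<Rightarrow> 'm) \<Rightarrow> bool" where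
  "identity_matrix C n X M \<longleftrightarrow>
     (\<forall>i<n. \<forall>j<n. if i = j then M i j = Ide C (X i) else zero_arrow C (M i j))"

lemma is_biproduct_iff:
  "is_biproduct C n X b \<iota> \<pi> \<longleftrightarrow> is_coproduct C n X b \<iota> \<and> is_product C n X b \<pi> \<and>
     identity_matrix C n X (\<lambda>i j. Comp C (\<pi> i) (\<iota> j))"
  unfolding is_biproduct_def identity_matrix_def by (intro conj_cong refl)

lemma canonical_map_iff:
  "canonical_map C n X c \<iota> p \<pi> \<phi> \<longleftrightarrow>
     \<phi> \<in> Hom C c p \<and> identity_matrix C n X (\<lambda>i j. Comp C (\<pi> i) (Comp C \<phi> (\<iota> j)))"
  unfolding canonical_map_def identity_matrix_def by (intro conj_cong refl)

lemma identity_matrix_cong: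
  assumes "\<And>i j. i < n \<Longrightarrow> j < n \<Longrightarrow> M i j = N i j"
  shows "identity_matrix C n X M \<longleftrightarrow> identity_matrix C n X N"
  using assms unfolding identity_matrix_def by simp

lemma identity_matrix_op:
  "identity_matrix (op_cat C) n X M \<longleftrightarrow> identity_matrix C n X (\<lambda>i j. M j i)"
  unfolding identity_matrix_def by (simp; metis)

lemma is_biproduct_op: "is_biproduct (op_cat C) n X b \<pi> \<iota> \<longleftrightarrow> is_biproduct C n X b \<iota> \<pi>"
  unfolding is_biproduct_iff identity_matrix_op is_product_op[of C] is_coproduct_op[of C] by auto

lemma semiadditive_op: "semiadditive C \<Longrightarrow> semiadditive (op_cat C)"
  unfolding semiadditive_def by (metis category_op zero_object_op is_biproduct_op op_cat_simps(1))

lemma identity_matrix_unique: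
  assumes C: "category C" "zero_object C z"
    and M: "identity_matrix C n X M" "M i j \<in> Hom C x y" and N: "identity_matrix C n X N" "N i j \<in> Hom C x y"
    and ij: "i < n" "j < n"
  shows "M i j = N i j"
  using zero_arrow_unique[OF C M(2) _ N(2)] M(1) N(1) ij unfolding identity_matrix_def by metis

context
  fixes C :: "('o, 'm) cat" and z
  assumes C: "category C" and z: "zero_object C z"
begin

lemma canonical_map_exists:
  assumes c: "is_coproduct C n X c \<iota>" and p: "is_product C n X p \<pi>"
  obtains \<phi> where "canonical_map C n X c \<iota> p \<pi> \<phi>"
proof -
  note Dc = is_coproductD[OF c] and Dp = is_productD[OF p]
  have "\<forall>i j. \<exists>m. i < n \<longrightarrow> j < n \<longrightarrow> m \<in> Hom C (X j) (X i) \<and>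
      (if i = j then m = Ide C (X i) else zero_arrow C m)"
    using zero_arrow_ex[OF C z Dc(2) Dc(2)] ide_hom[OF C Dc(2)] by (simp split: if_splits; metis)
  then obtain M where M: "\<And>i j. i < n \<Longrightarrow> j < n \<Longrightarrow> M i j \<in> Hom C (X j) (X i)"
      "identity_matrix C n X M" unfolding identity_matrix_def by metis
  have "\<forall>j. \<exists>t. j < n \<longrightarrow> t \<in> Hom C (X j) p \<and> (\<forall>i<n. Comp C (\<pi> i) t = M i j)"
    using product_ex[OF p Dc(2) M(1)] by metis
  then obtain t where t: "\<And>j. j < n \<Longrightarrow> t j \<in> Hom C (X j) p"
      "\<And>i j. i < n \<Longrightarrow> j < n \<Longrightarrow> Comp C (\<pi> i) (t j) = M i j" by metis
  obtain \<phi> where "\<phi> \<in> Hom C c p" "\<And>j. j < n \<Longrightarrow> Comp C \<phi> (\<iota> j) = t j"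
    using coproduct_ex[OF c Dp(1) t(1)] by blast
  then have "canonical_map C n X c \<iota> p \<pi> \<phi>"
    using M(2) t(2) identity_matrix_cong[of n M "\<lambda>i j. Comp C (\<pi> i) (Comp C \<phi> (\<iota> j))" C X]
    unfolding canonical_map_iff by simp
  then show ?thesis using that by blast
qed

lemma canonical_map_unique:
  assumes c: "is_coproduct C n X c \<iota>" and p: "is_product C n X p \<pi>"
    and f: "canonical_map C n X c \<iota> p \<pi> f" and g: "canonical_map C n X c \<iota> p \<pi> g"
  shows "f = g"
proof -
  note Dc = is_coproductD[OF c] and Dp = is_productD[OF p]
  have fg: "f \<in> Hom C c p" "g \<in> Hom C c p" using f g unfolding canonical_map_iff by auto
  show ?thesis
  proof (rule coproduct_eq[OF C c fg])
    fix j assume j: "j < n"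
    note h = comp_hom[OF C Dc(3)[OF j] fg(1)] comp_hom[OF C Dc(3)[OF j] fg(2)]
    show "Comp C f (\<iota> j) = Comp C g (\<iota> j)"
    proof (rule product_eq[OF C p h])
      fix i assume i: "i < n"
      show "Comp C (\<pi> i) (Comp C f (\<iota> j)) = Comp C (\<pi> i) (Comp C g (\<iota> j))"
        using identity_matrix_unique[OF C z _ _ _ _ i j, of X "\<lambda>i j. Comp C (\<pi> i) (Comp C f (\<iota> j))"
            "X j" "X i" "\<lambda>i j. Comp C (\<pi> i) (Comp C g (\<iota> j))"] f g
          comp_hom[OF C h(1) Dp(3)[OF i]] comp_hom[OF C h(2) Dp(3)[OF i]]
        unfolding canonical_map_iff by auto
    qed
  qed
qed

lemma biproduct_of_canonical_iso:
  assumes c: "is_coproduct C n X c \<iota>" and p: "is_product C n X p \<pi>"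
    and f: "canonical_map C n X c \<iota> p \<pi> f" "is_iso C f"
  shows "is_biproduct C n X c \<iota> (\<lambda>i. Comp C (\<pi> i) f)"
proof -
  have fh: "f \<in> Hom C c p" and m: "identity_matrix C n X (\<lambda>i j. Comp C (\<pi> i) (Comp C f (\<iota> j)))"
    using f unfolding canonical_map_iff by auto
  have "Comp C (\<pi> i) (Comp C f (\<iota> j)) = Comp C (Comp C (\<pi> i) f) (\<iota> j)" if "i < n" "j < n" for i j
    using comp_assoc[OF C is_coproductD(3)[OF c that(2)] fh is_productD(3)[OF p that(1)]] by simp
  then show ?thesis
    using product_change_vertex[OF C p fh f(2)] c m unfolding is_biproduct_iff
    by (simp cong: identity_matrix_cong)
qed

text \<open>A biproduct of the family is isomorphic to the given coproduct and to the given product, and the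
  composite isomorphism has the identity matrix, so it is the canonical map.\<close>

lemma canonical_iso_of_biproduct:
  assumes b: "is_biproduct C n X b \<kappa> \<rho>"
    and c: "is_coproduct C n X c \<iota>" and p: "is_product C n X p \<pi>"
    and f: "canonical_map C n X c \<iota> p \<pi> f"
  shows "is_iso C f"
proof -
  have bc: "is_coproduct C n X b \<kappa>" and bp: "is_product C n X b \<rho>"
    and m: "identity_matrix C n X (\<lambda>i j. Comp C (\<rho> i) (\<kappa> j))"
    using b unfolding is_biproduct_iff by auto
  obtain e where e: "e \<in> Hom C c b" "is_iso C e" "\<And>i. i < n \<Longrightarrow> Comp C e (\<iota> i) = \<kappa> i"
    using coproduct_unique[OF C c bc] by blast
  obtain d where d: "d \<in> Hom C b p" "is_iso C d" "\<And>i. i < n \<Longrightarrow> Comp C (\<pi> i) d = \<rho> i"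
    using product_unique[OF C bp p] by blast
  have de: "Comp C d e \<in> Hom C c p" using comp_hom[OF C e(1) d(1)] .
  have "Comp C (\<pi> i) (Comp C (Comp C d e) (\<iota> j)) = Comp C (\<rho> i) (\<kappa> j)" if "i < n" "j < n" for i j
  proof -
    note ij = is_productD(3)[OF p that(1)] is_coproductD(3)[OF c that(2)]
      is_coproductD(3)[OF bc that(2)]
    show ?thesis
      using comp_assoc[OF C ij(2) e(1) d(1)] comp_assoc[OF C ij(3) d(1) ij(1)] e(3) d(3) that by simp
  qed
  then have "canonical_map C n X c \<iota> p \<pi> (Comp C d e)"
    using de m unfolding canonical_map_iff by (simp cong: identity_matrix_cong)
  then have "f = Comp C d e" using canonical_map_unique[OF c p f] by blast
  then show ?thesis using iso_comp[OF C e(1,2) d(1,2)] by simp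
qed

text \<open>The entry \<open>(j, j)\<close> of the matrix is an identity, while \<open>\<iota> j\<close> and \<open>\<pi> j\<close> are isomorphisms because
  the other summands and factors vanish.\<close>

lemma canonical_iso_if_zero:
  assumes c: "is_coproduct C n X c \<iota>" and p: "is_product C n X p \<pi>"
    and f: "canonical_map C n X c \<iota> p \<pi> f" and j: "j < n"
    and zero: "\<And>i. i < n \<Longrightarrow> i \<noteq> j \<Longrightarrow> zero_object C (X i)"
  shows "is_iso C f"
proof -
  note Dc = is_coproductD[OF c] and Dp = is_productD[OF p]
  have fh: "f \<in> Hom C c p" and m: "Comp C (\<pi> j) (Comp C f (\<iota> j)) = Ide C (X j)"
    using f j unfolding canonical_map_iff identity_matrix_def by auto
  have "is_iso C (Comp C f (\<iota> j))"
    using iso_cancel_left[OF C comp_hom[OF C Dc(3)[OF j] fh] Dp(3)[OF j]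
        product_zero_factors[OF C p j zero]] m iso_ide[OF C Dc(2)[OF j]] by simp
  then show ?thesis
    using iso_cancel_right[OF C Dc(3)[OF j] coproduct_zero_summands[OF C c j zero] fh] by simp
qed

lemma biproduct_change_family:
  assumes b: "is_biproduct C n X b \<iota> \<pi>" and iso: "\<And>i. i < n \<Longrightarrow> isomorphic C (X i) (Y i)"
  shows "\<exists>\<iota> \<pi>. is_biproduct C n Y b \<iota> \<pi>"
proof -
  have bc: "is_coproduct C n X b \<iota>" and bp: "is_product C n X b \<pi>"
    and m: "identity_matrix C n X (\<lambda>i j. Comp C (\<pi> i) (\<iota> j))"
    using b unfolding is_biproduct_iff by auto
  note Dc = is_coproductD[OF bc] and Dp = is_productD[OF bp]
  obtain e where e: "\<And>i. i < n \<Longrightarrow> e i \<in> Hom C (X i) (Y i)" "\<And>i. i < n \<Longrightarrow> is_iso C (e i)"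
    using iso unfolding isomorphic_def by metis
  have "\<forall>i. \<exists>d. i < n \<longrightarrow> d \<in> Hom C (Y i) (X i) \<and> Comp C (e i) d = Ide C (Y i) \<and> is_iso C d"
    using is_isoE[OF C e(2) e(1)] by metis
  then obtain d where d: "\<And>i. i < n \<Longrightarrow> d i \<in> Hom C (Y i) (X i)" "\<And>i. i < n \<Longrightarrow> is_iso C (d i)"
     "\<And>i. i < n \<Longrightarrow> Comp C (e i) (d i) = Ide C (Y i)" by metis
  have eq: "Comp C (Comp C (e i) (\<pi> i)) (Comp C (\<iota> j) (d j)) =
      Comp C (e i) (Comp C (Comp C (\<pi> i) (\<iota> j)) (d j))" if "i < n" "j < n" for i j
    using that comp_assoc[OF C comp_hom[OF C d(1) Dc(3)] Dp(3) e(1), of j i]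
      comp_assoc[OF C d(1) Dc(3) Dp(3), of j i] by simp
  have "identity_matrix C n Y (\<lambda>i j. Comp C (Comp C (e i) (\<pi> i)) (Comp C (\<iota> j) (d j)))"
    unfolding identity_matrix_def
  proof (intro allI impI)
    fix i j assume ij: "i < n" "j < n"
    note h = comp_hom[OF C Dc(3)[OF ij(2)] Dp(3)[OF ij(1)]]
    show "if i = j then Comp C (Comp C (e i) (\<pi> i)) (Comp C (\<iota> j) (d j)) = Ide C (Y i)
       else zero_arrow C (Comp C (Comp C (e i) (\<pi> i)) (Comp C (\<iota> j) (d j)))"
    proof (cases "i = j")
      case True
      then have "Comp C (\<pi> i) (\<iota> j) = Ide C (X i)" using m ij unfolding identity_matrix_def by simp
      then show ?thesis
        using True eq[OF ij] ij d(3) comp_ide_left[OF C d(1)] by simp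
    next
      case False
      then have "zero_arrow C (Comp C (\<pi> i) (\<iota> j))" using m ij unfolding identity_matrix_def by simp
      then show ?thesis
        using False eq[OF ij]
          zero_arrow_comp_right[OF C z comp_hom[OF C d(1)[OF ij(2)] h]
            zero_arrow_comp_left[OF C z h _ d(1)[OF ij(2)]] e(1)[OF ij(1)]] by simp
    qed
  qed
  then show ?thesis
    using coproduct_change_family[OF C bc d(1,2)] product_change_family[OF C bp e]
    unfolding is_biproduct_iff by blast
qed

lemma biproduct_Suc:
  assumes b: "is_biproduct C n X b \<iota> \<pi>" and c: "is_biproduct C 2 Y c \<kappa> \<rho>"
    and Y: "Y 0 = b" "Y 1 = X n"
  shows "\<exists>\<iota> \<pi>. is_biproduct C (Suc n) X c \<iota> \<pi>"
proof -
  have b: "is_coproduct C n X b \<iota>" "is_product C n X b \<pi>" and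
    m: "identity_matrix C n X (\<lambda>i j. Comp C (\<pi> i) (\<iota> j))"
    using b unfolding is_biproduct_iff by auto
  have c: "is_coproduct C 2 Y c \<kappa>" "is_product C 2 Y c \<rho>" and
    m2: "identity_matrix C 2 Y (\<lambda>i j. Comp C (\<rho> i) (\<kappa> j))"
    using c unfolding is_biproduct_iff by auto
  note i_h = is_coproductD(3)[OF b(1)] and p_h = is_productD(3)[OF b(2)]
  have k: "\<kappa> 0 \<in> Hom C b c" "\<kappa> 1 \<in> Hom C (X n) c" "\<rho> 0 \<in> Hom C c b" "\<rho> 1 \<in> Hom C c (X n)"
    using is_coproductD(3)[OF c(1), of 0] is_coproductD(3)[OF c(1), of 1]
      is_productD(3)[OF c(2), of 0] is_productD(3)[OF c(2), of 1] Y by auto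
  have r: "Comp C (\<rho> 0) (\<kappa> 0) = Ide C b" "Comp C (\<rho> 1) (\<kappa> 1) = Ide C (X n)"
    "zero_arrow C (Comp C (\<rho> 0) (\<kappa> 1))" "zero_arrow C (Comp C (\<rho> 1) (\<kappa> 0))"
    using m2 Y unfolding identity_matrix_def by (auto simp: less_2_cases_iff)
  have k10: "Comp C (\<rho> 1) (\<kappa> 0) \<in> Hom C b (X n)" and k01: "Comp C (\<rho> 0) (\<kappa> 1) \<in> Hom C (X n) b"
    using comp_hom[OF C k(1) k(4)] comp_hom[OF C k(2) k(3)] by auto
  have 00: "Comp C (Comp C (\<pi> i) (\<rho> 0)) (Comp C (\<kappa> 0) (\<iota> j)) = Comp C (\<pi> i) (\<iota> j)"
    if "i < n" "j < n" for i j
    using comp_assoc[OF C comp_hom[OF C i_h[OF that(2)] k(1)] k(3) p_h[OF that(1)]]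
      comp_assoc[OF C i_h[OF that(2)] k(1) k(3)] r(1) comp_ide_left[OF C i_h[OF that(2)]] by simp
  have 01: "zero_arrow C (Comp C (Comp C (\<pi> i) (\<rho> 0)) (\<kappa> 1))" if "i < n" for i
    using comp_assoc[OF C k(2,3) p_h[OF that]] zero_arrow_comp_right[OF C z k01 r(3) p_h[OF that]]
    by simp
  have 10: "zero_arrow C (Comp C (\<rho> 1) (Comp C (\<kappa> 0) (\<iota> j)))" if "j < n" for j
    using comp_assoc[OF C i_h[OF that] k(1) k(4)] zero_arrow_comp_left[OF C z k10 r(4) i_h[OF that]]
    by simp
  have "identity_matrix C (Suc n) X (\<lambda>i j.
      Comp C (if i < n then Comp C (\<pi> i) (\<rho> 0) else \<rho> 1) (if j < n then Comp C (\<kappa> 0) (\<iota> j) else \<kappa> 1))"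
    using m 00 01 10 r(2) unfolding identity_matrix_def by (auto simp: less_Suc_eq)
  then show ?thesis
    using coproduct_Suc[OF C b(1) c(1) Y] product_Suc[OF C b(2) c(2) Y]
    unfolding is_biproduct_iff by blast
qed

text \<open>A biproduct of \<open>n + 1\<close> objects is the binary biproduct of the last one and a biproduct of the
  others; the zero object is the empty biproduct.\<close>

lemma semiadditiveI:
  assumes bin: "\<And>Y. Y 0 \<in> Obj C \<Longrightarrow> Y 1 \<in> Obj C \<Longrightarrow> \<exists>b \<iota> \<pi>. is_biproduct C 2 Y b \<iota> \<pi>"
  shows "semiadditive C"
proof -
  have "\<exists>b \<iota> \<pi>. is_biproduct C n X b \<iota> \<pi>" if "\<forall>i<n. X i \<in> Obj C" for n X
    using that
  proof (induction n)
    case 0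
    have "is_biproduct C 0 X z \<iota> \<pi>" for \<iota> \<pi>
      using z unfolding is_biproduct_def is_coproduct_def is_product_def zero_object_def initial_def
        terminal_def by simp
    then show ?case by blast
  next
    case (Suc n)
    then obtain b \<iota> \<pi> where b: "is_biproduct C n X b \<iota> \<pi>" by auto
    then have "b \<in> Obj C" unfolding is_biproduct_def is_product_def by simp
    then obtain c \<kappa> \<rho> where "is_biproduct C 2 (\<lambda>i. if i = 0 then b else X n) c \<kappa> \<rho>"
      using bin[of "\<lambda>i. if i = 0 then b else X n"] Suc.prems by auto
    from biproduct_Suc[OF b this] show ?case by auto
  qed
  then show ?thesis using C z unfolding semiadditive_def by blast
qed

end

lemma semiadditive_canonically:
  assumes "semiadditive C" shows "coproducts_canonically_products C"
proof -
  obtain z where C: "category C" and z: "zero_object C z"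
    using assms unfolding semiadditive_def by auto
  have "(\<exists>!f. canonical_map C n X c \<iota> p \<pi> f) \<and> (\<forall>f. canonical_map C n X c \<iota> p \<pi> f \<longrightarrow> is_iso C f)"
    if c: "is_coproduct C n X c \<iota>" and p: "is_product C n X p \<pi>" for n X c \<iota> p \<pi>
  proof -
    obtain b \<kappa> \<rho> where b: "is_biproduct C n X b \<kappa> \<rho>"
      using assms is_coproductD(2)[OF c] unfolding semiadditive_def by metis
    show ?thesis
      using canonical_map_exists[OF C z c p] canonical_map_unique[OF C z c p]
        canonical_iso_of_biproduct[OF C z b c p] by metis
  qed
  then show ?thesis unfolding coproducts_canonically_products_def by blast
qed

text \<open>The isomorphism to a biproduct that matches the inclusions also matches the projections,
  because the matrix of \<open>\<pi>\<close> against \<open>\<iota>\<close> determines \<open>\<pi>\<close>. Hence \<open>\<pi>\<close> inherits the universal property.\<close>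

lemma product_of_identity_matrix:
  assumes sa: "semiadditive C" and c: "is_coproduct C n X c \<iota>"
    and p: "\<And>i. i < n \<Longrightarrow> \<pi> i \<in> Hom C c (X i)"
    and m: "identity_matrix C n X (\<lambda>i j. Comp C (\<pi> i) (\<iota> j))"
  shows "is_product C n X c \<pi>"
proof -
  obtain z where C: "category C" and z: "zero_object C z"
    using sa unfolding semiadditive_def by auto
  obtain b \<kappa> \<rho> where b: "is_biproduct C n X b \<kappa> \<rho>"
    using sa is_coproductD(2)[OF c] unfolding semiadditive_def by metis
  then have bc: "is_coproduct C n X b \<kappa>" and bp: "is_product C n X b \<rho>"
    and bm: "identity_matrix C n X (\<lambda>i j. Comp C (\<rho> i) (\<kappa> j))"
    unfolding is_biproduct_iff by auto
  obtain e where e: "e \<in> Hom C c b" "is_iso C e" "\<And>i. i < n \<Longrightarrow> Comp C e (\<iota> i) = \<kappa> i"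
    using coproduct_unique[OF C c bc] by blast
  have eq: "\<pi> i = Comp C (\<rho> i) e" if i: "i < n" for i
  proof (rule coproduct_eq[OF C c p[OF i] comp_hom[OF C e(1) is_productD(3)[OF bp i]]])
    fix j assume j: "j < n"
    note jh = is_coproductD(3)[OF c j] is_coproductD(3)[OF bc j]
    have "Comp C (\<pi> i) (\<iota> j) = Comp C (\<rho> i) (\<kappa> j)"
      by (rule identity_matrix_unique[OF C z m _ bm _ i j])
        (rule comp_hom[OF C jh(1) p[OF i]] comp_hom[OF C jh(2) is_productD(3)[OF bp i]])+
    then show "Comp C (\<pi> i) (\<iota> j) = Comp C (Comp C (\<rho> i) e) (\<iota> j)"
      using comp_assoc[OF C jh(1) e(1) is_productD(3)[OF bp i]] e(3)[OF j] by simp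
  qed
  show ?thesis
    using product_change_vertex[OF C bp e(1,2)] eq unfolding is_product_def by simp
qed

lemma product_completes_to_biproduct:
  assumes sa: "semiadditive C" and p: "is_product C n X p \<pi>"
  shows "\<exists>\<iota>. is_biproduct C n X p \<iota> \<pi>"
proof -
  obtain z where C: "category C" and z: "zero_object C z"
    using sa unfolding semiadditive_def by auto
  obtain b \<kappa> \<rho> where b: "is_biproduct C n X b \<kappa> \<rho>"
    using sa is_productD(2)[OF p] unfolding semiadditive_def by metis
  then have bc: "is_coproduct C n X b \<kappa>" and bp: "is_product C n X b \<rho>"
    and bm: "identity_matrix C n X (\<lambda>i j. Comp C (\<rho> i) (\<kappa> j))"
    unfolding is_biproduct_iff by auto
  obtain e where e: "e \<in> Hom C b p" "is_iso C e" "\<And>i. i < n \<Longrightarrow> Comp C (\<pi> i) e = \<rho> i"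
    using product_unique[OF C bp p] by blast
  have "Comp C (\<pi> i) (Comp C e (\<kappa> j)) = Comp C (\<rho> i) (\<kappa> j)" if "i < n" "j < n" for i j
    using comp_assoc[OF C is_coproductD(3)[OF bc that(2)] e(1) is_productD(3)[OF p that(1)]]
      e(3)[OF that(1)] by simp
  then have "is_biproduct C n X p (\<lambda>i. Comp C e (\<kappa> i)) \<pi>"
    using coproduct_change_vertex[OF C bc e(1,2)] p bm unfolding is_biproduct_iff
    by (simp cong: identity_matrix_cong)
  then show ?thesis by blast
qed

text \<open>An initial object is an empty coproduct, so its image is initial; in a category with zero object
  every initial object is zero.\<close>

lemma preserves_zero_object:
  assumes F: "F \<in> functors C D" and "preserves_finite_coproducts F"
    and "zero_object C z" "zero_object D w"
  shows "zero_object D (OMap F z)"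
proof -
  have "is_coproduct C 0 (\<lambda>_. z) z (\<lambda>_. Ide C z)"
    using assms(3) unfolding is_coproduct_def zero_object_def initial_def by simp
  then have "is_coproduct D 0 (\<lambda>_. OMap F z) (OMap F z) (\<lambda>_. AMap F (Ide C z))"
    using assms(2)[unfolded preserves_finite_coproducts_def, rule_format,
        of 0 "\<lambda>_. z" z "\<lambda>_. Ide C z"] fctr_src[OF F] by simp
  then have "initial D (OMap F z)" unfolding is_coproduct_def initial_def by simp
  then show ?thesis using initial_is_zero[OF fctr_cat(2)[OF F] assms(4)] by simp
qed

lemma preserves_identity_matrix:
  assumes F: "F \<in> functors C D"
    and pres: "\<And>z. zero_object C z \<Longrightarrow> zero_object D (OMap F z)"
    and M: "identity_matrix C n X M" "\<And>i. i < n \<Longrightarrow> X i \<in> Obj C"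
  shows "identity_matrix D n (\<lambda>i. OMap F (X i)) (\<lambda>i j. AMap F (M i j))"
proof -
  have "zero_arrow D (AMap F f)" if zf: "zero_arrow C f" for f
  proof -
    obtain z a b where 1: "zero_object C z" "a \<in> Hom C (Dom C f) z" "b \<in> Hom C z (Cod C f)"
      "f = Comp C b a" using zf unfolding zero_arrow_def by blast
    have "AMap F f = Comp D (AMap F b) (AMap F a)" using fctr_comp[OF F 1(2,3)] 1(4) by simp
    then show ?thesis
      using zero_arrow_comp_right[OF fctr_cat(2)[OF F] pres[OF 1(1)] fctr_hom[OF F 1(2)]
          zero_arrow_zero_object[OF fctr_cat(2)[OF F] pres[OF 1(1)] fctr_hom[OF F 1(2)]]
          fctr_hom[OF F 1(3)]] pres[OF 1(1)] by simp
  qed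
  then show ?thesis
    using M fctr_ide[OF F] unfolding identity_matrix_def by auto
qed

text \<open>Zero objects are preserved, hence so are zero arrows and identity matrices. The image of a
  biproduct is thus a coproduct with projections whose matrix is the identity, which makes it a
  product. Every product in \<open>C\<close> is part of a biproduct.\<close>

lemma preserves_all_finite_of_coproducts:
  assumes F: "F \<in> functors C D" and pres: "preserves_finite_coproducts F"
    and sa: "semiadditive C" "semiadditive D"
  shows "preserves_all_finite F"
proof -
  note src = fctr_src[OF F]
  obtain w where w: "zero_object D w" using sa(2) unfolding semiadditive_def by auto
  have bi: "is_biproduct D n (\<lambda>i. OMap F (X i)) (OMap F b) (\<lambda>i. AMap F (\<iota> i)) (\<lambda>i. AMap F (\<pi> i))"
    if b: "is_biproduct C n X b \<iota> \<pi>" for n X b \<iota> \<pi>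
  proof -
    have bc: "is_coproduct C n X b \<iota>" and bp: "is_product C n X b \<pi>"
      and m: "identity_matrix C n X (\<lambda>i j. Comp C (\<pi> i) (\<iota> j))"
      using b unfolding is_biproduct_iff by auto
    have "AMap F (Comp C (\<pi> i) (\<iota> j)) = Comp D (AMap F (\<pi> i)) (AMap F (\<iota> j))" if "i < n" "j < n" for i j
      using fctr_comp[OF F is_coproductD(3)[OF bc that(2)] is_productD(3)[OF bp that(1)]] .
    then have m': "identity_matrix D n (\<lambda>i. OMap F (X i)) (\<lambda>i j. Comp D (AMap F (\<pi> i)) (AMap F (\<iota> j)))"
      using preserves_identity_matrix[OF F preserves_zero_object[OF F pres _ w] m
          is_coproductD(2)[OF bc]] by (simp cong: identity_matrix_cong)
    have c': "is_coproduct D n (\<lambda>i. OMap F (X i)) (OMap F b) (\<lambda>i. AMap F (\<iota> i))"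
      using pres bc src unfolding preserves_finite_coproducts_def by auto
    show ?thesis
      using product_of_identity_matrix[OF sa(2) c' _ m'] fctr_hom[OF F is_productD(3)[OF bp]] c' m'
      unfolding is_biproduct_iff by simp
  qed
  have "preserves_finite_products F"
    unfolding preserves_finite_products_def src
    using product_completes_to_biproduct[OF sa(1)] bi unfolding is_biproduct_def by blast
  then show ?thesis
    using pres bi src unfolding preserves_all_finite_def preserves_finite_biproducts_def by auto
qed

lemma preserves_finite_products_op:
  "preserves_finite_products F \<longleftrightarrow> preserves_finite_coproducts (op_fctr F)"
  unfolding preserves_finite_products_def preserves_finite_coproducts_def is_product_op by simp

lemma preserves_all_finite_of_products:
  assumes F: "F \<in> functors C D" and pres: "preserves_finite_products F"
    and sa: "semiadditive C" "semiadditive D"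
  shows "preserves_all_finite F"
proof -
  have all: "preserves_all_finite (op_fctr F)"
    using preserves_all_finite_of_coproducts[OF op_functors[OF F]
        pres[unfolded preserves_finite_products_op] semiadditive_op[OF sa(1)] semiadditive_op[OF sa(2)]] .
  then have "preserves_finite_coproducts F"
    using preserves_finite_products_op[of "op_fctr F"] unfolding preserves_all_finite_def by simp
  moreover have "preserves_finite_biproducts F"
    using all unfolding preserves_all_finite_def preserves_finite_biproducts_def
    by (simp add: is_biproduct_op)
  ultimately show ?thesis using pres unfolding preserves_all_finite_def by simp
qed

section \<open>Universal arrows and adjoint functors\<close>

text \<open>An initial object of the comma category of \<open>x\<close> over \<open>F\<close>: the value at \<open>x\<close> of a left adjoint of \<open>F\<close>,
  without a choice of the adjoint. Applied to \<open>op_fctr F\<close> it describes the values of a right adjoint.\<close>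

definition universal_arrow :: "('o, 'm, 'p, 'n) fctr \<Rightarrow> 'p \<Rightarrow> 'o \<Rightarrow> 'n \<Rightarrow> bool" where
  "universal_arrow F x c u \<longleftrightarrow> c \<in> Obj (Src F) \<and> u \<in> Hom (Tgt F) x (OMap F c) \<and>
     (\<forall>d \<in> Obj (Src F). \<forall>g \<in> Hom (Tgt F) x (OMap F d).
        \<exists>!h. h \<in> Hom (Src F) c d \<and> Comp (Tgt F) (AMap F h) u = g)"

context
  fixes C :: "('o, 'm) cat" and D :: "('p, 'n) cat" and F
  assumes F: "F \<in> functors C D"
begin

lemma universal_arrowD:
  assumes "universal_arrow F x c u"
  shows "c \<in> Obj C" "u \<in> Hom D x (OMap F c)" "x \<in> Obj D"
  using assms hom_obj[OF fctr_cat(2)[OF F]] unfolding universal_arrow_def fctr_src[OF F] by auto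

lemma universal_arrow_ex:
  assumes "universal_arrow F x c u" "g \<in> Hom D x (OMap F d)" "d \<in> Obj C"
  obtains h where "h \<in> Hom C c d" "Comp D (AMap F h) u = g"
  using assms unfolding universal_arrow_def fctr_src[OF F] by metis

lemma universal_arrow_eq:
  assumes "universal_arrow F x c u" "h \<in> Hom C c d" "h' \<in> Hom C c d"
    and eq: "Comp D (AMap F h) u = Comp D (AMap F h') u"
  shows "h = h'"
proof -
  have "Comp D (AMap F h) u \<in> Hom D x (OMap F d)"
    using comp_hom[OF fctr_cat(2)[OF F] universal_arrowD(2)[OF assms(1)] fctr_hom[OF F assms(2)]] .
  then have "\<exists>!k. k \<in> Hom C c d \<and> Comp D (AMap F k) u = Comp D (AMap F h) u"
    using assms(1) hom_obj(2)[OF fctr_cat(1)[OF F] assms(2)]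
    unfolding universal_arrow_def fctr_src[OF F] by blast
  then show ?thesis using assms(2,3) eq by metis
qed

lemma universal_arrowI:
  assumes "c \<in> Obj C" "u \<in> Hom D x (OMap F c)"
    and "\<And>d g. d \<in> Obj C \<Longrightarrow> g \<in> Hom D x (OMap F d) \<Longrightarrow> \<exists>h \<in> Hom C c d. Comp D (AMap F h) u = g"
    and "\<And>d h h'. h \<in> Hom C c d \<Longrightarrow> h' \<in> Hom C c d \<Longrightarrow>
      Comp D (AMap F h) u = Comp D (AMap F h') u \<Longrightarrow> h = h'"
  shows "universal_arrow F x c u"
  using assms unfolding universal_arrow_def fctr_src[OF F] by metis

lemma universal_arrow_unique:
  assumes c: "universal_arrow F x c u" and d: "universal_arrow F x d v"
  obtains e where "e \<in> Hom C c d" "is_iso C e" "Comp D (AMap F e) u = v"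
proof -
  note C = fctr_cat[OF F]
  note Dc = universal_arrowD[OF c] and Dd = universal_arrowD[OF d]
  obtain e where e: "e \<in> Hom C c d" "Comp D (AMap F e) u = v"
    using universal_arrow_ex[OF c Dd(2,1)] by blast
  obtain e' where e': "e' \<in> Hom C d c" "Comp D (AMap F e') v = u"
    using universal_arrow_ex[OF d Dc(2,1)] by blast
  have "Comp C e' e = Ide C c"
    using comp_assoc[OF C(2) Dc(2) fctr_hom[OF F e(1)] fctr_hom[OF F e'(1)]]
      fctr_comp[OF F e(1) e'(1)] fctr_ide[OF F Dc(1)] comp_ide_left[OF C(2) Dc(2)] e(2) e'(2)
    by (intro universal_arrow_eq[OF c comp_hom[OF C(1) e(1) e'(1)] ide_hom[OF C(1) Dc(1)]]) simp
  moreover have "Comp C e e' = Ide C d"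
    using comp_assoc[OF C(2) Dd(2) fctr_hom[OF F e'(1)] fctr_hom[OF F e(1)]]
      fctr_comp[OF F e'(1) e(1)] fctr_ide[OF F Dd(1)] comp_ide_left[OF C(2) Dd(2)] e(2) e'(2)
    by (intro universal_arrow_eq[OF d comp_hom[OF C(1) e'(1) e(1)] ide_hom[OF C(1) Dd(1)]]) simp
  ultimately show ?thesis using that e is_isoI[OF C(1) e(1) e'(1)] by blast
qed

lemma universal_arrow_change:
  assumes c: "universal_arrow F x c u" and e: "e \<in> Hom C c d" "is_iso C e"
  shows "universal_arrow F x d (Comp D (AMap F e) u)"
proof -
  note C = fctr_cat[OF F]
  note Dc = universal_arrowD[OF c]
  obtain e' where e': "e' \<in> Hom C d c" "Comp C e' e = Ide C c" using is_isoE[OF C(1) e(2,1)] by metis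
  have eq: "Comp D (AMap F h) (Comp D (AMap F e) u) = Comp D (AMap F (Comp C h e)) u"
    if "h \<in> Hom C d y" for h y
    using comp_assoc[OF C(2) Dc(2) fctr_hom[OF F e(1)] fctr_hom[OF F that]]
      fctr_comp[OF F e(1) that] by simp
  show ?thesis
  proof (rule universal_arrowI)
    show "d \<in> Obj C" using hom_obj[OF C(1) e(1)] by simp
    show "Comp D (AMap F e) u \<in> Hom D x (OMap F d)"
      using comp_hom[OF C(2) Dc(2) fctr_hom[OF F e(1)]] .
  next
    fix y g assume y: "y \<in> Obj C" and g: "g \<in> Hom D x (OMap F y)"
    obtain h where h: "h \<in> Hom C c y" "Comp D (AMap F h) u = g"
      using universal_arrow_ex[OF c g y] by blast
    have "Comp C (Comp C h e') e = h"
      using comp_assoc[OF C(1) e(1) e'(1) h(1)] e'(2) comp_ide_right[OF C(1) h(1)] by simp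
    then show "\<exists>h\<in>Hom C d y. Comp D (AMap F h) (Comp D (AMap F e) u) = g"
      using eq[OF comp_hom[OF C(1) e'(1) h(1)]] h(2) comp_hom[OF C(1) e'(1) h(1)] by metis
  next
    fix y h h' assume h: "h \<in> Hom C d y" and h': "h' \<in> Hom C d y"
      and "Comp D (AMap F h) (Comp D (AMap F e) u) = Comp D (AMap F h') (Comp D (AMap F e) u)"
    then have "Comp C h e = Comp C h' e"
      using eq[OF h] eq[OF h'] universal_arrow_eq[OF c comp_hom[OF C(1) e(1) h] comp_hom[OF C(1) e(1) h']]
      by simp
    then show "h = h'" using epi_iso[OF C(1) e h h'] by simp
  qed
qed

text \<open>Between objects that receive an invertible universal arrow, \<open>F\<close> is full and faithful, so it
  reflects isomorphisms there.\<close>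

lemma universal_arrow_reflects_iso:
  assumes c: "universal_arrow F x c u" "is_iso D u" and d: "universal_arrow F y d v" "is_iso D v"
    and f: "f \<in> Hom C c d" "is_iso D (AMap F f)"
  shows "is_iso C f"
proof -
  note C = fctr_cat[OF F]
  note Dc = universal_arrowD[OF c(1)] and Dd = universal_arrowD[OF d(1)]
  note Ff = fctr_hom[OF F f(1)]
  obtain k where k: "k \<in> Hom D (OMap F d) (OMap F c)" "Comp D k (AMap F f) = Ide D (OMap F c)"
      "Comp D (AMap F f) k = Ide D (OMap F d)"
    using is_isoE[OF C(2) f(2) Ff] by metis
  obtain h where h: "h \<in> Hom C d c" "Comp D (AMap F h) v = Comp D k v"
    using universal_arrow_ex[OF d(1) comp_hom[OF C(2) Dd(2) k(1)] Dc(1)] by blast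
  have Fh: "AMap F h = k" using epi_iso[OF C(2) Dd(2) d(2) fctr_hom[OF F h(1)] k(1) h(2)] .
  have "Comp C h f = Ide C c"
    using fctr_comp[OF F f(1) h(1)] Fh k(2) fctr_ide[OF F Dc(1)]
    by (intro universal_arrow_eq[OF c(1) comp_hom[OF C(1) f(1) h(1)] ide_hom[OF C(1) Dc(1)]]) simp
  moreover have "Comp C f h = Ide C d"
    using fctr_comp[OF F h(1) f(1)] Fh k(3) fctr_ide[OF F Dd(1)]
    by (intro universal_arrow_eq[OF d(1) comp_hom[OF C(1) h(1) f(1)] ide_hom[OF C(1) Dd(1)]]) simp
  ultimately show ?thesis using is_isoI[OF C(1) f(1) h(1)] by simp
qed

lemma universal_arrow_iso_unique:
  assumes c: "universal_arrow F x c u" "is_iso D u" and d: "universal_arrow F x d v"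
  shows "is_iso D v"
proof -
  obtain e where e: "e \<in> Hom C c d" "is_iso C e" "Comp D (AMap F e) u = v"
    using universal_arrow_unique[OF c(1) d] by blast
  then show ?thesis
    using iso_comp[OF fctr_cat(2)[OF F] universal_arrowD(2)[OF c(1)] c(2) fctr_hom[OF F e(1)]
        fctr_iso[OF F e(2)]] by simp
qed

text \<open>Arrows out of a coproduct are families of arrows out of the summands, on either side of the
  correspondence. This says that the essential image of a left adjoint is closed under coproducts
  and, applied to opposite categories, that of a right adjoint is closed under products.\<close>

lemma coproduct_universal_arrow:
  assumes c: "is_coproduct C n X c \<iota>" and u: "\<And>i. i < n \<Longrightarrow> universal_arrow F (x i) (X i) (u i)"
    and d: "is_coproduct D n x d \<kappa>"
  shows "\<exists>v. universal_arrow F d c v"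
proof -
  note C = fctr_cat[OF F]
  note Dc = is_coproductD[OF c] and Dd = is_coproductD[OF d] and Du = universal_arrowD[OF u]
  note Fi = fctr_hom[OF F Dc(3)]
  obtain v where v: "v \<in> Hom D d (OMap F c)"
      "\<And>i. i < n \<Longrightarrow> Comp D v (\<kappa> i) = Comp D (AMap F (\<iota> i)) (u i)"
    using coproduct_ex[OF d fctr_obj[OF F Dc(1)], of "\<lambda>i. Comp D (AMap F (\<iota> i)) (u i)"]
      comp_hom[OF C(2) Du(2) Fi] by metis
  have eq: "Comp D (Comp D (AMap F h) v) (\<kappa> i) = Comp D (AMap F (Comp C h (\<iota> i))) (u i)"
    if "h \<in> Hom C c y" "i < n" for h y i
    using comp_assoc[OF C(2) Dd(3)[OF that(2)] v(1) fctr_hom[OF F that(1)]] v(2)[OF that(2)]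
      comp_assoc[OF C(2) Du(2)[OF that(2)] Fi[OF that(2)] fctr_hom[OF F that(1)]]
      fctr_comp[OF F Dc(3)[OF that(2)] that(1)] by simp
  have "universal_arrow F d c v"
  proof (rule universal_arrowI[OF Dc(1) v(1)])
    fix y g assume y: "y \<in> Obj C" and g: "g \<in> Hom D d (OMap F y)"
    have "\<forall>i. \<exists>h. i < n \<longrightarrow> h \<in> Hom C (X i) y \<and> Comp D (AMap F h) (u i) = Comp D g (\<kappa> i)"
      using universal_arrow_ex[OF u comp_hom[OF C(2) Dd(3) g] y] by metis
    then obtain k where k: "\<And>i. i < n \<Longrightarrow> k i \<in> Hom C (X i) y"
      "\<And>i. i < n \<Longrightarrow> Comp D (AMap F (k i)) (u i) = Comp D g (\<kappa> i)" by metis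
    obtain h where h: "h \<in> Hom C c y" "\<And>i. i < n \<Longrightarrow> Comp C h (\<iota> i) = k i"
      using coproduct_ex[OF c y k(1)] by blast
    have "Comp D (AMap F h) v = g"
      using eq[OF h(1)] h(2) k(2)
      by (intro coproduct_eq[OF C(2) d comp_hom[OF C(2) v(1) fctr_hom[OF F h(1)]] g]) simp
    then show "\<exists>h\<in>Hom C c y. Comp D (AMap F h) v = g" using h(1) by blast
  next
    fix y h h' assume h: "h \<in> Hom C c y" and h': "h' \<in> Hom C c y"
      and "Comp D (AMap F h) v = Comp D (AMap F h') v"
    then have "Comp D (AMap F (Comp C h (\<iota> i))) (u i) = Comp D (AMap F (Comp C h' (\<iota> i))) (u i)"
      if "i < n" for i using eq[OF h that] eq[OF h' that] by simp
    then show "h = h'"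
      using universal_arrow_eq[OF u comp_hom[OF C(1) Dc(3) h] comp_hom[OF C(1) Dc(3) h']]
      by (intro coproduct_eq[OF C(1) c h h']) simp
  qed
  then show ?thesis by blast
qed

text \<open>If \<open>F\<close> has a left adjoint \<open>L\<close> with invertible unit \<open>1 \<rightarrow> F L\<close> and a right adjoint \<open>R\<close>, then the
  counit \<open>F R \<rightarrow> 1\<close> is invertible as well: \<open>Hom(w, F R b) \<cong> Hom(L w, R b) \<cong> Hom(F L w, b) \<cong> Hom(w, b)\<close> is composition
  with the counit.\<close>

lemma adjoint_triple_counit_iso:
  assumes left: "\<And>w. w \<in> Obj D \<Longrightarrow> \<exists>c u. universal_arrow F w c u \<and> is_iso D u"
    and t: "universal_arrow (op_fctr F) b t e"
  shows "is_iso D e"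
proof -
  note C = fctr_cat[OF F]
  have e: "e \<in> Hom D (OMap F t) b" and tO: "t \<in> Obj C"
    and ex: "\<And>d g. d \<in> Obj C \<Longrightarrow> g \<in> Hom D (OMap F d) b \<Longrightarrow> 
       \<exists>!h. h \<in> Hom C d t \<and> Comp D e (AMap F h) = g"
    using t unfolding universal_arrow_def by (auto simp: fctr_src[OF F])
  show ?thesis
  proof (rule iso_by_representability[OF C(2) e])
    fix w g assume g: "g \<in> Hom D w b"
    then have w: "w \<in> Obj D" using hom_obj[OF C(2)] by auto
    obtain c u where cu: "universal_arrow F w c u" and u_iso: "is_iso D u" using left[OF w] by auto
    note Dc = universal_arrowD[OF cu]
    obtain v where v: "v \<in> Hom D (OMap F c) w" "Comp D v u = Ide D w"
      using is_isoE[OF C(2) u_iso Dc(2)] by metis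
    obtain h where h: "h \<in> Hom C c t" "Comp D e (AMap F h) = Comp D g v"
      using ex[OF Dc(1) comp_hom[OF C(2) v(1) g]] by blast
    have 1: "Comp D e (Comp D (AMap F h) u) = g"
      using comp_assoc[OF C(2) Dc(2) fctr_hom[OF F h(1)] e] h(2)
        comp_assoc[OF C(2) Dc(2) v(1) g] v(2) comp_ide_right[OF C(2) g] by simp
    show "\<exists>!m. m \<in> Hom D w (OMap F t) \<and> Comp D e m = g"
    proof (rule ex1I[of _ "Comp D (AMap F h) u"])
      show "Comp D (AMap F h) u \<in> Hom D w (OMap F t) \<and> Comp D e (Comp D (AMap F h) u) = g"
        using comp_hom[OF C(2) Dc(2) fctr_hom[OF F h(1)]] 1 by simp
      fix m assume m: "m \<in> Hom D w (OMap F t) \<and> Comp D e m = g"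
      obtain k where k: "k \<in> Hom C c t" "Comp D (AMap F k) u = m"
        using universal_arrow_ex[OF cu _ tO] m by blast
      have eq: "Comp D (Comp D e (AMap F k)) u = Comp D (Comp D e (AMap F h)) u"
        using comp_assoc[OF C(2) Dc(2) fctr_hom[OF F h(1)] e]
          comp_assoc[OF C(2) Dc(2) fctr_hom[OF F k(1)] e] 1 k(2) m by simp
      have "Comp D e (AMap F k) = Comp D e (AMap F h)"
        by (rule epi_iso[OF C(2) Dc(2) u_iso comp_hom[OF C(2) fctr_hom[OF F k(1)] e]
              comp_hom[OF C(2) fctr_hom[OF F h(1)] e] eq])
      moreover have "\<exists>!l. l \<in> Hom C c t \<and> Comp D e (AMap F l) = Comp D e (AMap F h)"
        by (rule ex[OF Dc(1) comp_hom[OF C(2) fctr_hom[OF F h(1)] e]])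
      ultimately have "k = h" using k(1) h(1) by blast
      then show "m = Comp D (AMap F h) u" using k(2) by simp
    qed
  qed
qed

end

lemma adjunctionD:
  assumes "adjunction L R \<eta> \<epsilon>" and R: "R \<in> functors D C"
  shows "L \<in> functors C D" "\<eta> \<in> ntranss (id_fctr C) (R \<odot> L)" "\<epsilon> \<in> ntranss (L \<odot> R) (id_fctr D)"
    "\<And>x. x \<in> Obj C \<Longrightarrow> Comp D (Cmp \<epsilon> (OMap L x)) (AMap L (Cmp \<eta> x)) = Ide D (OMap L x)"
    "\<And>y. y \<in> Obj D \<Longrightarrow> Comp C (AMap R (Cmp \<epsilon> y)) (Cmp \<eta> (OMap R y)) = Ide C (OMap R y)"
proof -
  have "Src L = C" "Tgt L = D" using assms unfolding adjunction_def functors_def by auto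
  then show "L \<in> functors C D" "\<eta> \<in> ntranss (id_fctr C) (R \<odot> L)" "\<epsilon> \<in> ntranss (L \<odot> R) (id_fctr D)"
    "\<And>x. x \<in> Obj C \<Longrightarrow> Comp D (Cmp \<epsilon> (OMap L x)) (AMap L (Cmp \<eta> x)) = Ide D (OMap L x)"
    "\<And>y. y \<in> Obj D \<Longrightarrow> Comp C (AMap R (Cmp \<epsilon> y)) (Cmp \<eta> (OMap R y)) = Ide C (OMap R y)"
    using assms(1) unfolding adjunction_def by (auto simp: functors_def)
qed

lemma adjunctionI:
  assumes "L \<in> functors C D" "R \<in> functors D C"
    "\<eta> \<in> ntranss (id_fctr C) (R \<odot> L)" "\<epsilon> \<in> ntranss (L \<odot> R) (id_fctr D)"
    "\<And>x. x \<in> Obj C \<Longrightarrow> Comp D (Cmp \<epsilon> (OMap L x)) (AMap L (Cmp \<eta> x)) = Ide D (OMap L x)"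
    "\<And>y. y \<in> Obj D \<Longrightarrow> Comp C (AMap R (Cmp \<epsilon> y)) (Cmp \<eta> (OMap R y)) = Ide C (OMap R y)"
  shows "adjunction L R \<eta> \<epsilon>"
  using assms unfolding adjunction_def by (auto simp: functors_def)

lemma adjunction_op:
  assumes adj: "adjunction L R \<eta> \<epsilon>" and R: "R \<in> functors D C"
  shows "adjunction (op_fctr R) (op_fctr L) (op_ntrans \<epsilon>) (op_ntrans \<eta>)"
proof -
  note A = adjunctionD[OF adj R]
  note C = fctr_cat[OF R]
  show ?thesis
  proof (rule adjunctionI[OF op_functors[OF R] op_functors[OF A(1)]])
    show "op_ntrans \<epsilon> \<in> ntranss (id_fctr (op_cat D)) (op_fctr L \<odot> op_fctr R)"
      using op_ntranss[OF comp_fctr_functors[OF R A(1)] A(3)] by (simp add: op_comp_fctr op_id_fctr)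
    show "op_ntrans \<eta> \<in> ntranss (op_fctr R \<odot> op_fctr L) (id_fctr (op_cat C))"
      using op_ntranss[OF id_fctr_functors[OF C(2)] A(2)] by (simp add: op_comp_fctr op_id_fctr)
  qed (use A(4,5) in \<open>auto simp: op_ntrans_def\<close>)
qed

context
  fixes C :: "('o, 'm) cat" and D :: "('p, 'n) cat" and L R \<eta> \<epsilon>
  assumes adj: "adjunction L R \<eta> \<epsilon>" and R: "R \<in> functors D C"
begin

lemma unit_hom: "x \<in> Obj C \<Longrightarrow> Cmp \<eta> x \<in> Hom C x (OMap R (OMap L x))"
  using ntrans_hom[OF adjunctionD(2)[OF adj R] id_fctr_functors[OF fctr_cat(2)[OF R]]]
  by (simp add: comp_fctr_obj fctr_src[OF adjunctionD(1)[OF adj R]])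

lemma counit_hom: "y \<in> Obj D \<Longrightarrow> Cmp \<epsilon> y \<in> Hom D (OMap L (OMap R y)) y"
  using ntrans_hom[OF adjunctionD(3)[OF adj R] comp_fctr_functors[OF R adjunctionD(1)[OF adj R]]]
  by (simp add: comp_fctr_obj fctr_src[OF R])

lemma unit_nat:
  "f \<in> Hom C x y \<Longrightarrow> Comp C (AMap R (AMap L f)) (Cmp \<eta> x) = Comp C (Cmp \<eta> y) f"
  using ntrans_nat[OF adjunctionD(2)[OF adj R] id_fctr_functors[OF fctr_cat(2)[OF R]]]
  by (simp add: comp_fctr_arr fctr_src[OF adjunctionD(1)[OF adj R]] HomD)

lemma counit_nat:
  "f \<in> Hom D x y \<Longrightarrow> Comp D f (Cmp \<epsilon> x) = Comp D (Cmp \<epsilon> y) (AMap L (AMap R f))"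
  using ntrans_nat[OF adjunctionD(3)[OF adj R] comp_fctr_functors[OF R adjunctionD(1)[OF adj R]]]
  by (simp add: comp_fctr_arr fctr_src[OF R] HomD)

lemma unit_universal:
  assumes x: "x \<in> Obj C" shows "universal_arrow R x (OMap L x) (Cmp \<eta> x)"
proof (rule universal_arrowI[OF R])
  note C = fctr_cat[OF R]
  note L = adjunctionD(1)[OF adj R]
  show "OMap L x \<in> Obj D" using fctr_obj[OF L x] .
  show "Cmp \<eta> x \<in> Hom C x (OMap R (OMap L x))" using unit_hom[OF x] .
  {
    fix d g assume d: "d \<in> Obj D" and g: "g \<in> Hom C x (OMap R d)"
    have "Comp C (AMap R (Comp D (Cmp \<epsilon> d) (AMap L g))) (Cmp \<eta> x) = g"
      using fctr_comp[OF R fctr_hom[OF L g] counit_hom[OF d]] unit_nat[OF g]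
        comp_assoc[OF C(2) unit_hom[OF x] fctr_hom[OF R fctr_hom[OF L g]] fctr_hom[OF R counit_hom[OF d]]]
        comp_assoc[OF C(2) g unit_hom[OF fctr_obj[OF R d]] fctr_hom[OF R counit_hom[OF d]]]
        adjunctionD(5)[OF adj R d] comp_ide_left[OF C(2) g] by simp
    then show "\<exists>h\<in>Hom D (OMap L x) d. Comp C (AMap R h) (Cmp \<eta> x) = g"
      using comp_hom[OF C(1) fctr_hom[OF L g] counit_hom[OF d]] by blast
  }
  have eq: "Comp D (Cmp \<epsilon> d) (AMap L (Comp C (AMap R h) (Cmp \<eta> x))) = h"
    if h: "h \<in> Hom D (OMap L x) d" for d h
  proof -
    have d: "d \<in> Obj D" using hom_obj[OF C(1) h] by simp
    note Lx = fctr_obj[OF L x]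
    have "Comp D (Cmp \<epsilon> d) (AMap L (Comp C (AMap R h) (Cmp \<eta> x))) =
       Comp D (Comp D (Cmp \<epsilon> d) (AMap L (AMap R h))) (AMap L (Cmp \<eta> x))"
      using fctr_comp[OF L unit_hom[OF x] fctr_hom[OF R h]]
        comp_assoc[OF C(1) fctr_hom[OF L unit_hom[OF x]] fctr_hom[OF L fctr_hom[OF R h]] counit_hom[OF d]]
      by simp
    also have "\<dots> = Comp D (Comp D h (Cmp \<epsilon> (OMap L x))) (AMap L (Cmp \<eta> x))"
      using counit_nat[OF h] by simp
    also have "\<dots> = h"
      using comp_assoc[OF C(1) fctr_hom[OF L unit_hom[OF x]] counit_hom[OF Lx] h]
        adjunctionD(4)[OF adj R x] comp_ide_right[OF C(1) h] by simp
    finally show ?thesis .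
  qed
  fix d h h' assume "h \<in> Hom D (OMap L x) d" "h' \<in> Hom D (OMap L x) d"
    "Comp C (AMap R h) (Cmp \<eta> x) = Comp C (AMap R h') (Cmp \<eta> x)"
  then show "h = h'" using eq by metis
qed

text \<open>Arrows out of \<open>L c\<close> are transposed to arrows out of \<open>c\<close>, which are determined by their
  restrictions to the summands.\<close>

lemma left_adjoint_preserves_coproducts: "preserves_finite_coproducts L"
  unfolding preserves_finite_coproducts_def
proof (intro allI impI)
  note C = fctr_cat[OF R]
  note L = adjunctionD(1)[OF adj R]
  fix n X c \<iota> assume "is_coproduct (Src L) n X c \<iota>"
  then have c: "is_coproduct C n X c \<iota>" by (simp add: fctr_src[OF L])
  note Dc = is_coproductD[OF c]
  have u: "universal_arrow R (X i) (OMap L (X i)) (Cmp \<eta> (X i))" if "i < n" for i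
    using unit_universal Dc(2) that by blast
  have uc: "universal_arrow R c (OMap L c) (Cmp \<eta> c)" using unit_universal Dc(1) by blast
  note Li = fctr_hom[OF L Dc(3)]
  have transpose: "Comp C (AMap R (Comp D h (AMap L (\<iota> i)))) (Cmp \<eta> (X i)) =
      Comp C (Comp C (AMap R h) (Cmp \<eta> c)) (\<iota> i)" if h: "h \<in> Hom D (OMap L c) y" and i: "i < n" for h y i
    using fctr_comp[OF R Li[OF i] h] unit_nat[OF Dc(3)[OF i]]
      comp_assoc[OF C(2) unit_hom[OF Dc(2)[OF i]] fctr_hom[OF R Li[OF i]] fctr_hom[OF R h]]
      comp_assoc[OF C(2) Dc(3)[OF i] unit_hom[OF Dc(1)] fctr_hom[OF R h]] by simp
  have "is_coproduct D n (\<lambda>i. OMap L (X i)) (OMap L c) (\<lambda>i. AMap L (\<iota> i))"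
  proof (rule is_coproductI[OF C(1) fctr_obj[OF L Dc(1)] Li])
    fix y t assume y: "y \<in> Obj D" and t: "\<And>i. i < n \<Longrightarrow> t i \<in> Hom D (OMap L (X i)) y"
    obtain g where g: "g \<in> Hom C c (OMap R y)"
        "\<And>i. i < n \<Longrightarrow> Comp C g (\<iota> i) = Comp C (AMap R (t i)) (Cmp \<eta> (X i))"
      using coproduct_ex[OF c fctr_obj[OF R y], of "\<lambda>i. Comp C (AMap R (t i)) (Cmp \<eta> (X i))"]
        comp_hom[OF C(2) unit_hom[OF Dc(2)] fctr_hom[OF R t]] by metis
    obtain h where h: "h \<in> Hom D (OMap L c) y" "Comp C (AMap R h) (Cmp \<eta> c) = g"
      using universal_arrow_ex[OF R uc g(1) y] by blast
    have "Comp D h (AMap L (\<iota> i)) = t i" if i: "i < n" for i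
      using universal_arrow_eq[OF R u[OF i] comp_hom[OF C(1) Li[OF i] h(1)] t[OF i]]
        transpose[OF h(1) i] h(2) g(2)[OF i] by simp
    then show "\<exists>h\<in>Hom D (OMap L c) y. \<forall>i<n. Comp D h (AMap L (\<iota> i)) = t i" using h(1) by blast
  next
    fix y h h' assume h: "h \<in> Hom D (OMap L c) y" and h': "h' \<in> Hom D (OMap L c) y"
      and eq: "\<And>i. i < n \<Longrightarrow> Comp D h (AMap L (\<iota> i)) = Comp D h' (AMap L (\<iota> i))"
    have "Comp C (AMap R h) (Cmp \<eta> c) = Comp C (AMap R h') (Cmp \<eta> c)"
      using transpose[OF h] transpose[OF h'] eq
      by (intro coproduct_eq[OF C(2) c comp_hom[OF C(2) unit_hom[OF Dc(1)] fctr_hom[OF R h]]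
            comp_hom[OF C(2) unit_hom[OF Dc(1)] fctr_hom[OF R h']]]) simp
    then show "h = h'" using universal_arrow_eq[OF R uc h h'] by simp
  qed
  then show "is_coproduct (Tgt L) n (\<lambda>i. OMap L (X i)) (OMap L c) (\<lambda>i. AMap L (\<iota> i))"
    by (simp add: fctr_src[OF L])
qed

end

lemma right_adjoint_preserves_products:
  assumes adj: "adjunction L R \<eta> \<epsilon>" and R: "R \<in> functors D C"
  shows "preserves_finite_products R"
  unfolding preserves_finite_products_op
  by (rule left_adjoint_preserves_coproducts[OF adjunction_op[OF adj R]
        op_functors[OF adjunctionD(1)[OF adj R]]])

lemma counit_couniversal:
  assumes adj: "adjunction L R \<eta> \<epsilon>" and R: "R \<in> functors D C" and y: "y \<in> Obj D"
  shows "universal_arrow (op_fctr L) y (OMap R y) (Cmp \<epsilon> y)"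
  using unit_universal[OF adjunction_op[OF adj R] op_functors[OF adjunctionD(1)[OF adj R]], of y] y
  by (simp add: op_ntrans_def)

text \<open>The essential image of a left adjoint does not depend on its choice.\<close>

lemma in_image_left_adjoint_iff:
  assumes R: "R \<in> functors D C" and ex: "\<exists>L. left_adjoint_of L R"
  shows "(\<exists>L. left_adjoint_of L R \<and> in_essential_image L y) \<longleftrightarrow> (\<exists>x u. universal_arrow R x y u)"
proof
  assume "\<exists>L. left_adjoint_of L R \<and> in_essential_image L y"
  then obtain L \<eta> \<epsilon> where adj: "adjunction L R \<eta> \<epsilon>" and im: "in_essential_image L y"
    unfolding left_adjoint_of_def by auto
  note L = adjunctionD(1)[OF adj R]
  obtain x e where x: "x \<in> Obj C" and e: "e \<in> Hom D (OMap L x) y" "is_iso D e"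
    using im unfolding in_essential_image_def isomorphic_def fctr_src[OF L] by auto
  show "\<exists>x u. universal_arrow R x y u"
    using universal_arrow_change[OF R unit_universal[OF adj R x] e] by blast
next
  assume "\<exists>x u. universal_arrow R x y u"
  then obtain x u where xu: "universal_arrow R x y u" by auto
  obtain L \<eta> \<epsilon> where adj: "adjunction L R \<eta> \<epsilon>" using ex unfolding left_adjoint_of_def by auto
  note L = adjunctionD(1)[OF adj R] and x = universal_arrowD[OF R xu]
  obtain e where "e \<in> Hom D (OMap L x) y" "is_iso D e"
    using universal_arrow_unique[OF R unit_universal[OF adj R x(3)] xu] by blast
  then have "in_essential_image L y"
    using x(1,3) unfolding in_essential_image_def isomorphic_def fctr_src[OF L] by blast
  then show "\<exists>L. left_adjoint_of L R \<and> in_essential_image L y"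
    using adj unfolding left_adjoint_of_def by blast
qed

lemma in_image_right_adjoint_iff:
  assumes L: "L \<in> functors C D" and ex: "\<exists>R. right_adjoint_of R L"
  shows "(\<exists>R. right_adjoint_of R L \<and> in_essential_image R x) \<longleftrightarrow>
    (\<exists>y u. universal_arrow (op_fctr L) y x u)"
proof
  note C = fctr_cat[OF L]
  assume "\<exists>R. right_adjoint_of R L \<and> in_essential_image R x"
  then obtain R \<eta> \<epsilon> where adj: "adjunction L R \<eta> \<epsilon>" and im: "in_essential_image R x"
    unfolding right_adjoint_of_def by auto
  have R: "R \<in> functors D C" using adj L unfolding adjunction_def functors_def by auto
  obtain y e where y: "y \<in> Obj D" and e: "e \<in> Hom C (OMap R y) x" "is_iso C e"
    using im unfolding in_essential_image_def isomorphic_def fctr_src[OF R] by auto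
  obtain e' where e': "e' \<in> Hom C x (OMap R y)" "is_iso C e'" using is_isoE[OF C(1) e(2,1)] by metis
  show "\<exists>y u. universal_arrow (op_fctr L) y x u"
    using universal_arrow_change[OF op_functors[OF L] counit_couniversal[OF adj R y], of e' x] e'
    by auto
next
  note C = fctr_cat[OF L]
  assume "\<exists>y u. universal_arrow (op_fctr L) y x u"
  then obtain y u where yu: "universal_arrow (op_fctr L) y x u" by auto
  obtain R \<eta> \<epsilon> where adj: "adjunction L R \<eta> \<epsilon>" using ex unfolding right_adjoint_of_def by auto
  have R: "R \<in> functors D C" using adj L unfolding adjunction_def functors_def by auto
  note y = universal_arrowD[OF op_functors[OF L] yu]
  have yD: "y \<in> Obj D" and xC: "x \<in> Obj C" using y by auto
  obtain e where "e \<in> Hom C x (OMap R y)" "is_iso C e"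
    using universal_arrow_unique[OF op_functors[OF L] counit_couniversal[OF adj R yD] yu] by auto
  then have "isomorphic C (OMap R y) x" using isomorphic_sym[OF C(1)] unfolding isomorphic_def by blast
  then have "in_essential_image R x"
    using yD xC unfolding in_essential_image_def fctr_src[OF R] by blast
  then show "\<exists>R. right_adjoint_of R L \<and> in_essential_image R x"
    using adj unfolding right_adjoint_of_def by blast
qed

section \<open>Binary coproducts from adjoints of the diagonal\<close>

text \<open>A pair of functors \<open>B \<rightarrow> C\<close> that identifies \<open>B\<close> with \<open>C \<times> C\<close> up to equivalence.\<close>

definition jointly_equivalence :: "('o, 'm, 'p, 'n) fctr \<Rightarrow> ('o, 'm, 'p, 'n) fctr \<Rightarrow> bool" where
  "jointly_equivalence E F \<longleftrightarrow>
     (\<forall>x \<in> Obj (Tgt E). \<forall>y \<in> Obj (Tgt E). \<exists>z \<in> Obj (Src E).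
        isomorphic (Tgt E) (OMap E z) x \<and> isomorphic (Tgt E) (OMap F z) y) \<and>
     (\<forall>z \<in> Obj (Src E). \<forall>w \<in> Obj (Src E). \<forall>f \<in> Hom (Tgt E) (OMap E z) (OMap E w).
        \<forall>g \<in> Hom (Tgt E) (OMap F z) (OMap F w).
        \<exists>!h. h \<in> Hom (Src E) z w \<and> AMap E h = f \<and> AMap F h = g)"

text \<open>Under the identification of \<open>B\<close> with \<open>C \<times> C\<close> the functor \<open>N\<close> is the diagonal of \<open>C\<close>, and a left
  adjoint of the diagonal computes binary coproducts.\<close>

lemma coproducts_of_left_adjoint:
  assumes E: "E \<in> functors B C" and F: "F \<in> functors B C" and N: "N \<in> functors C B"
    and joint: "jointly_equivalence E F"
    and EN: "E \<odot> N = id_fctr C" and FN: "F \<odot> N = id_fctr C"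
    and ex: "\<exists>L. left_adjoint_of L N" and X: "X 0 \<in> Obj C" "X 1 \<in> Obj C"
  shows "\<exists>c \<iota>. is_coproduct C 2 X c \<iota>"
proof -
  note C = fctr_cat[OF N]
  have ENo: "OMap E (OMap N y) = y" "OMap F (OMap N y) = y" if "y \<in> Obj C" for y
    using that comp_fctr_obj[of y N E] comp_fctr_obj[of y N F] EN FN by (auto simp: fctr_src[OF N])
  have ENm: "AMap E (AMap N f) = f" "AMap F (AMap N f) = f" if "f \<in> Hom C x y" for f x y
    using HomD(1)[OF that] comp_fctr_arr[of f N E] comp_fctr_arr[of f N F] EN FN
    by (auto simp: fctr_src[OF N])
  obtain z where z: "z \<in> Obj B" "isomorphic C (OMap E z) (X 0)" "isomorphic C (OMap F z) (X 1)"
    using joint X unfolding jointly_equivalence_def fctr_src[OF E] by blast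
  obtain a where a: "a \<in> Hom C (X 0) (OMap E z)" "is_iso C a"
    using isomorphic_sym[OF C(1) z(2)] unfolding isomorphic_def by auto
  obtain b where b: "b \<in> Hom C (X 1) (OMap F z)" "is_iso C b"
    using isomorphic_sym[OF C(1) z(3)] unfolding isomorphic_def by auto
  obtain L \<eta> \<epsilon> where adj: "adjunction L N \<eta> \<epsilon>" using ex unfolding left_adjoint_of_def by auto
  define c where "c = OMap L z"
  define u where "u = Cmp \<eta> z"
  have univ: "universal_arrow N z c u"
    using unit_universal[OF adj N z(1)] unfolding c_def u_def .
  note Dc = universal_arrowD[OF N univ]
  have Eu: "AMap E u \<in> Hom C (OMap E z) c" and Fu: "AMap F u \<in> Hom C (OMap F z) c"
    using fctr_hom[OF E Dc(2)] fctr_hom[OF F Dc(2)] ENo[OF Dc(1)] by auto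
  \<comment> \<open>The inclusions are the two components of the unit \<open>u\<close>.\<close>
  define \<iota> where "\<iota> i = (if i = 0 then Comp C (AMap E u) a else Comp C (AMap F u) b)" for i :: nat
  have eqs: "Comp C h (\<iota> 0) = Comp C (AMap E (Comp B (AMap N h) u)) a"
      "Comp C h (\<iota> 1) = Comp C (AMap F (Comp B (AMap N h) u)) b" if h: "h \<in> Hom C c y" for h y
    using comp_assoc[OF C(1) a(1) Eu h] comp_assoc[OF C(1) b(1) Fu h]
      fctr_comp[OF E Dc(2) fctr_hom[OF N h]] fctr_comp[OF F Dc(2) fctr_hom[OF N h]] ENm[OF h]
    by (auto simp: \<iota>_def)
  have "is_coproduct C 2 X c \<iota>"
  proof (rule is_coproductI[OF C(1) Dc(1)])
    show "\<iota> i \<in> Hom C (X i) c" if "i < 2" for i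
      using that comp_hom[OF C(1) a(1) Eu] comp_hom[OF C(1) b(1) Fu]
      by (auto simp: \<iota>_def less_2_cases_iff)
  next
    fix y t assume y: "y \<in> Obj C" and t: "\<And>i::nat. i < 2 \<Longrightarrow> t i \<in> Hom C (X i) y"
    obtain a' where a': "a' \<in> Hom C (OMap E z) (X 0)" "Comp C a' a = Ide C (X 0)"
      using is_isoE[OF C(1) a(2,1)] by metis
    obtain b' where b': "b' \<in> Hom C (OMap F z) (X 1)" "Comp C b' b = Ide C (X 1)"
      using is_isoE[OF C(1) b(2,1)] by metis
    have t01: "t 0 \<in> Hom C (X 0) y" "t 1 \<in> Hom C (X 1) y" using t by auto
    have "Comp C (t 0) a' \<in> Hom C (OMap E z) (OMap E (OMap N y))"
      "Comp C (t 1) b' \<in> Hom C (OMap F z) (OMap F (OMap N y))"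
      using comp_hom[OF C(1) a'(1) t01(1)] comp_hom[OF C(1) b'(1) t01(2)] ENo[OF y] by auto
    then obtain g where g: "g \<in> Hom B z (OMap N y)" "AMap E g = Comp C (t 0) a'" "AMap F g = Comp C (t 1) b'"
      using joint z(1) fctr_obj[OF N y] unfolding jointly_equivalence_def fctr_src[OF E] by blast
    obtain h where h: "h \<in> Hom C c y" "Comp B (AMap N h) u = g"
      using universal_arrow_ex[OF N univ g(1) y] by blast
    have "Comp C h (\<iota> i) = t i" if "i < 2" for i
      using that eqs[OF h(1)] h(2) g(2,3) comp_assoc[OF C(1) a(1) a'(1) t01(1)]
        comp_assoc[OF C(1) b(1) b'(1) t01(2)] a'(2) b'(2) comp_ide_right[OF C(1) t01(1)]
        comp_ide_right[OF C(1) t01(2)] by (auto simp: less_2_cases_iff)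
    then show "\<exists>h\<in>Hom C c y. \<forall>i<2. Comp C h (\<iota> i) = t i" using h(1) by blast
  next
    fix y h h' assume h: "h \<in> Hom C c y" and h': "h' \<in> Hom C c y"
      and "\<And>i. i < 2 \<Longrightarrow> Comp C h (\<iota> i) = Comp C h' (\<iota> i)"
    then have eq: "Comp C h (\<iota> 0) = Comp C h' (\<iota> 0)" "Comp C h (\<iota> 1) = Comp C h' (\<iota> 1)" by auto
    have y: "y \<in> Obj C" using hom_obj[OF C(1) h] by simp
    define g where "g = Comp B (AMap N h) u"
    define g' where "g' = Comp B (AMap N h') u"
    have gh: "g \<in> Hom B z (OMap N y)" "g' \<in> Hom B z (OMap N y)"
      using comp_hom[OF C(2) Dc(2) fctr_hom[OF N h]] comp_hom[OF C(2) Dc(2) fctr_hom[OF N h']]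
      by (auto simp: g_def g'_def)
    have "AMap E g = AMap E g'"
      using eqs(1)[OF h] eqs(1)[OF h'] eq(1)
      by (intro epi_iso[OF C(1) a fctr_hom[OF E gh(1)] fctr_hom[OF E gh(2)]]) (simp add: g_def g'_def)
    moreover have "AMap F g = AMap F g'"
      using eqs(2)[OF h] eqs(2)[OF h'] eq(2)
      by (intro epi_iso[OF C(1) b fctr_hom[OF F gh(1)] fctr_hom[OF F gh(2)]]) (simp add: g_def g'_def)
    moreover have "\<exists>!k. k \<in> Hom B z (OMap N y) \<and> AMap E k = AMap E g \<and> AMap F k = AMap F g"
      using joint z(1) fctr_obj[OF N y] fctr_hom[OF E gh(1)] fctr_hom[OF F gh(1)]
      unfolding jointly_equivalence_def fctr_src[OF E] by blast
    ultimately have "g = g'" using gh by metis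
    then show "h = h'" using universal_arrow_eq[OF N univ h h'] by (simp add: g_def g'_def)
  qed
  then show ?thesis by blast
qed

lemma jointly_equivalence_op:
  assumes "jointly_equivalence E F" and C: "category (Tgt E)"
  shows "jointly_equivalence (op_fctr E) (op_fctr F)"
  using assms(1) unfolding jointly_equivalence_def by (simp add: isomorphic_op[OF C])

lemma products_of_right_adjoint:
  assumes E: "E \<in> functors B C" and F: "F \<in> functors B C" and N: "N \<in> functors C B"
    and joint: "jointly_equivalence E F"
    and EN: "E \<odot> N = id_fctr C" and FN: "F \<odot> N = id_fctr C"
    and ex: "\<exists>R. right_adjoint_of R N" and X: "X 0 \<in> Obj C" "X 1 \<in> Obj C"
  shows "\<exists>p \<pi>. is_product C 2 X p \<pi>"
proof -
  obtain R \<eta> \<epsilon> where adj: "adjunction N R \<eta> \<epsilon>" using ex unfolding right_adjoint_of_def by auto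
  have R: "R \<in> functors B C" using adj N unfolding adjunction_def functors_def by auto
  have "left_adjoint_of (op_fctr R) (op_fctr N)"
    using adjunction_op[OF adj R] unfolding left_adjoint_of_def by blast
  moreover have "jointly_equivalence (op_fctr E) (op_fctr F)"
    using jointly_equivalence_op[OF joint] fctr_cat[OF E] fctr_src[OF E] by simp
  ultimately have "\<exists>p \<pi>. is_coproduct (op_cat C) 2 X p \<pi>"
    using coproducts_of_left_adjoint[OF op_functors[OF E] op_functors[OF F] op_functors[OF N]] X
    by (simp add: op_comp_fctr[symmetric] EN FN op_id_fctr; blast)
  then show ?thesis by (simp add: is_product_op)
qed

text \<open>A functor naturally isomorphic to the identity is faithful: conjugation with the isomorphism
  recovers the arrow. The transformation may point either way, as for the two halves of an
  equivalence.\<close>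

lemma nat_iso_faithful:
  assumes G: "G \<in> functors C C" and a: "a \<in> ntranss (id_fctr C) G \<or> a \<in> ntranss G (id_fctr C)"
    and iso: "is_niso a" and f: "f \<in> Hom C x y" "g \<in> Hom C x y" "AMap G f = AMap G g"
  shows "f = g"
proof -
  note C = fctr_cat(1)[OF G] and I = id_fctr_functors[OF fctr_cat(1)[OF G]]
  have xy: "x \<in> Obj C" "y \<in> Obj C" using hom_obj[OF C f(1)] by auto
  note arr = HomD(1)[OF f(1)] HomD(1)[OF f(2)]
  from a show ?thesis
  proof
    assume a: "a \<in> ntranss (id_fctr C) G"
    have "is_iso C (Cmp a y)"
      using iso xy(2) unfolding is_niso_def by (simp add: ntrans_src[OF a I])
    moreover have "Comp C (Cmp a y) f = Comp C (Cmp a y) g"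
      using ntrans_nat[OF a I f(1)] ntrans_nat[OF a I f(2)] f(3) arr by simp
    moreover have "Cmp a y \<in> Hom C y (OMap G y)" using ntrans_hom[OF a I xy(2)] xy(2) by simp
    ultimately show ?thesis using mono_iso[OF C _ _ f(1,2)] by blast
  next
    assume a: "a \<in> ntranss G (id_fctr C)"
    have "is_iso C (Cmp a x)"
      using iso xy(1) unfolding is_niso_def by (simp add: ntrans_src[OF a G] fctr_src[OF G])
    moreover have "Comp C f (Cmp a x) = Comp C g (Cmp a x)"
      using ntrans_nat[OF a G f(1)] ntrans_nat[OF a G f(2)] f(3) arr by simp
    moreover have "Cmp a x \<in> Hom C (OMap G x) x" using ntrans_hom[OF a G xy(1)] xy(1) by simp
    ultimately show ?thesis using epi_iso[OF C _ _ f(1,2)] by blast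
  qed
qed

lemma equivalence_full_faithful:
  assumes F: "F \<in> functors C D" and eq: "is_equivalence F"
  shows "\<And>x y f g. f \<in> Hom C x y \<Longrightarrow> g \<in> Hom C x y \<Longrightarrow> AMap F f = AMap F g \<Longrightarrow> f = g"
    and "\<And>x y g. x \<in> Obj C \<Longrightarrow> y \<in> Obj C \<Longrightarrow> g \<in> Hom D (OMap F x) (OMap F y) \<Longrightarrow>
      \<exists>f \<in> Hom C x y. AMap F f = g"
    and "\<And>y. y \<in> Obj D \<Longrightarrow> \<exists>x \<in> Obj C. isomorphic D (OMap F x) y"
proof -
  obtain G a b where G: "G \<in> functors D C" and a: "a \<in> ntranss (id_fctr C) (G \<odot> F)" "is_niso a"
    and b: "b \<in> ntranss (F \<odot> G) (id_fctr D)" "is_niso b"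
    using eq unfolding is_equivalence_def fctr_src[OF F] by auto
  note C = fctr_cat[OF F]
  note GF = comp_fctr_functors[OF F G] and FG = comp_fctr_functors[OF G F]
  note I = id_fctr_functors[OF C(1)]
  have GFm: "AMap (G \<odot> F) f = AMap G (AMap F f)" if "f \<in> Hom C x y" for f x y
    using HomD(1)[OF that] by (simp add: comp_fctr_arr fctr_src[OF F])
  have FGm: "AMap (F \<odot> G) f = AMap F (AMap G f)" if "f \<in> Hom D x y" for f x y
    using HomD(1)[OF that] by (simp add: comp_fctr_arr fctr_src[OF G])
  show "f = g" if "f \<in> Hom C x y" "g \<in> Hom C x y" "AMap F f = AMap F g" for x y f g
    using nat_iso_faithful[OF GF disjI1[OF a(1)] a(2) that(1,2)] that(3) GFm[OF that(1)] GFm[OF that(2)]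
    by simp
  have faithG: "f = g" if "f \<in> Hom D x y" "g \<in> Hom D x y" "AMap G f = AMap G g" for x y f g
    using nat_iso_faithful[OF FG disjI2[OF b(1)] b(2) that(1,2)] that(3) FGm[OF that(1)] FGm[OF that(2)]
    by simp
  {
    fix x y g assume xy: "x \<in> Obj C" "y \<in> Obj C" and g: "g \<in> Hom D (OMap F x) (OMap F y)"
    have ah: "Cmp a w \<in> Hom C w (OMap G (OMap F w))" "is_iso C (Cmp a w)" if "w \<in> Obj C" for w
      using ntrans_hom[OF a(1) I that] that a(2) unfolding is_niso_def
      by (auto simp: comp_fctr_obj fctr_src[OF F] ntrans_src[OF a(1) I])
    obtain k where k: "k \<in> Hom C (OMap G (OMap F y)) y" "Comp C (Cmp a y) k = Ide C (OMap G (OMap F y))"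
      using is_isoE[OF C(1) ah(2)[OF xy(2)] ah(1)[OF xy(2)]] by metis
    note Gg = fctr_hom[OF G g] and ax = ah[OF xy(1)] and ay = ah[OF xy(2)]
    \<comment> \<open>The only candidate, by naturality of \<open>a\<close>.\<close>
    define f where "f = Comp C k (Comp C (AMap G g) (Cmp a x))"
    have f: "f \<in> Hom C x y"
      unfolding f_def using comp_hom[OF C(1) comp_hom[OF C(1) ax(1) Gg] k(1)] .
    have "Comp C (AMap G (AMap F f)) (Cmp a x) = Comp C (Cmp a y) f"
      using ntrans_nat[OF a(1) I f] GFm[OF f] HomD(1)[OF f] by simp
    also have "\<dots> = Comp C (AMap G g) (Cmp a x)"
      unfolding f_def
      using comp_assoc[OF C(1) comp_hom[OF C(1) ax(1) Gg] k(1) ay(1)] k(2)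
        comp_ide_left[OF C(1) comp_hom[OF C(1) ax(1) Gg]] by simp
    finally have "AMap G (AMap F f) = AMap G g"
      using epi_iso[OF C(1) ax fctr_hom[OF G fctr_hom[OF F f]] Gg] by simp
    then have "AMap F f = g" using faithG[OF fctr_hom[OF F f] g] by simp
    then show "\<exists>f\<in>Hom C x y. AMap F f = g" using f by blast
  }
  show "\<exists>x\<in>Obj C. isomorphic D (OMap F x) y" if y: "y \<in> Obj D" for y
  proof -
    have "Cmp b y \<in> Hom D (OMap F (OMap G y)) y" "is_iso D (Cmp b y)"
      using ntrans_hom[OF b(1) FG y] y b(2) unfolding is_niso_def
      by (auto simp: comp_fctr_obj fctr_src[OF G] fctr_src[OF FG] ntrans_src[OF b(1) FG])
    then show ?thesis using fctr_obj[OF G y] unfolding isomorphic_def by blast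
  qed
qed

lemma Hom_prod_cat: "Hom (prod_cat C D) x y = Hom C (fst x) (fst y) \<times> Hom D (snd x) (snd y)"
  by (auto simp: Hom_def prod_cat_def)

lemma category_prod_cat:
  assumes "category C" "category D" shows "category (prod_cat C D)"
  using assms unfolding category_def Hom_prod_cat by (auto simp: prod_cat_def Hom_def)

lemma is_iso_prod_cat:
  assumes "is_iso (prod_cat C D) f" shows "is_iso C (fst f)" "is_iso D (snd f)"
  using assms unfolding is_iso_def Hom_prod_cat by (auto simp: prod_cat_def)

lemma pair_fctr_functors:
  assumes E: "E \<in> functors B C" and F: "F \<in> functors B D"
  shows "pair_fctr E F \<in> functors B (prod_cat C D)"
  unfolding pair_fctr_def fctr_src[OF E] fctr_src[OF F]
  using fctr_obj[OF E] fctr_obj[OF F] fctr_hom[OF E] fctr_hom[OF F] fctr_ide[OF E] fctr_ide[OF F]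
    fctr_comp[OF E] fctr_comp[OF F]
  by (intro mk_fctr_functors[OF fctr_cat(1)[OF E]
        category_prod_cat[OF fctr_cat(2)[OF E] fctr_cat(2)[OF F]]])
    (auto simp: Hom_prod_cat, auto simp: prod_cat_def)

lemma equivalence_jointly:
  assumes E: "E \<in> functors B C" and F: "F \<in> functors B C" and eq: "is_equivalence (pair_fctr E F)"
  shows "jointly_equivalence E F"
proof -
  note P = pair_fctr_functors[OF E F]
  note ff = equivalence_full_faithful[OF P eq]
  have Po: "OMap (pair_fctr E F) z = (OMap E z, OMap F z)" if "z \<in> Obj B" for z
    using that by (simp add: pair_fctr_def mk_fctr_def fctr_src[OF E])
  have Pm: "AMap (pair_fctr E F) f = (AMap E f, AMap F f)" if "f \<in> Hom B z w" for f z w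
    using HomD(1)[OF that] by (simp add: pair_fctr_def mk_fctr_def fctr_src[OF E])
  show ?thesis
    unfolding jointly_equivalence_def fctr_src[OF E]
  proof (intro conjI ballI)
    fix x y assume "x \<in> Obj C" "y \<in> Obj C"
    then obtain z f where z: "z \<in> Obj B" and
        f: "f \<in> Hom (prod_cat C C) (OMap E z, OMap F z) (x, y)" "is_iso (prod_cat C C) f"
      using ff(3)[of "(x, y)"] Po unfolding isomorphic_def by (auto simp: prod_cat_def)
    show "\<exists>z\<in>Obj B. isomorphic C (OMap E z) x \<and> isomorphic C (OMap F z) y"
      using z f(1) is_iso_prod_cat[OF f(2)] unfolding isomorphic_def Hom_prod_cat
      by (metis fst_conv mem_Times_iff snd_conv)
  next
    fix z w f g assume zw: "z \<in> Obj B" "w \<in> Obj B"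
      and f: "f \<in> Hom C (OMap E z) (OMap E w)" and g: "g \<in> Hom C (OMap F z) (OMap F w)"
    obtain h where h: "h \<in> Hom B z w" "AMap (pair_fctr E F) h = (f, g)"
      using ff(2)[OF zw, of "(f, g)"] f g Po zw by (auto simp: Hom_prod_cat)
    show "\<exists>!h. h \<in> Hom B z w \<and> AMap E h = f \<and> AMap F h = g"
    proof (rule ex1I[of _ h])
      show "h \<in> Hom B z w \<and> AMap E h = f \<and> AMap F h = g" using h Pm[OF h(1)] by simp
      show "k = h" if "k \<in> Hom B z w \<and> AMap E k = f \<and> AMap F k = g" for k
        using ff(1)[of k z w h] that h Pm by auto
    qed
  qed
qed

section \<open>Small categories and shapes\<close>

context
  fixes S :: "'a code set \<Rightarrow> bool"
  assumes S: "smallness S"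
begin

lemma small_finite: "finite A \<Longrightarrow> S A"
  using S unfolding smallness_def by blast

lemma small_image: "S A \<Longrightarrow> S (f ` A)"
  using S unfolding smallness_def by blast

lemma small_Union: "S A \<Longrightarrow> (\<And>a. a \<in> A \<Longrightarrow> S (B a)) \<Longrightarrow> S (\<Union>a\<in>A. B a)"
  using S unfolding smallness_def by blast

lemma small_subset:
  assumes "S A" "B \<subseteq> A" shows "S B"
proof -
  have "S (\<Union>a\<in>A. if a \<in> B then {a} else {})"
    by (intro small_Union[OF assms(1)]) (simp add: small_finite)
  moreover have "(\<Union>a\<in>A. if a \<in> B then {a} else {}) = B"
    using assms(2) by (auto split: if_splits)
  ultimately show ?thesis by simp
qed

lemma small_Un:
  assumes "S A" "S B" shows "S (A \<union> B)"
proof -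
  have "S (\<Union>i\<in>{v0 :: 'a code, v1}. if i = v0 then A else B)"
    by (intro small_Union) (use small_finite assms in auto)
  moreover have "(\<Union>i\<in>{v0 :: 'a code, v1}. if i = v0 then A else B) = A \<union> B" by (auto simp: v0_def v1_def)
  ultimately show ?thesis by simp
qed

lemma small_Tup:
  assumes "S A" "S B" shows "S {Tup a b | a b. a \<in> A \<and> b \<in> B}"
proof -
  have "S (\<Union>a\<in>A. Tup a ` B)" using small_Union[OF assms(1)] small_image[OF assms(2)] by simp
  moreover have "(\<Union>a\<in>A. Tup a ` B) = {Tup a b | a b. a \<in> A \<and> b \<in> B}" by auto
  ultimately show ?thesis by simp
qed

lemma small_cat_finite: "category J \<Longrightarrow> finite (Obj J) \<Longrightarrow> finite (Arr J) \<Longrightarrow> small_cat S J"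
  unfolding small_cat_def using small_finite by simp

lemma small_sum_cat:
  assumes "category (sum_cat J K)" "small_cat S J" "small_cat S K" shows "small_cat S (sum_cat J K)"
  using assms small_Un small_image unfolding small_cat_def by (simp add: sum_cat_def)

lemma small_over_slice:
  assumes "category (over_slice u k)" "small_cat S (Src u)" "small_cat S (Tgt u)"
  shows "small_cat S (over_slice u k)"
proof -
  let ?P = "{Tup j f | j f. j \<in> Obj (Src u) \<and> f \<in> Arr (Tgt u)}"
  have P: "S ?P" using small_Tup assms(2,3) unfolding small_cat_def by simp
  have O: "S (Obj (over_slice u k))"
    by (rule small_subset[OF P]) (auto simp: over_slice_def comma_cat_def Hom_def)
  let ?Q = "{Tup p g | p g. p \<in> {Tup x y | x y. x \<in> Obj (over_slice u k) \<and> y \<in> Obj (over_slice u k)} \<and>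
    g \<in> Arr (Src u)}"
  have Q: "S ?Q" using small_Tup[OF small_Tup[OF O O]] assms(2) unfolding small_cat_def by simp
  have "S (Arr (over_slice u k))"
    by (rule small_subset[OF Q]) (auto simp: over_slice_def comma_cat_def Hom_def)
  then show ?thesis using O assms(1) unfolding small_cat_def by simp
qed

end

lemma Hom_poset_cat:
  "f \<in> Hom (poset_cat P le) x y \<longleftrightarrow> x \<in> P \<and> y \<in> P \<and> le x y \<and> f = Tup x y"
  by (auto simp: Hom_def poset_cat_def)

lemma category_poset_cat:
  assumes "\<And>x. x \<in> P \<Longrightarrow> le x x" "\<And>x y z. x \<in> P \<Longrightarrow> y \<in> P \<Longrightarrow> z \<in> P \<Longrightarrow> le x y \<Longrightarrow> le y z \<Longrightarrow> le x z"
  shows "category (poset_cat P le)"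
proof (rule categoryI)
  fix f g x y z assume "f \<in> Hom (poset_cat P le) x y" "g \<in> Hom (poset_cat P le) y z"
  then show "Comp (poset_cat P le) g f \<in> Hom (poset_cat P le) x z"
    using assms(2)[of x y z] unfolding Hom_poset_cat by (simp add: poset_cat_def)
qed (auto simp: Hom_poset_cat, auto simp: poset_cat_def assms(1))

lemma category_point_cat: "category point_cat"
  unfolding point_cat_def by (rule category_poset_cat) auto

lemma category_interval_cat: "category interval_cat"
  unfolding interval_cat_def by (rule category_poset_cat) auto

lemma Hom_sprod_cat:
  "f \<in> Hom (sprod_cat J K) (Tup a b) (Tup c d) \<longleftrightarrow>
     (\<exists>g h. f = Tup g h \<and> g \<in> Hom J a c \<and> h \<in> Hom K b d)"
  by (auto simp: Hom_def sprod_cat_def)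

lemma category_sprod_cat:
  assumes "category J" "category K" shows "category (sprod_cat J K)"
  using assms unfolding category_def Hom_def by (auto simp: sprod_cat_def)

lemma category_full_subcat:
  assumes "category J" shows "category (full_subcat J A)"
  using assms unfolding category_def Hom_def full_subcat_def by auto

lemma Hom_full_subcat:
  "f \<in> Hom (full_subcat J A) x y \<longleftrightarrow> f \<in> Hom J x y \<and> x \<in> A \<and> y \<in> A"
  by (auto simp: Hom_def full_subcat_def)

lemma inclusion_functors:
  assumes "category J" shows "inclusion J A \<in> functors (full_subcat J A) J"
  unfolding inclusion_def using category_full_subcat[OF assms] assms
  by (intro mk_fctr_functors) (auto simp: Hom_full_subcat, auto simp: full_subcat_def)

lemma const_fctr_functors:
  assumes "category J" "category K" "k \<in> Obj K" shows "const_fctr J K k \<in> functors J K"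
  unfolding const_fctr_def
  using ide_hom[OF assms(2,3)] comp_ide_left[OF assms(2) ide_hom[OF assms(2,3)]] assms
  by (intro mk_fctr_functors) auto

lemma obj_fctr_functors: "category K \<Longrightarrow> k \<in> Obj K \<Longrightarrow> obj_fctr K k \<in> functors point_cat K"
  unfolding obj_fctr_def using const_fctr_functors[OF category_point_cat] .

lemma point_cat_simps [simp]: "Obj point_cat = {Pt}" "Arr point_cat = {Tup Pt Pt}"
  by (auto simp: point_cat_def poset_cat_def)

lemma to_point_functors: "category J \<Longrightarrow> to_point J \<in> functors J point_cat"
  unfolding to_point_def by (rule const_fctr_functors[OF _ category_point_cat]) simp_all

lemma obj_fctr_obj [simp]: "OMap (obj_fctr K k) Pt = k"
  by (simp add: obj_fctr_def const_fctr_def mk_fctr_def)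

lemma point_fctr_eqI:
  assumes F: "F \<in> functors point_cat K" and G: "G \<in> functors point_cat K" and "OMap F Pt = OMap G Pt"
  shows "F = G"
proof (rule fctr_eqI[OF F G])
  have i: "Ide point_cat Pt = Tup Pt Pt" by (simp add: point_cat_def poset_cat_def)
  show "AMap F f = AMap G f" if "f \<in> Arr point_cat" for f
    using that fctr_ide[OF F, of Pt] fctr_ide[OF G, of Pt] assms(3) unfolding i by simp
qed (use assms(3) in simp)

lemma comp_obj_fctr:
  assumes u: "u \<in> functors J K" and j: "j \<in> Obj J"
  shows "u \<odot> obj_fctr J j = obj_fctr K (OMap u j)"
proof -
  note o = obj_fctr_functors[OF fctr_cat(1)[OF u] j]
  show ?thesis
    using comp_fctr_obj[of Pt "obj_fctr J j" u]
    by (intro point_fctr_eqI[OF comp_fctr_functors[OF o u] obj_fctr_functors[OF fctr_cat(2)[OF u] fctr_obj[OF u j]]])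
      (simp add: fctr_src[OF o])
qed

lemma point_terminal: "f \<in> Hom point_cat x y \<Longrightarrow> f = Tup Pt Pt"
  using HomD(1) by fastforce

lemma to_point_unique:
  assumes F: "F \<in> functors J point_cat" and G: "G \<in> functors J point_cat"
  shows "F = G"
proof (rule fctr_eqI[OF F G])
  show "OMap F x = OMap G x" if "x \<in> Obj J" for x using fctr_obj[OF F that] fctr_obj[OF G that] by simp
  show "AMap F f = AMap G f" if "f \<in> Arr J" for f
    using point_terminal[OF fctr_hom[OF F hom_self[OF that]]]
      point_terminal[OF fctr_hom[OF G hom_self[OF that]]] by simp
qed

text \<open>Transported by a derivator, this computes colimits over a category with a terminal object as
  evaluation there. The unit is the unique arrow to \<open>t\<close>, and naturality as well as the triangle
  identities hold because their two sides end in a terminal object.\<close>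

lemma terminal_adjunction:
  fixes C :: "'a scat"
  assumes C: "category C" and t: "terminal C t"
  obtains \<delta> where "adjunction (to_point C) (obj_fctr C t) \<delta> (id_ntrans (id_fctr point_cat))"
proof -
  have tO: "t \<in> Obj C" using t unfolding terminal_def by simp
  note p = to_point_functors[OF C] and o = obj_fctr_functors[OF C tO]
  note I = id_fctr_functors[OF C] and op = comp_fctr_functors[OF p o]
  have po: "to_point C \<odot> obj_fctr C t = id_fctr point_cat"
    by (rule to_point_unique[OF comp_fctr_functors[OF o p] id_fctr_functors[OF category_point_cat]])
  define c where "c x = (THE f. f \<in> Hom C x t)" for x
  have c: "c x \<in> Hom C x t" if "x \<in> Obj C" for x
    unfolding c_def using t that unfolding terminal_def by (intro theI'[of "\<lambda>f. f \<in> Hom C x t"]) simp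
  have uniq: "f = g" if "f \<in> Hom C x t" "g \<in> Hom C x t" for f g x
  proof -
    have "\<exists>!k. k \<in> Hom C x t" using t hom_obj[OF C that(1)] unfolding terminal_def by simp
    then show ?thesis using that by auto
  qed
  have opO: "OMap (obj_fctr C t \<odot> to_point C) x = t" if "x \<in> Obj C" for x
    using that fctr_obj[OF p that] by (simp add: comp_fctr_obj fctr_src[OF p])
  have \<delta>: "mk_ntrans (id_fctr C) (obj_fctr C t \<odot> to_point C) c \<in> ntranss (id_fctr C) (obj_fctr C t \<odot> to_point C)"
  proof (rule mk_ntrans_ntranss[OF I op])
    show "c x \<in> Hom C (OMap (id_fctr C) x) (OMap (obj_fctr C t \<odot> to_point C) x)" if "x \<in> Obj C" for x
      using c[OF that] opO[OF that] that by simp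
    fix f x y assume f: "f \<in> Hom C x y"
    note xy = hom_obj[OF C f]
    have "AMap (obj_fctr C t \<odot> to_point C) f \<in> Hom C t t" using fctr_hom[OF op f] opO xy by simp
    then show "Comp C (AMap (obj_fctr C t \<odot> to_point C) f) (c x) = Comp C (c y) (AMap (id_fctr C) f)"
      using uniq[OF comp_hom[OF C c[OF xy(1)]] comp_hom[OF C f c[OF xy(2)]]] HomD(1)[OF f] by simp
  qed
  have "adjunction (to_point C) (obj_fctr C t) (mk_ntrans (id_fctr C) (obj_fctr C t \<odot> to_point C) c)
      (id_ntrans (id_fctr point_cat))"
  proof (rule adjunctionI[OF p o \<delta>])
    note PI = id_fctr_functors[OF category_point_cat]
    show e: "id_ntrans (id_fctr point_cat) \<in> ntranss (to_point C \<odot> obj_fctr C t) (id_fctr point_cat)"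
      unfolding po using id_ntrans_ntranss[OF PI] .
    have eh: "Cmp (id_ntrans (id_fctr point_cat)) y \<in> Hom point_cat y y" if "y \<in> Obj point_cat" for y :: "'a code"
      using ntrans_hom[OF id_ntrans_ntranss[OF PI] PI that] that by simp
    show "Comp point_cat (Cmp (id_ntrans (id_fctr point_cat)) (OMap (to_point C) x))
         (AMap (to_point C) (Cmp (mk_ntrans (id_fctr C) (obj_fctr C t \<odot> to_point C) c) x)) =
         Ide point_cat (OMap (to_point C) x)" if x: "x \<in> Obj C" for x
    proof -
      have "AMap (to_point C) (Cmp (mk_ntrans (id_fctr C) (obj_fctr C t \<odot> to_point C) c) x)
          \<in> Hom point_cat (OMap (to_point C) x) (OMap (to_point C) t)"
        using fctr_hom[OF p c[OF x]] x by (simp add: mk_ntrans_cmp)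
      moreover have "OMap (to_point C) t = OMap (to_point C) x"
        using fctr_obj[OF p x] fctr_obj[OF p tO] by simp
      ultimately have "Comp point_cat (Cmp (id_ntrans (id_fctr point_cat)) (OMap (to_point C) x))
         (AMap (to_point C) (Cmp (mk_ntrans (id_fctr C) (obj_fctr C t \<odot> to_point C) c) x))
         \<in> Hom point_cat (OMap (to_point C) x) (OMap (to_point C) x)"
        using comp_hom[OF category_point_cat _ eh[OF fctr_obj[OF p x]]] by simp
      then show ?thesis
        using point_terminal point_terminal[OF ide_hom[OF category_point_cat fctr_obj[OF p x]]] by metis
    qed
    fix y :: "'a code" assume y: "y \<in> Obj point_cat"
    then have y': "OMap (obj_fctr C t) y = t" by simp
    have "Comp C (AMap (obj_fctr C t) (Cmp (id_ntrans (id_fctr point_cat)) y)) (c t) = Ide C t"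
      using uniq[OF comp_hom[OF C c[OF tO]] ide_hom[OF C tO]] fctr_hom[OF o eh[OF y]] y' by simp
    then show "Comp C (AMap (obj_fctr C t) (Cmp (id_ntrans (id_fctr point_cat)) y))
          (Cmp (mk_ntrans (id_fctr C) (obj_fctr C t \<odot> to_point C) c) (OMap (obj_fctr C t) y)) =
         Ide C (OMap (obj_fctr C t) y)"
      unfolding y' using tO by (simp add: mk_ntrans_cmp)
  qed
  then show ?thesis using that by blast
qed

section \<open>Slices\<close>

context
  fixes J K :: "'a scat" and u k
  assumes u: "u \<in> functors J K" and k: "k \<in> Obj K"
begin

lemma over_slice_obj:
  "x \<in> Obj (over_slice u k) \<longleftrightarrow> (\<exists>j f. x = Tup j f \<and> j \<in> Obj J \<and> f \<in> Hom K (OMap u j) k)"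
  by (auto simp: over_slice_def comma_cat_def fctr_src[OF u])

lemma over_slice_hom:
  "h \<in> Hom (over_slice u k) x y \<longleftrightarrow> (\<exists>g. h = Tup (Tup x y) g \<and> x \<in> Obj (over_slice u k) \<and>
     y \<in> Obj (over_slice u k) \<and> g \<in> Hom J (tfst x) (tfst y) \<and> Comp K (tsnd y) (AMap u g) = tsnd x)"
  by (auto simp: over_slice_def comma_cat_def Hom_def fctr_src[OF u])

lemma over_slice_ops:
  "Ide (over_slice u k) x = Tup (Tup x x) (Ide J (tfst x))"
  "Comp (over_slice u k) h' h = Tup (Tup (tfst (tfst h)) (tsnd (tfst h'))) (Comp J (tsnd h') (tsnd h))"
  by (auto simp: over_slice_def comma_cat_def fctr_src[OF u])

lemma over_slice_dest:
  assumes "x \<in> Obj (over_slice u k)"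
  shows "tfst x \<in> Obj J" "tsnd x \<in> Hom K (OMap u (tfst x)) k"
  using assms by (auto simp: over_slice_obj)

lemma category_over_slice: "category (over_slice u k)"
proof -
  let ?C = "over_slice u k"
  note J = fctr_cat(1)[OF u] and K = fctr_cat(2)[OF u]
  have comp: "Comp ?C h' h \<in> Hom ?C x z" if h: "h \<in> Hom ?C x y" and h': "h' \<in> Hom ?C y z" for h h' x y z
  proof -
    obtain g where g: "h = Tup (Tup x y) g" "x \<in> Obj ?C" "y \<in> Obj ?C" "g \<in> Hom J (tfst x) (tfst y)"
        "Comp K (tsnd y) (AMap u g) = tsnd x"
      using h over_slice_hom by blast
    obtain g' where g': "h' = Tup (Tup y z) g'" "z \<in> Obj ?C" "g' \<in> Hom J (tfst y) (tfst z)"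
        "Comp K (tsnd z) (AMap u g') = tsnd y"
      using h' over_slice_hom by blast
    have "Comp K (tsnd z) (AMap u (Comp J g' g)) = tsnd x"
      using fctr_comp[OF u g(4) g'(3)] g(5) g'(4)
        comp_assoc[OF K fctr_hom[OF u g(4)] fctr_hom[OF u g'(3)] over_slice_dest(2)[OF g'(2)]] by simp
    then show ?thesis
      using g g' comp_hom[OF J g(4) g'(3)] by (simp add: over_slice_hom over_slice_ops)
  qed
  have ide: "Ide ?C x \<in> Hom ?C x x" if x: "x \<in> Obj ?C" for x
    using over_slice_dest[OF x] x ide_hom[OF J] fctr_ide[OF u] comp_ide_right[OF K]
    by (auto simp: over_slice_hom over_slice_ops)
  show ?thesis
  proof (rule categoryI)
    fix f x y assume f: "f \<in> Hom ?C x y"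
    obtain g where g: "f = Tup (Tup x y) g" "x \<in> Obj ?C" "y \<in> Obj ?C" "g \<in> Hom J (tfst x) (tfst y)"
      using f over_slice_hom by blast
    show "x \<in> Obj ?C \<and> y \<in> Obj ?C" using g by auto
    show "Comp ?C f (Ide ?C x) = f" "Comp ?C (Ide ?C y) f = f"
      using g(1) comp_ide_right[OF J g(4)] comp_ide_left[OF J g(4)] by (simp_all add: over_slice_ops)
  next
    fix f g h x y z w assume "f \<in> Hom ?C x y" "g \<in> Hom ?C y z" "h \<in> Hom ?C z w"
    then obtain f' g' h' where "f = Tup (Tup x y) f'" "f' \<in> Hom J (tfst x) (tfst y)"
        "g = Tup (Tup y z) g'" "g' \<in> Hom J (tfst y) (tfst z)"
        "h = Tup (Tup z w) h'" "h' \<in> Hom J (tfst z) (tfst w)"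
      using over_slice_hom by metis
    then show "Comp ?C h (Comp ?C g f) = Comp ?C (Comp ?C h g) f"
      using comp_assoc[OF J] by (simp add: over_slice_ops)
  qed (use ide comp in auto)
qed

lemma slice_pr_functors: "slice_pr (over_slice u k) J \<in> functors (over_slice u k) J"
  unfolding slice_pr_def using category_over_slice fctr_cat(1)[OF u]
  by (intro mk_fctr_functors) (auto simp: over_slice_hom over_slice_ops over_slice_obj)

lemma over_slice_2cell_ntranss:
  "over_slice_2cell u k \<in> ntranss (u \<odot> slice_pr (over_slice u k) J) (obj_fctr K k \<odot> to_point (over_slice u k))"
proof -
  let ?C = "over_slice u k"
  note K = fctr_cat(2)[OF u] and p = to_point_functors[OF category_over_slice]
  note o = obj_fctr_functors[OF K k]
  note F = comp_fctr_functors[OF slice_pr_functors u] and G = comp_fctr_functors[OF p o]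
  have Fo: "OMap (u \<odot> slice_pr ?C J) x = OMap u (tfst x)" if "x \<in> Obj ?C" for x
    using that by (simp add: comp_fctr_obj fctr_src[OF slice_pr_functors]; simp add: slice_pr_def mk_fctr_def)
  have Go: "OMap (obj_fctr K k \<odot> to_point ?C) x = k" if "x \<in> Obj ?C" for x
    using that fctr_obj[OF p that] by (simp add: comp_fctr_obj fctr_src[OF p])
  have pi: "AMap (to_point ?C) f = Ide point_cat Pt" if "f \<in> Arr ?C" for f
    using that by (simp add: to_point_def const_fctr_def mk_fctr_def)
  show ?thesis
    unfolding over_slice_2cell_def fctr_src[OF u]
  proof (rule mk_ntrans_ntranss[OF F G])
    show "tsnd x \<in> Hom K (OMap (u \<odot> slice_pr ?C J) x) (OMap (obj_fctr K k \<odot> to_point ?C) x)"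
      if "x \<in> Obj ?C" for x
      using Fo[OF that] Go[OF that] over_slice_dest(2)[OF that] by simp
    fix h x y assume h: "h \<in> Hom ?C x y"
    obtain g where g: "h = Tup (Tup x y) g" "x \<in> Obj ?C" "y \<in> Obj ?C" "g \<in> Hom J (tfst x) (tfst y)"
        "Comp K (tsnd y) (AMap u g) = tsnd x"
      using h over_slice_hom by blast
    have 1: "AMap (u \<odot> slice_pr ?C J) h = AMap u g"
      using HomD(1)[OF h] g(1) by (simp add: comp_fctr_arr fctr_src[OF slice_pr_functors]; simp add: slice_pr_def mk_fctr_def)
    have "AMap (obj_fctr K k \<odot> to_point ?C) h = Ide K k"
      using HomD(1)[OF h] pi fctr_ide[OF o, of Pt] by (simp add: comp_fctr_arr fctr_src[OF p])
    then show "Comp K (AMap (obj_fctr K k \<odot> to_point ?C) h) (tsnd x) =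
        Comp K (tsnd y) (AMap (u \<odot> slice_pr ?C J) h)"
      using 1 g(5) comp_ide_left[OF K over_slice_dest(2)[OF g(2)]] by simp
  qed
qed

end

text \<open>An arrow from \<open>(x, g)\<close> to \<open>(j, id)\<close> is an arrow \<open>f : x \<rightarrow> j\<close> with \<open>u f = g\<close>.\<close>

lemma over_slice_terminal:
  assumes u: "u \<in> functors J K" and j: "j \<in> Obj J"
    and ff: "\<And>x g. x \<in> Obj J \<Longrightarrow> g \<in> Hom K (OMap u x) (OMap u j) \<Longrightarrow> \<exists>!f. f \<in> Hom J x j \<and> AMap u f = g"
  shows "terminal (over_slice u (OMap u j)) (Tup j (Ide K (OMap u j)))"
proof -
  let ?k = "OMap u j" let ?C = "over_slice u ?k" let ?t = "Tup j (Ide K ?k)"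
  note K = fctr_cat(2)[OF u] and k = fctr_obj[OF u j]
  have t: "?t \<in> Obj ?C" using over_slice_obj[OF u k] j ide_hom[OF K k] by simp
  have "\<exists>!h. h \<in> Hom ?C x ?t" if x: "x \<in> Obj ?C" for x
  proof -
    note dx = over_slice_dest[OF u k x]
    have "h \<in> Hom ?C x ?t \<longleftrightarrow> (\<exists>g. h = Tup (Tup x ?t) g \<and> g \<in> Hom J (tfst x) j \<and> AMap u g = tsnd x)" for h
      using x t comp_ide_left[OF K fctr_hom[OF u]] comp_ide_left[OF K dx(2)] by (auto simp: over_slice_hom[OF u k])
    moreover have "\<exists>!g. g \<in> Hom J (tfst x) j \<and> AMap u g = tsnd x" using ff[OF dx] .
    ultimately show ?thesis by metis
  qed
  then show ?thesis using t unfolding terminal_def by blast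
qed

section \<open>Prederivators\<close>

context
  fixes S :: "'a code set \<Rightarrow> bool" and \<D> :: "('a, 'o, 'm) prederiv"
  assumes D: "prederivator S \<D>"
begin

lemmas prederivator_val = D[unfolded prederivator_def, THEN conjunct1, rule_format]
lemmas prederivator_local = D[unfolded prederivator_def, THEN conjunct2, THEN conjunct1, rule_format]
lemmas prederivator_id =
  D[unfolded prederivator_def, THEN conjunct2, THEN conjunct2, THEN conjunct1, rule_format]
lemmas prederivator_comp =
  D[unfolded prederivator_def, THEN conjunct2, THEN conjunct2, THEN conjunct2, rule_format]

lemma val_category: "small_cat S J \<Longrightarrow> category (Val \<D> J)"
  by (rule prederivator_val)

lemma pull_functors:
  "small_cat S J \<Longrightarrow> small_cat S K \<Longrightarrow> u \<in> functors J K \<Longrightarrow> Pull \<D> u \<in> functors (Val \<D> K) (Val \<D> J)"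
  using prederivator_local[of J K] by simp

lemma pull2_ntranss:
  assumes "small_cat S J" "small_cat S K" "u \<in> functors J K" "a \<in> ntranss u v"
  shows "Pull2 \<D> a \<in> ntranss (Pull \<D> u) (Pull \<D> v)"
  using prederivator_local[OF assms(1,2), THEN conjunct2, THEN conjunct1] assms(3,4)
    ntrans_tgt[OF assms(4,3)] by simp

lemma pull2_id:
  "small_cat S J \<Longrightarrow> small_cat S K \<Longrightarrow> u \<in> functors J K \<Longrightarrow> Pull2 \<D> (id_ntrans u) = id_ntrans (Pull \<D> u)"
  using prederivator_local[of J K] by simp

lemma pull2_vcomp:
  assumes "small_cat S J" "small_cat S K" and u: "u \<in> functors J K" and a: "a \<in> ntranss u v"
    and b: "b \<in> ntranss v w"
  shows "Pull2 \<D> (vcomp b a) = vcomp (Pull2 \<D> b) (Pull2 \<D> a)"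
  using prederivator_local[OF assms(1,2), THEN conjunct2, THEN conjunct2, THEN conjunct2,
      rule_format, OF u ntrans_tgt[OF a u] ntrans_tgt[OF b ntrans_tgt[OF a u]] a b] .

lemma pull_id: "small_cat S J \<Longrightarrow> Pull \<D> (id_fctr J) = id_fctr (Val \<D> J)"
  by (rule prederivator_id)

lemma pull_comp:
  "small_cat S J \<Longrightarrow> small_cat S K \<Longrightarrow> small_cat S L \<Longrightarrow> u \<in> functors J K \<Longrightarrow> v \<in> functors K L \<Longrightarrow>
     Pull \<D> (v \<odot> u) = Pull \<D> u \<odot> Pull \<D> v"
  by (rule prederivator_comp[THEN conjunct1, rule_format])

lemma pull2_hcomp:
  assumes "small_cat S J" "small_cat S K" "small_cat S L" and u: "u \<in> functors J K" and v: "v \<in> functors K L"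
    and a: "a \<in> ntranss u u'" and b: "b \<in> ntranss v v'"
  shows "Pull2 \<D> (hcomp b a) = hcomp (Pull2 \<D> a) (Pull2 \<D> b)"
  using prederivator_comp[OF assms(1-3), THEN conjunct2, rule_format, OF u ntrans_tgt[OF a u] v
      ntrans_tgt[OF b v] a b] .

lemma pull_comp_obj:
  assumes "small_cat S J" "small_cat S K" "small_cat S L" "u \<in> functors J K" and v: "v \<in> functors K L"
    and "X \<in> Obj (Val \<D> L)"
  shows "OMap (Pull \<D> u) (OMap (Pull \<D> v) X) = OMap (Pull \<D> (v \<odot> u)) X"
  using pull_comp[OF assms(1-5)] assms(6) fctr_src[OF pull_functors[OF assms(2,3) v]]
  by (simp add: comp_fctr_obj)

lemma pull_comp_arr:
  assumes "small_cat S J" "small_cat S K" "small_cat S L" "u \<in> functors J K" and v: "v \<in> functors K L"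
    and "f \<in> Arr (Val \<D> L)"
  shows "AMap (Pull \<D> u) (AMap (Pull \<D> v) f) = AMap (Pull \<D> (v \<odot> u)) f"
  using pull_comp[OF assms(1-5)] assms(6) fctr_src[OF pull_functors[OF assms(2,3) v]]
  by (simp add: comp_fctr_arr)

text \<open>A 2-functor that reverses functors but not transformations turns an adjunction into one in which
  the two functors have changed sides; unit and counit keep their roles.\<close>

lemma pull_adjunction:
  assumes J: "small_cat S J" and K: "small_cat S K" and v: "v \<in> functors K J"
    and adj: "adjunction u v \<eta> \<epsilon>"
  shows "adjunction (Pull \<D> v) (Pull \<D> u) (Pull2 \<D> \<eta>) (Pull2 \<D> \<epsilon>)"
proof -
  note A = adjunctionD[OF adj v]
  note u = A(1)
  have catJ: "category J" and catK: "category K" using fctr_cat[OF u] by auto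
  note pu = pull_functors[OF J K u] and pv = pull_functors[OF K J v]
  note IJ = id_fctr_functors[OF catJ] and IK = id_fctr_functors[OF catK]
  note vu = comp_fctr_functors[OF u v] and uv = comp_fctr_functors[OF v u]
  have \<eta>: "Pull2 \<D> \<eta> \<in> ntranss (id_fctr (Val \<D> J)) (Pull \<D> u \<odot> Pull \<D> v)"
    using pull2_ntranss[OF J J IJ A(2)] unfolding pull_id[OF J] pull_comp[OF J K J u v] .
  have \<epsilon>: "Pull2 \<D> \<epsilon> \<in> ntranss (Pull \<D> v \<odot> Pull \<D> u) (id_fctr (Val \<D> K))"
    using pull2_ntranss[OF K K uv A(3)] unfolding pull_id[OF K] pull_comp[OF K J K v u] .
  note iu = id_ntrans_ntranss[OF u] and iv = id_ntrans_ntranss[OF v]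
  note IVJ = id_fctr_functors[OF val_category[OF J]] and IVK = id_fctr_functors[OF val_category[OF K]]
  note puv = comp_fctr_functors[OF pv pu] and pvu = comp_fctr_functors[OF pu pv]
  have h1: "hcomp \<eta> (id_ntrans v) \<in> ntranss v (v \<odot> u \<odot> v)"
    using hcomp_ntranss[OF v iv IJ A(2)] unfolding comp_id_fctr[OF v] comp_fctr_assoc[OF v u v] .
  have h2: "hcomp (id_ntrans v) \<epsilon> \<in> ntranss (v \<odot> u \<odot> v) v"
    using hcomp_ntranss[OF uv A(3) v iv] unfolding comp_id_fctr[OF v] .
  have "vcomp (hcomp (id_ntrans v) \<epsilon>) (hcomp \<eta> (id_ntrans v)) = id_ntrans v"
  proof (rule ntrans_eqI[OF v vcomp_ntranss[OF v h1 h2] iv])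
    fix x assume x: "x \<in> Obj K"
    show "Cmp (vcomp (hcomp (id_ntrans v) \<epsilon>) (hcomp \<eta> (id_ntrans v))) x = Cmp (id_ntrans v) x"
      using A(5)[OF x] whisker_left_cmp[OF uv A(3) v x] whisker_right_cmp[OF v IJ A(2) x] x
      by (simp add: vcomp_cmp[OF v h1] id_ntrans_cmp fctr_src[OF v])
  qed
  then have t1: "vcomp (hcomp (Pull2 \<D> \<epsilon>) (id_ntrans (Pull \<D> v))) (hcomp (id_ntrans (Pull \<D> v)) (Pull2 \<D> \<eta>)) =
      id_ntrans (Pull \<D> v)"
    using pull2_vcomp[OF K J v h1 h2] pull2_hcomp[OF K J J v IJ iv A(2)]
      pull2_hcomp[OF K K J uv v A(3) iv] pull2_id[OF K J v] by simp
  have h3: "hcomp (id_ntrans u) \<eta> \<in> ntranss u (u \<odot> v \<odot> u)"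
    using hcomp_ntranss[OF IJ A(2) u iu] unfolding comp_id_fctr[OF u] .
  have h4: "hcomp \<epsilon> (id_ntrans u) \<in> ntranss (u \<odot> v \<odot> u) u"
    using hcomp_ntranss[OF u iu uv A(3)] unfolding comp_id_fctr[OF u] comp_fctr_assoc[OF u v u] .
  have "vcomp (hcomp \<epsilon> (id_ntrans u)) (hcomp (id_ntrans u) \<eta>) = id_ntrans u"
  proof (rule ntrans_eqI[OF u vcomp_ntranss[OF u h3 h4] iu])
    fix x assume x: "x \<in> Obj J"
    show "Cmp (vcomp (hcomp \<epsilon> (id_ntrans u)) (hcomp (id_ntrans u) \<eta>)) x = Cmp (id_ntrans u) x"
      using A(4)[OF x] whisker_left_cmp[OF IJ A(2) u x] whisker_right_cmp[OF u uv A(3) x] x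
      by (simp add: vcomp_cmp[OF u h3] id_ntrans_cmp fctr_src[OF u])
  qed
  then have t2: "vcomp (hcomp (id_ntrans (Pull \<D> u)) (Pull2 \<D> \<epsilon>)) (hcomp (Pull2 \<D> \<eta>) (id_ntrans (Pull \<D> u))) =
      id_ntrans (Pull \<D> u)"
    using pull2_vcomp[OF J K u h3 h4] pull2_hcomp[OF J J K IJ u A(2) iu]
      pull2_hcomp[OF J K K u uv iu A(3)] pull2_id[OF J K u] by simp
  have g1: "hcomp (id_ntrans (Pull \<D> v)) (Pull2 \<D> \<eta>) \<in> ntranss (Pull \<D> v) (Pull \<D> v \<odot> Pull \<D> u \<odot> Pull \<D> v)"
    using hcomp_ntranss[OF IVJ \<eta> pv id_ntrans_ntranss[OF pv]] unfolding comp_id_fctr[OF pv] .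
  have g2: "hcomp (Pull2 \<D> \<eta>) (id_ntrans (Pull \<D> u)) \<in> ntranss (Pull \<D> u) (Pull \<D> u \<odot> Pull \<D> v \<odot> Pull \<D> u)"
    using hcomp_ntranss[OF pu id_ntrans_ntranss[OF pu] IVJ \<eta>]
    unfolding comp_id_fctr[OF pu] comp_fctr_assoc[OF pu pv pu] .
  show ?thesis
  proof (rule adjunctionI[OF pv pu \<eta> \<epsilon>])
    fix X assume X: "X \<in> Obj (Val \<D> J)"
    show "Comp (Val \<D> K) (Cmp (Pull2 \<D> \<epsilon>) (OMap (Pull \<D> v) X)) (AMap (Pull \<D> v) (Cmp (Pull2 \<D> \<eta>) X)) =
         Ide (Val \<D> K) (OMap (Pull \<D> v) X)"
      using arg_cong[OF t1, of "\<lambda>a. Cmp a X"] X whisker_left_cmp[OF IVJ \<eta> pv X]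
        whisker_right_cmp[OF pv pvu \<epsilon> X]
      by (simp add: vcomp_cmp[OF pv g1] id_ntrans_cmp fctr_src[OF pv])
  next
    fix X assume X: "X \<in> Obj (Val \<D> K)"
    show "Comp (Val \<D> J) (AMap (Pull \<D> u) (Cmp (Pull2 \<D> \<epsilon>) X)) (Cmp (Pull2 \<D> \<eta>) (OMap (Pull \<D> u) X)) =
         Ide (Val \<D> J) (OMap (Pull \<D> u) X)"
      using arg_cong[OF t2, of "\<lambda>a. Cmp a X"] X whisker_left_cmp[OF pvu \<epsilon> pu X]
        whisker_right_cmp[OF pu IVJ \<eta> X]
      by (simp add: vcomp_cmp[OF pu g2] id_ntrans_cmp fctr_src[OF pu])
  qed
qed

end

section \<open>Kan extensions along full and faithful functors\<close>

lemma derivatorD: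
  assumes "derivator S \<D>"
  shows "prederivator S \<D>" "Der1 S \<D>" "Der2 S \<D>" "Der3 S \<D>" "Der4_left S \<D>" "Der4_right S \<D>"
  using assms unfolding derivator_def by auto

text \<open>Left Kan extension along a full and faithful functor does not change the values on the
  subcategory. At \<open>j\<close> the slice \<open>J\<^sub>/\<^sub>u\<^sub>j\<close> has the terminal object \<open>(j, id)\<close>, so the colimit over the slice
  is evaluation at this object. With this choice of the colimit functor the comparison map of Der4
  becomes \<open>j\<^sup>* \<eta>\<close>, which is therefore invertible, and Der2 applies.\<close>

lemma full_faithful_unit_iso:
  fixes J K :: "'a scat" and \<D> :: "('a, 'o, 'm) prederiv"
  assumes S: "smallness S" and D: "derivator S \<D>" and J: "small_cat S J" and K: "small_cat S K"
    and u: "u \<in> functors J K"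
    and ff: "\<And>x y g. x \<in> Obj J \<Longrightarrow> y \<in> Obj J \<Longrightarrow> g \<in> Hom K (OMap u x) (OMap u y) \<Longrightarrow>
      \<exists>!f. f \<in> Hom J x y \<and> AMap u f = g"
    and adj: "adjunction u_sh (Pull \<D> u) \<eta> \<epsilon>" and X: "X \<in> Obj (Val \<D> J)"
  shows "is_iso (Val \<D> J) (Cmp \<eta> X)"
proof -
  note P = derivatorD(1)[OF D]
  note pu = pull_functors[OF P J K u]
  note sh = adjunctionD(1)[OF adj pu]
  have catJ: "category J" and catK: "category K" using fctr_cat[OF u] by auto
  let ?E = "Val \<D> point_cat"
  let ?W = "OMap u_sh X"
  have W: "?W \<in> Obj (Val \<D> K)" using fctr_obj[OF sh X] .
  have point: "small_cat S (point_cat :: 'a scat)"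
    by (rule small_cat_finite[OF S category_point_cat]) simp_all
  have \<eta>X: "Cmp \<eta> X \<in> Hom (Val \<D> J) X (OMap (Pull \<D> u) ?W)" using unit_hom[OF adj pu X] .
  have "is_iso ?E (AMap (Pull \<D> (obj_fctr J j)) (Cmp \<eta> X))" if j: "j \<in> Obj J" for j
  proof -
    let ?k = "OMap u j"
    have k: "?k \<in> Obj K" using fctr_obj[OF u j] .
    let ?C = "over_slice u ?k" and ?t0 = "Tup j (Ide K (OMap u j))"
    have t0: "terminal ?C ?t0" using over_slice_terminal[OF u j] ff j by blast
    then have t0O: "?t0 \<in> Obj ?C" unfolding terminal_def by simp
    note catC = category_over_slice[OF u k]
    have C: "small_cat S ?C" using small_over_slice[OF S catC] fctr_src[OF u] J K by simp
    let ?t = "obj_fctr ?C ?t0" and ?pr = "slice_pr ?C J" and ?p = "to_point ?C"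
    let ?j = "obj_fctr J j" and ?kk = "obj_fctr K ?k" and ?\<alpha> = "over_slice_2cell u ?k"
    note t = obj_fctr_functors[OF catC t0O] and pr = slice_pr_functors[OF u k]
      and p = to_point_functors[OF catC] and jf = obj_fctr_functors[OF catJ j]
      and kf = obj_fctr_functors[OF catK k]
    obtain \<delta> where \<delta>: "adjunction ?p ?t \<delta> (id_ntrans (id_fctr point_cat))"
      using terminal_adjunction[OF catC t0] by blast
    let ?\<epsilon>' = "Pull2 \<D> (id_ntrans (id_fctr point_cat))"
    have adj': "adjunction (Pull \<D> ?t) (Pull \<D> ?p) (Pull2 \<D> \<delta>) ?\<epsilon>'"
      using pull_adjunction[OF P C point t \<delta>] .
    have iso: "is_iso ?E
       (Comp ?E (Cmp ?\<epsilon>' (OMap (Pull \<D> ?kk) ?W))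
       (Comp ?E (AMap (Pull \<D> ?t) (Cmp (Pull2 \<D> ?\<alpha>) ?W))
                (AMap (Pull \<D> ?t) (AMap (Pull \<D> ?pr) (Cmp \<eta> X)))))"
      using derivatorD(5)[OF D, unfolded Der4_left_def Let_def, rule_format, OF J K u k adj adj' X] .
    note catE = val_category[OF P point]
    have prt: "?pr \<odot> ?t = ?j"
      using comp_obj_fctr[OF pr t0O] t0O by (simp add: slice_pr_def mk_fctr_def)
    have uj: "u \<odot> ?j = ?kk" using comp_obj_fctr[OF u j] .
    note pkf = pull_functors[OF P point K kf]
    have kW: "OMap (Pull \<D> ?kk) ?W \<in> Obj ?E" using fctr_obj[OF pkf W] .
    \<comment> \<open>The three factors of the comparison map: two are identities, the third is \<open>j\<^sup>* \<eta>\<close>.\<close>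
    have m3: "AMap (Pull \<D> ?t) (AMap (Pull \<D> ?pr) (Cmp \<eta> X)) = AMap (Pull \<D> ?j) (Cmp \<eta> X)"
      using pull_comp_arr[OF P point C J t pr HomD(1)[OF \<eta>X]] prt by simp
    have m3h: "AMap (Pull \<D> ?j) (Cmp \<eta> X) \<in> Hom ?E (OMap (Pull \<D> ?j) X) (OMap (Pull \<D> ?kk) ?W)"
      using fctr_hom[OF pull_functors[OF P point J jf] \<eta>X] pull_comp_obj[OF P point J K jf u W] uj by simp
    note \<alpha> = over_slice_2cell_ntranss[OF u k]
    have upr: "(u \<odot> ?pr) \<odot> ?t = ?kk" using comp_fctr_assoc[OF t pr u] prt uj by simp
    have kpt: "(?kk \<odot> ?p) \<odot> ?t = ?kk"
    proof -
      have "?p \<odot> ?t = id_fctr point_cat"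
        by (rule to_point_unique[OF comp_fctr_functors[OF t p] id_fctr_functors[OF category_point_cat]])
      then show ?thesis using comp_fctr_assoc[OF t p kf] comp_id_fctr(1)[OF kf] by simp
    qed
    have \<alpha>t: "hcomp ?\<alpha> (id_ntrans ?t) = id_ntrans ?kk"
    proof (rule ntrans_eqI[OF kf _ id_ntrans_ntranss[OF kf]])
      show "hcomp ?\<alpha> (id_ntrans ?t) \<in> ntranss ?kk ?kk"
        using hcomp_ntranss[OF t id_ntrans_ntranss[OF t] comp_fctr_functors[OF pr u] \<alpha>]
        unfolding upr kpt .
      show "Cmp (hcomp ?\<alpha> (id_ntrans ?t)) x = Cmp (id_ntrans ?kk) x" if "x \<in> Obj point_cat" for x
        using whisker_right_cmp[OF t comp_fctr_functors[OF pr u] \<alpha> that] that t0O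
        by (simp add: id_ntrans_cmp fctr_src[OF kf]; simp add: over_slice_2cell_def mk_ntrans_def
            fctr_src[OF u] fctr_src[OF comp_fctr_functors[OF pr u]])
    qed
    have m2: "AMap (Pull \<D> ?t) (Cmp (Pull2 \<D> ?\<alpha>) ?W) = Ide ?E (OMap (Pull \<D> ?kk) ?W)"
    proof -
      note upf = pull_functors[OF P C K comp_fctr_functors[OF pr u]]
      have "AMap (Pull \<D> ?t) (Cmp (Pull2 \<D> ?\<alpha>) ?W) =
          Cmp (hcomp (id_ntrans (Pull \<D> ?t)) (Pull2 \<D> ?\<alpha>)) ?W"
        using whisker_left_cmp[OF upf pull2_ntranss[OF P C K comp_fctr_functors[OF pr u] \<alpha>]
            pull_functors[OF P point C t] W] by simp
      also have "\<dots> = Cmp (Pull2 \<D> (id_ntrans ?kk)) ?W"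
        using pull2_hcomp[OF P point C K t comp_fctr_functors[OF pr u] id_ntrans_ntranss[OF t] \<alpha>]
          pull2_id[OF P point C t] \<alpha>t by simp
      also have "\<dots> = Ide ?E (OMap (Pull \<D> ?kk) ?W)"
        using pull2_id[OF P point K kf] W by (simp add: id_ntrans_cmp fctr_src[OF pkf])
      finally show ?thesis .
    qed
    have m1: "Cmp ?\<epsilon>' (OMap (Pull \<D> ?kk) ?W) = Ide ?E (OMap (Pull \<D> ?kk) ?W)"
      using pull2_id[OF P point point id_fctr_functors[OF category_point_cat]] pull_id[OF P point] kW
      by (simp add: id_ntrans_cmp)
    show ?thesis
      using iso unfolding m1 m2 m3 by (simp add: comp_ide_left[OF catE m3h])
  qed
  then show ?thesis
    using derivatorD(3)[OF D, unfolded Der2_def, rule_format, OF J HomD(1)[OF \<eta>X]] by blast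
qed

section \<open>Coproducts, products and zero objects in the values of a derivator\<close>

context
  fixes S :: "'a code set \<Rightarrow> bool" and \<D> :: "('a, 'o, 'm) prederiv"
  assumes S: "smallness S" and D: "derivator S \<D>"
begin

lemmas prederiv = derivatorD(1)[OF D]

lemma left_adjoint_exists:
  assumes "small_cat S J" "small_cat S K" "u \<in> functors J K"
  obtains u_sh \<eta> \<epsilon> where "adjunction u_sh (Pull \<D> u) \<eta> \<epsilon>"
  using derivatorD(4)[OF D, unfolded Der3_def, rule_format, OF assms] unfolding left_adjoint_of_def by blast

lemma right_adjoint_exists:
  assumes "small_cat S J" "small_cat S K" "u \<in> functors J K"
  obtains u_lst \<eta> \<epsilon> where "adjunction (Pull \<D> u) u_lst \<eta> \<epsilon>"
  using derivatorD(4)[OF D, unfolded Der3_def, rule_format, OF assms] unfolding right_adjoint_of_def by blast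

lemma right_adjoint_functors:
  assumes "small_cat S J" "small_cat S K" "u \<in> functors J K" "adjunction (Pull \<D> u) u_lst \<eta> \<epsilon>"
  shows "u_lst \<in> functors (Val \<D> J) (Val \<D> K)"
  using assms(4) fctr_src[OF pull_functors[OF prederiv assms(1-3)]] unfolding adjunction_def functors_def by simp

text \<open>A restriction functor is a left adjoint and a right adjoint.\<close>

lemma pull_preserves:
  assumes "small_cat S J" "small_cat S K" "u \<in> functors J K"
  shows "preserves_finite_coproducts (Pull \<D> u)" "preserves_finite_products (Pull \<D> u)"
proof -
  note pu = pull_functors[OF prederiv assms]
  obtain u_lst \<eta> \<epsilon> where r: "adjunction (Pull \<D> u) u_lst \<eta> \<epsilon>" using right_adjoint_exists[OF assms] .
  show "preserves_finite_coproducts (Pull \<D> u)"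
    using left_adjoint_preserves_coproducts[OF r right_adjoint_functors[OF assms r]] .
  obtain u_sh \<eta> \<epsilon> where l: "adjunction u_sh (Pull \<D> u) \<eta> \<epsilon>" using left_adjoint_exists[OF assms] .
  show "preserves_finite_products (Pull \<D> u)"
    using right_adjoint_preserves_products[OF l pu] .
qed

lemma pull_preserves_zero:
  assumes "small_cat S J" "small_cat S K" "u \<in> functors J K" "zero_object (Val \<D> K) z"
  shows "zero_object (Val \<D> J) (OMap (Pull \<D> u) z)"
proof -
  note pu = pull_functors[OF prederiv assms(1-3)]
  have 0: "is_coproduct (Val \<D> K) 0 (\<lambda>_. z) z (\<lambda>_. Ide (Val \<D> K) z)"
      "is_product (Val \<D> K) 0 (\<lambda>_. z) z (\<lambda>_. Ide (Val \<D> K) z)"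
    using assms(4) unfolding is_coproduct_def is_product_def zero_object_def initial_def terminal_def
    by simp_all
  have "initial (Val \<D> J) (OMap (Pull \<D> u) z)"
    using pull_preserves(1)[OF assms(1-3), unfolded preserves_finite_coproducts_def fctr_src[OF pu],
        rule_format, OF 0(1)] unfolding is_coproduct_def initial_def by simp
  moreover have "terminal (Val \<D> J) (OMap (Pull \<D> u) z)"
    using pull_preserves(2)[OF assms(1-3), unfolded preserves_finite_products_def fctr_src[OF pu],
        rule_format, OF 0(2)] unfolding is_product_def terminal_def by simp
  ultimately show ?thesis unfolding zero_object_def by simp
qed

lemma small_point: "small_cat S point_cat"
  by (rule small_cat_finite[OF S category_point_cat]) simp_all

lemma pointed_zero_object:
  assumes "pointed \<D>" and J: "small_cat S J" shows "\<exists>z. zero_object (Val \<D> J) z"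
proof -
  have "category J" using J unfolding small_cat_def by simp
  then show ?thesis
    using assms(1) pull_preserves_zero[OF J small_point to_point_functors] unfolding pointed_def by blast
qed

lemma v0_neq_v1 [simp]: "v0 \<noteq> v1" "v1 \<noteq> v0"
  by (auto simp: v0_def v1_def)

lemma sum_cat_simps:
  "Obj (sum_cat J K) = Tup v0 ` Obj J \<union> Tup v1 ` Obj K"
  "h \<in> Hom (sum_cat J K) (Tup v0 x) y \<longleftrightarrow> (\<exists>f z. h = Tup v0 f \<and> y = Tup v0 z \<and> f \<in> Hom J x z)"
  "h \<in> Hom (sum_cat J K) (Tup v1 x) y \<longleftrightarrow> (\<exists>f z. h = Tup v1 f \<and> y = Tup v1 z \<and> f \<in> Hom K x z)"
  by (auto simp: sum_cat_def Hom_def)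

lemma sum_cat_ops:
  "Ide (sum_cat J K) (Tup v0 x) = Tup v0 (Ide J x)"
  "Ide (sum_cat J K) (Tup v1 x) = Tup v1 (Ide K x)"
  "Comp (sum_cat J K) (Tup v0 g) (Tup v0 f) = Tup v0 (Comp J g f)"
  "Comp (sum_cat J K) (Tup v1 g) (Tup v1 f) = Tup v1 (Comp K g f)"
  by (auto simp: sum_cat_def)

lemma sum_cat_Hom_cases:
  assumes "h \<in> Hom (sum_cat J K) a b"
  obtains x y f where "a = Tup v0 x" "b = Tup v0 y" "h = Tup v0 f" "f \<in> Hom J x y"
    | x y f where "a = Tup v1 x" "b = Tup v1 y" "h = Tup v1 f" "f \<in> Hom K x y"
  using assms by (auto simp: sum_cat_def Hom_def)

lemma category_sum_cat:
  assumes J: "category J" and K: "category K" shows "category (sum_cat J K)"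
proof (rule categoryI)
  fix f x y assume "f \<in> Hom (sum_cat J K) x y"
  then show "x \<in> Obj (sum_cat J K) \<and> y \<in> Obj (sum_cat J K)"
    "Comp (sum_cat J K) f (Ide (sum_cat J K) x) = f" "Comp (sum_cat J K) (Ide (sum_cat J K) y) f = f"
    using hom_obj[OF J] hom_obj[OF K] comp_ide_left[OF J] comp_ide_left[OF K] comp_ide_right[OF J]
      comp_ide_right[OF K]
    by (auto elim!: sum_cat_Hom_cases simp: sum_cat_simps sum_cat_ops)
next
  fix x assume "x \<in> Obj (sum_cat J K)"
  then show "Ide (sum_cat J K) x \<in> Hom (sum_cat J K) x x"
    using ide_hom[OF J] ide_hom[OF K] by (auto simp: sum_cat_simps sum_cat_ops)
next
  fix f g x y z assume f: "f \<in> Hom (sum_cat J K) x y" and g: "g \<in> Hom (sum_cat J K) y z"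
  show "Comp (sum_cat J K) g f \<in> Hom (sum_cat J K) x z"
    using f
  proof (cases rule: sum_cat_Hom_cases)
    case (1 x' y' f')
    then show ?thesis using g comp_hom[OF J] by (auto simp: sum_cat_simps sum_cat_ops)
  next
    case (2 x' y' f')
    then show ?thesis using g comp_hom[OF K] by (auto simp: sum_cat_simps sum_cat_ops)
  qed
next
  fix f g h x y z w assume f: "f \<in> Hom (sum_cat J K) x y" and g: "g \<in> Hom (sum_cat J K) y z"
    and h: "h \<in> Hom (sum_cat J K) z w"
  show "Comp (sum_cat J K) h (Comp (sum_cat J K) g f) = Comp (sum_cat J K) (Comp (sum_cat J K) h g) f"
    using f
  proof (cases rule: sum_cat_Hom_cases)
    case (1 x' y' f')
    then show ?thesis using g h comp_assoc[OF J] by (auto simp: sum_cat_simps sum_cat_ops)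
  next
    case (2 x' y' f')
    then show ?thesis using g h comp_assoc[OF K] by (auto simp: sum_cat_simps sum_cat_ops)
  qed
qed

text \<open>The inclusions exhibit \<open>\<D>(J \<squnion> J)\<close> as \<open>\<D>(J) \<times> \<D>(J)\<close> (Der1), and restriction along the fold
  functor \<open>J \<squnion> J \<rightarrow> J\<close> corresponds to the diagonal under this identification.\<close>

lemma fold_decomposition:
  assumes J: "small_cat S J"
  obtains B :: "('o, 'm) cat" and E F N where "E \<in> functors B (Val \<D> J)" "F \<in> functors B (Val \<D> J)" "N \<in> functors (Val \<D> J) B"
    "jointly_equivalence E F" "E \<odot> N = id_fctr (Val \<D> J)" "F \<odot> N = id_fctr (Val \<D> J)"
    "\<exists>L. left_adjoint_of L N" "\<exists>R. right_adjoint_of R N"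
proof -
  let ?JJ = "sum_cat J J"
  let ?l = "sum_inl J J" and ?r = "sum_inr J J" and ?f = "mk_fctr ?JJ J tsnd tsnd"
  have cJ: "category J" using J unfolding small_cat_def by simp
  note cJJ = category_sum_cat[OF cJ cJ]
  note JJ = small_sum_cat[OF S cJJ J J]
  have l: "?l \<in> functors J ?JJ"
    unfolding sum_inl_def by (rule mk_fctr_functors[OF cJ cJJ]) (auto simp: sum_cat_simps sum_cat_ops)
  have r: "?r \<in> functors J ?JJ"
    unfolding sum_inr_def by (rule mk_fctr_functors[OF cJ cJJ]) (auto simp: sum_cat_simps sum_cat_ops)
  have f: "?f \<in> functors ?JJ J"
    by (rule mk_fctr_functors[OF cJJ cJ])
      (auto elim!: sum_cat_Hom_cases simp: sum_cat_simps sum_cat_ops)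
  have arr: "Tup v0 h \<in> Arr ?JJ" "Tup v1 h \<in> Arr ?JJ" if "h \<in> Arr J" for h
    using that by (auto simp: sum_cat_def)
  have fl: "?f \<odot> ?l = id_fctr J"
    by (rule fctr_eqI[OF comp_fctr_functors[OF l f] id_fctr_functors[OF cJ]])
      (auto simp: comp_fctr_obj comp_fctr_arr fctr_src[OF l] sum_inl_def mk_fctr_def arr sum_cat_simps)
  have fr: "?f \<odot> ?r = id_fctr J"
    by (rule fctr_eqI[OF comp_fctr_functors[OF r f] id_fctr_functors[OF cJ]])
      (auto simp: comp_fctr_obj comp_fctr_arr fctr_src[OF r] sum_inr_def mk_fctr_def arr sum_cat_simps)
  note pl = pull_functors[OF prederiv J JJ l] and pr = pull_functors[OF prederiv J JJ r] and pf = pull_functors[OF prederiv JJ J f]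
  have "jointly_equivalence (Pull \<D> ?l) (Pull \<D> ?r)"
    using equivalence_jointly[OF pl pr] derivatorD(2)[OF D] J unfolding Der1_def by blast
  moreover have "Pull \<D> ?l \<odot> Pull \<D> ?f = id_fctr (Val \<D> J)" "Pull \<D> ?r \<odot> Pull \<D> ?f = id_fctr (Val \<D> J)"
    using pull_comp[OF prederiv J JJ J l f] pull_comp[OF prederiv J JJ J r f] fl fr pull_id[OF prederiv J] by simp_all
  moreover have "\<exists>L. left_adjoint_of L (Pull \<D> ?f)" "\<exists>R. right_adjoint_of R (Pull \<D> ?f)"
    using left_adjoint_exists[OF JJ J f] right_adjoint_exists[OF JJ J f]
    unfolding left_adjoint_of_def right_adjoint_of_def by metis+
  ultimately show ?thesis by (rule that[OF pl pr pf])
qed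

lemma binary_coproduct_exists:
  assumes J: "small_cat S J" and X: "X 0 \<in> Obj (Val \<D> J)" "X 1 \<in> Obj (Val \<D> J)"
  obtains c \<iota> where "is_coproduct (Val \<D> J) 2 X c \<iota>"
proof -
  obtain B :: "('o, 'm) cat" and E F N where d: "E \<in> functors B (Val \<D> J)" "F \<in> functors B (Val \<D> J)" "N \<in> functors (Val \<D> J) B"
    "jointly_equivalence E F" "E \<odot> N = id_fctr (Val \<D> J)" "F \<odot> N = id_fctr (Val \<D> J)"
    "\<exists>L. left_adjoint_of L N" "\<exists>R. right_adjoint_of R N" using fold_decomposition[OF J] .
  show ?thesis using coproducts_of_left_adjoint[OF d(1-6,7) X] that by blast
qed

lemma binary_product_exists:
  assumes J: "small_cat S J" and X: "X 0 \<in> Obj (Val \<D> J)" "X 1 \<in> Obj (Val \<D> J)"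
  obtains p \<pi> where "is_product (Val \<D> J) 2 X p \<pi>"
proof -
  obtain B :: "('o, 'm) cat" and E F N where d: "E \<in> functors B (Val \<D> J)" "F \<in> functors B (Val \<D> J)" "N \<in> functors (Val \<D> J) B"
    "jointly_equivalence E F" "E \<odot> N = id_fctr (Val \<D> J)" "F \<odot> N = id_fctr (Val \<D> J)"
    "\<exists>L. left_adjoint_of L N" "\<exists>R. right_adjoint_of R N" using fold_decomposition[OF J] .
  show ?thesis using products_of_right_adjoint[OF d(1-6,8) X] that by blast
qed

lemma pull_canonical_map:
  assumes J: "small_cat S J" and K: "small_cat S K" and u: "u \<in> functors J K"
    and c: "is_coproduct (Val \<D> K) n X c \<iota>" and p: "is_product (Val \<D> K) n X p \<pi>"
    and f: "canonical_map (Val \<D> K) n X c \<iota> p \<pi> f"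
  shows "is_coproduct (Val \<D> J) n (\<lambda>i. OMap (Pull \<D> u) (X i)) (OMap (Pull \<D> u) c) (\<lambda>i. AMap (Pull \<D> u) (\<iota> i))"
    and "is_product (Val \<D> J) n (\<lambda>i. OMap (Pull \<D> u) (X i)) (OMap (Pull \<D> u) p) (\<lambda>i. AMap (Pull \<D> u) (\<pi> i))"
    and "canonical_map (Val \<D> J) n (\<lambda>i. OMap (Pull \<D> u) (X i)) (OMap (Pull \<D> u) c)
      (\<lambda>i. AMap (Pull \<D> u) (\<iota> i)) (OMap (Pull \<D> u) p) (\<lambda>i. AMap (Pull \<D> u) (\<pi> i)) (AMap (Pull \<D> u) f)"
proof -
  note pu = pull_functors[OF prederiv J K u]
  note C = fctr_cat[OF pu]
  show "is_coproduct (Val \<D> J) n (\<lambda>i. OMap (Pull \<D> u) (X i)) (OMap (Pull \<D> u) c) (\<lambda>i. AMap (Pull \<D> u) (\<iota> i))"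
    using pull_preserves(1)[OF J K u, unfolded preserves_finite_coproducts_def fctr_src[OF pu],
        rule_format, OF c] .
  show "is_product (Val \<D> J) n (\<lambda>i. OMap (Pull \<D> u) (X i)) (OMap (Pull \<D> u) p) (\<lambda>i. AMap (Pull \<D> u) (\<pi> i))"
    using pull_preserves(2)[OF J K u, unfolded preserves_finite_products_def fctr_src[OF pu],
        rule_format, OF p] .
  have fh: "f \<in> Hom (Val \<D> K) c p"
    and m: "identity_matrix (Val \<D> K) n X (\<lambda>i j. Comp (Val \<D> K) (\<pi> i) (Comp (Val \<D> K) f (\<iota> j)))"
    using f unfolding canonical_map_iff by auto
  note ih = is_coproductD(3)[OF c] and ph = is_productD(3)[OF p]
  have "AMap (Pull \<D> u) (Comp (Val \<D> K) (\<pi> i) (Comp (Val \<D> K) f (\<iota> j))) =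
      Comp (Val \<D> J) (AMap (Pull \<D> u) (\<pi> i)) (Comp (Val \<D> J) (AMap (Pull \<D> u) f) (AMap (Pull \<D> u) (\<iota> j)))"
    if "i < n" "j < n" for i j
    using fctr_comp[OF pu comp_hom[OF C(1) ih[OF that(2)] fh] ph[OF that(1)]]
      fctr_comp[OF pu ih[OF that(2)] fh] by simp
  then show "canonical_map (Val \<D> J) n (\<lambda>i. OMap (Pull \<D> u) (X i)) (OMap (Pull \<D> u) c)
      (\<lambda>i. AMap (Pull \<D> u) (\<iota> i)) (OMap (Pull \<D> u) p) (\<lambda>i. AMap (Pull \<D> u) (\<pi> i)) (AMap (Pull \<D> u) f)"
    using preserves_identity_matrix[OF pu pull_preserves_zero[OF J K u] m is_coproductD(2)[OF c]]
      fctr_hom[OF pu fh] unfolding canonical_map_iff by (simp cong: identity_matrix_cong)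
qed

text \<open>The value at \<open>j\<close> of the canonical map in \<open>\<D>(J)\<close> is the canonical map between the values, and by Der2
  invertibility is tested on values.\<close>

lemma semiadditive_from_point:
  assumes point: "pointed \<D>" and sa: "semiadditive (Val \<D> point_cat)" and J: "small_cat S J"
  shows "semiadditive (Val \<D> J)"
proof -
  let ?C = "Val \<D> J"
  note C = val_category[OF prederiv J]
  have cJ: "category J" using J unfolding small_cat_def by simp
  obtain z where z: "zero_object ?C z" using pointed_zero_object[OF point J] by auto
  show ?thesis
  proof (rule semiadditiveI[OF C z])
    fix X :: "nat \<Rightarrow> 'o" assume X: "X 0 \<in> Obj ?C" "X 1 \<in> Obj ?C"
    obtain c \<iota> where c: "is_coproduct ?C 2 X c \<iota>" using binary_coproduct_exists[OF J X] .
    obtain p \<pi> where p: "is_product ?C 2 X p \<pi>" using binary_product_exists[OF J X] .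
    obtain f where f: "canonical_map ?C 2 X c \<iota> p \<pi> f" using canonical_map_exists[OF C z c p] .
    have "is_iso (Val \<D> point_cat) (AMap (Pull \<D> (obj_fctr J j)) f)" if j: "j \<in> Obj J" for j
      using semiadditive_canonically[OF sa, unfolded coproducts_canonically_products_def, rule_format,
          OF pull_canonical_map(1,2)[OF small_point J obj_fctr_functors[OF cJ j] c p f]]
        pull_canonical_map(3)[OF small_point J obj_fctr_functors[OF cJ j] c p f] by blast
    moreover have "f \<in> Arr ?C" using f unfolding canonical_map_def by (simp add: Hom_def)
    ultimately have "is_iso ?C f"
      using derivatorD(3)[OF D, unfolded Der2_def, rule_format, OF J] by blast
    then show "\<exists>b \<iota> \<pi>. is_biproduct ?C 2 X b \<iota> \<pi>"
      using biproduct_of_canonical_iso[OF C z c p f] by blast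
  qed
qed

end

section \<open>Functors between finite posets\<close>

text \<open>A thin category is a preorder: functors into it are determined by their objects, and all diagrams
  commute. All shapes below are of this kind.\<close>

definition thin :: "('o, 'm) cat \<Rightarrow> bool" where
  "thin C \<longleftrightarrow> (\<forall>x y. \<forall>f \<in> Hom C x y. \<forall>g \<in> Hom C x y. f = g)"

definition thin_fctr :: "('o, 'm) cat \<Rightarrow> ('p, 'n) cat \<Rightarrow> ('o \<Rightarrow> 'p) \<Rightarrow> ('o, 'm, 'p, 'n) fctr" where
  "thin_fctr C D fo = mk_fctr C D fo (\<lambda>f. THE g. g \<in> Hom D (fo (Dom C f)) (fo (Cod C f)))"

lemma thinD: "thin C \<Longrightarrow> f \<in> Hom C x y \<Longrightarrow> g \<in> Hom C x y \<Longrightarrow> f = g"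
  unfolding thin_def by blast

lemma thin_fctr_functors:
  assumes C: "category C" and D: "category D" and th: "thin D"
    and o: "\<And>x. x \<in> Obj C \<Longrightarrow> fo x \<in> Obj D"
    and m: "\<And>f x y. f \<in> Hom C x y \<Longrightarrow> \<exists>g. g \<in> Hom D (fo x) (fo y)"
  shows "thin_fctr C D fo \<in> functors C D"
proof -
  define fm where "fm f = (THE g. g \<in> Hom D (fo (Dom C f)) (fo (Cod C f)))" for f
  have fm: "fm f \<in> Hom D (fo x) (fo y)" if f: "f \<in> Hom C x y" for f x y
  proof -
    have "\<exists>!g. g \<in> Hom D (fo x) (fo y)" using m[OF f] thinD[OF th] by blast
    then show ?thesis using theI'[of "\<lambda>g. g \<in> Hom D (fo x) (fo y)"] HomD[OF f] by (simp add: fm_def)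
  qed
  have "mk_fctr C D fo fm \<in> functors C D"
  proof (rule mk_fctr_functors[OF C D o fm])
    show "fm (Ide C x) = Ide D (fo x)" if x: "x \<in> Obj C" for x
      using thinD[OF th fm[OF ide_hom[OF C x]] ide_hom[OF D o[OF x]]] .
    show "fm (Comp C g f) = Comp D (fm g) (fm f)" if f: "f \<in> Hom C x y" and g: "g \<in> Hom C y z"
      for f g x y z
      using thinD[OF th fm[OF comp_hom[OF C f g]] comp_hom[OF D fm[OF f] fm[OF g]]] .
  qed
  then show ?thesis unfolding thin_fctr_def fm_def .
qed

lemma thin_fctr_obj: "x \<in> Obj C \<Longrightarrow> OMap (thin_fctr C D fo) x = fo x"
  by (simp add: thin_fctr_def mk_fctr_def)

lemma thin_fctr_eqI:
  assumes th: "thin D" and F: "F \<in> functors C D" and G: "G \<in> functors C D"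
    and o: "\<And>x. x \<in> Obj C \<Longrightarrow> OMap F x = OMap G x"
  shows "F = G"
proof (rule fctr_eqI[OF F G o])
  fix f assume f: "f \<in> Arr C"
  note h = hom_self[OF f]
  have "OMap F (Dom C f) = OMap G (Dom C f)" "OMap F (Cod C f) = OMap G (Cod C f)"
    using o hom_obj[OF fctr_cat(1)[OF F] h] by auto
  then show "AMap F f = AMap G f" using thinD[OF th fctr_hom[OF F h]] fctr_hom[OF G h] by simp
qed

text \<open>For preorders the triangle identities are automatic. The unit is an identity, so the universal
  arrows of the adjunction that a derivator makes of this one are identities as well.\<close>

lemma thin_adjunction:
  assumes thC: "thin C" and thD: "thin D" and u: "u \<in> functors C D" and v: "v \<in> functors D C"
    and vu: "v \<odot> u = id_fctr C"
    and le: "\<And>y. y \<in> Obj D \<Longrightarrow> \<exists>f. f \<in> Hom D (OMap u (OMap v y)) y"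
  obtains \<epsilon> where "adjunction u v (id_ntrans (id_fctr C)) \<epsilon>"
proof -
  note C = fctr_cat[OF u]
  note I = id_fctr_functors[OF C(1)] and J = id_fctr_functors[OF C(2)] and uv = comp_fctr_functors[OF v u]
  obtain c where c: "\<And>y. y \<in> Obj D \<Longrightarrow> c y \<in> Hom D (OMap u (OMap v y)) y" using le by metis
  let ?\<epsilon> = "mk_ntrans (u \<odot> v) (id_fctr D) c"
  have c': "c y \<in> Hom D (OMap (u \<odot> v) y) (OMap (id_fctr D) y)" if "y \<in> Obj D" for y
    using c[OF that] that by (simp add: comp_fctr_obj fctr_src[OF v])
  have \<epsilon>: "?\<epsilon> \<in> ntranss (u \<odot> v) (id_fctr D)"
  proof (rule mk_ntrans_ntranss[OF uv J c'])
    fix f x y assume f: "f \<in> Hom D x y"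
    note xy = hom_obj[OF C(2) f]
    show "Comp D (AMap (id_fctr D) f) (c x) = Comp D (c y) (AMap (u \<odot> v) f)"
      using thinD[OF thD comp_hom[OF C(2) c'[OF xy(1)] fctr_hom[OF J f]]
          comp_hom[OF C(2) fctr_hom[OF uv f] c'[OF xy(2)]]] .
  qed
  have \<epsilon>h: "Cmp ?\<epsilon> y \<in> Hom D (OMap u (OMap v y)) y" if "y \<in> Obj D" for y
    using c[OF that] that by (simp add: mk_ntrans_cmp fctr_src[OF uv])
  have \<eta>: "id_ntrans (id_fctr C) \<in> ntranss (id_fctr C) (v \<odot> u)"
    unfolding vu using id_ntrans_ntranss[OF I] .
  have \<eta>h: "Cmp (id_ntrans (id_fctr C)) x \<in> Hom C x (OMap v (OMap u x))" if "x \<in> Obj C" for x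
    using ntrans_hom[OF \<eta> I that] that by (simp add: comp_fctr_obj fctr_src[OF u])
  have "adjunction u v (id_ntrans (id_fctr C)) ?\<epsilon>"
  proof (rule adjunctionI[OF u v \<eta> \<epsilon>])
    fix x assume x: "x \<in> Obj C"
    note ux = fctr_obj[OF u x]
    show "Comp D (Cmp ?\<epsilon> (OMap u x)) (AMap u (Cmp (id_ntrans (id_fctr C)) x)) = Ide D (OMap u x)"
      using thinD[OF thD comp_hom[OF C(2) fctr_hom[OF u \<eta>h[OF x]] \<epsilon>h[OF ux]] ide_hom[OF C(2) ux]] .
  next
    fix y assume y: "y \<in> Obj D"
    note vy = fctr_obj[OF v y]
    show "Comp C (AMap v (Cmp ?\<epsilon> y)) (Cmp (id_ntrans (id_fctr C)) (OMap v y)) = Ide C (OMap v y)"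
      using thinD[OF thC comp_hom[OF C(1) \<eta>h[OF vy] fctr_hom[OF v \<epsilon>h[OF y]]] ide_hom[OF C(1) vy]] .
  qed
  then show ?thesis using that by blast
qed

lemma thin_poset_cat: "thin (poset_cat Q le)"
  unfolding thin_def by (auto simp: Hom_poset_cat)

lemma Hom_sprod_cat_cases:
  assumes "h \<in> Hom (sprod_cat J K) x y"
  shows "\<exists>f g. h = Tup f g \<and> f \<in> Hom J (tfst x) (tfst y) \<and> g \<in> Hom K (tsnd x) (tsnd y)"
proof -
  obtain f g where "h = Tup f g" "f \<in> Arr J" "g \<in> Arr K"
    using HomD(1)[OF assms] by (auto simp: sprod_cat_def)
  then show ?thesis using HomD(2,3)[OF assms] by (auto simp: Hom_def sprod_cat_def)
qed

lemma thin_sprod_cat: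
  assumes "thin J" "thin K" shows "thin (sprod_cat J K)"
  unfolding thin_def
proof (intro allI ballI)
  fix x y f g assume "f \<in> Hom (sprod_cat J K) x y" "g \<in> Hom (sprod_cat J K) x y"
  then obtain f1 f2 g1 g2 where fg: "f = Tup f1 f2" "g = Tup g1 g2"
    and h: "f1 \<in> Hom J (tfst x) (tfst y)" "f2 \<in> Hom K (tsnd x) (tsnd y)"
      "g1 \<in> Hom J (tfst x) (tfst y)" "g2 \<in> Hom K (tsnd x) (tsnd y)"
    using Hom_sprod_cat_cases by metis
  show "f = g" unfolding fg using thinD[OF assms(1) h(1,3)] thinD[OF assms(2) h(2,4)] by simp
qed

lemma thin_full_subcat: "thin J \<Longrightarrow> thin (full_subcat J A)"
  using thinD[of J] unfolding thin_def[of "full_subcat J A"] Hom_full_subcat Ball_def by blast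

text \<open>The inclusion of a full subcategory is full and faithful.\<close>

lemma inclusion_reflects:
  assumes "x \<in> Obj (full_subcat J A)" "y \<in> Obj (full_subcat J A)"
    and "g \<in> Hom J (OMap (inclusion J A) x) (OMap (inclusion J A) y)"
  shows "\<exists>!f. f \<in> Hom (full_subcat J A) x y \<and> AMap (inclusion J A) f = g"
proof -
  have "AMap (inclusion J A) f = f" if "f \<in> Hom (full_subcat J A) x y" for f
    using that by (auto simp: inclusion_def mk_fctr_def Hom_def)
  moreover have "OMap (inclusion J A) x = x" "OMap (inclusion J A) y = y"
    using assms(1,2) by (auto simp: inclusion_def mk_fctr_def)
  moreover have "x \<in> A" "y \<in> A" using assms(1,2) by (auto simp: full_subcat_def)
  ultimately show ?thesis using assms(3) by (auto simp: Hom_full_subcat)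
qed

section \<open>The square and its corners\<close>

text \<open>Strongness speaks about \<open>[1] \<times> J\<close>, so the interval appears as \<open>[1] \<times> e\<close>.\<close>

abbreviation edge_cat :: "'a scat" where
  "edge_cat \<equiv> sprod_cat interval_cat point_cat"

abbreviation span_cat :: "'a scat" where
  "span_cat \<equiv> full_subcat square_cat {Tup v0 v0, Tup v1 v0, Tup v0 v1}"

abbreviation cospan_cat :: "'a scat" where
  "cospan_cat \<equiv> full_subcat square_cat {Tup v1 v0, Tup v0 v1, Tup v1 v1}"

lemma interval_cat_obj: "Obj interval_cat = {v0, v1}"
  by (simp add: interval_cat_def poset_cat_def)

lemma square_cat_obj: "Obj square_cat = {Tup v0 v0, Tup v1 v0, Tup v0 v1, Tup v1 v1}"
  by (auto simp: square_cat_def sprod_cat_def interval_cat_obj)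

lemma edge_cat_obj: "Obj edge_cat = {Tup v0 Pt, Tup v1 Pt}"
  by (auto simp: sprod_cat_def interval_cat_obj)

lemma span_cat_obj: "Obj span_cat = {Tup v0 v0, Tup v1 v0, Tup v0 v1}"
  by (auto simp: full_subcat_def square_cat_obj)

lemma cospan_cat_obj: "Obj cospan_cat = {Tup v1 v0, Tup v0 v1, Tup v1 v1}"
  by (auto simp: full_subcat_def square_cat_obj)

definition interval_le :: "'a code \<Rightarrow> 'a code \<Rightarrow> bool" where
  "interval_le a b \<longleftrightarrow> a = v0 \<and> b = v0 \<or> a = v0 \<and> b = v1 \<or> a = v1 \<and> b = v1"

lemma Ex_Hom_square: "(\<exists>f. f \<in> Hom square_cat (Tup a b) (Tup c d)) \<longleftrightarrow> interval_le a c \<and> interval_le b d"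
  by (auto simp: square_cat_def Hom_sprod_cat interval_cat_def Hom_poset_cat interval_le_def)

lemma Ex_Hom_edge: "(\<exists>f. f \<in> Hom edge_cat (Tup a Pt) (Tup c Pt)) \<longleftrightarrow> interval_le a c"
  by (auto simp: Hom_sprod_cat interval_cat_def point_cat_def Hom_poset_cat interval_le_def)

lemma shape_categories:
  "category square_cat" "category edge_cat" "category span_cat" "category cospan_cat"
  using category_sprod_cat[OF category_interval_cat category_interval_cat]
    category_sprod_cat[OF category_interval_cat category_point_cat] category_full_subcat
  unfolding square_cat_def by blast+

lemma shape_thin: "thin square_cat" "thin edge_cat" "thin span_cat" "thin cospan_cat"
proof -
  show "thin square_cat" "thin edge_cat"
    unfolding square_cat_def interval_cat_def point_cat_def by (intro thin_sprod_cat thin_poset_cat)+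
  then show "thin span_cat" "thin cospan_cat" using thin_full_subcat by blast+
qed

lemma finite_sprod_cat:
  assumes "finite (Obj J)" "finite (Arr J)" "finite (Obj K)" "finite (Arr K)"
  shows "finite (Obj (sprod_cat J K))" "finite (Arr (sprod_cat J K))"
proof -
  have "Obj (sprod_cat J K) = (\<lambda>(x, y). Tup x y) ` (Obj J \<times> Obj K)"
    "Arr (sprod_cat J K) = (\<lambda>(x, y). Tup x y) ` (Arr J \<times> Arr K)"
    by (auto simp: sprod_cat_def)
  then show "finite (Obj (sprod_cat J K))" "finite (Arr (sprod_cat J K))" using assms by simp_all
qed

lemma finite_interval_cat: "finite (Obj interval_cat)" "finite (Arr interval_cat)"
proof -
  show "finite (Obj interval_cat)" by (simp add: interval_cat_obj)
  have "Arr interval_cat \<subseteq> (\<lambda>(x, y). Tup x y) ` ({v0, v1} \<times> {v0, v1})"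
    by (auto simp: interval_cat_def poset_cat_def)
  then show "finite (Arr interval_cat)" by (rule finite_subset) simp
qed

lemma finite_full_subcat:
  assumes "finite (Obj J)" "finite (Arr J)"
  shows "finite (Obj (full_subcat J A))" "finite (Arr (full_subcat J A))"
  using assms by (simp_all add: full_subcat_def)

lemma small_shapes:
  fixes S :: "'a code set \<Rightarrow> bool"
  assumes S: "smallness S"
  shows "small_cat S square_cat" "small_cat S edge_cat" "small_cat S span_cat" "small_cat S cospan_cat"
proof -
  note sq = finite_sprod_cat[OF finite_interval_cat finite_interval_cat, folded square_cat_def]
  have "finite (Obj edge_cat)" "finite (Arr edge_cat)"
    by (rule finite_sprod_cat[OF finite_interval_cat]; simp)+
  then show "small_cat S square_cat" "small_cat S edge_cat" "small_cat S span_cat" "small_cat S cospan_cat"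
    using small_cat_finite[OF S] shape_categories sq finite_full_subcat[OF sq] by blast+
qed

text \<open>The projection of the square to its first coordinate, its left adjoint, the inclusion of the edge
  from \<open>(0,0)\<close> to \<open>(1,0)\<close>, and the factorization of that inclusion through the span. The last functor
  sends the tip \<open>(1,1)\<close> of the cospan to \<open>1\<close> and the two legs to \<open>0\<close>.\<close>

definition square_proj :: "'a sfctr" where
  "square_proj = thin_fctr square_cat edge_cat (\<lambda>x. Tup (tfst x) Pt)"

definition edge_square :: "'a sfctr" where
  "edge_square = thin_fctr edge_cat square_cat (\<lambda>x. Tup (tfst x) v0)"

definition edge_span :: "'a sfctr" where
  "edge_span = thin_fctr edge_cat span_cat (\<lambda>x. Tup (tfst x) v0)"

definition cospan_tip :: "'a sfctr" where
  "cospan_tip = thin_fctr cospan_cat edge_cat (\<lambda>x. Tup (if x = Tup v1 v1 then v1 else v0) Pt)"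

lemma square_proj_functors: "square_proj \<in> functors square_cat edge_cat"
  unfolding square_proj_def
proof (rule thin_fctr_functors[OF shape_categories(1,2) shape_thin(2)])
  fix f x y :: "'a code" assume f: "f \<in> Hom square_cat x y"
  then obtain a b c d where "x = Tup a b" "y = Tup c d"
    using hom_obj[OF shape_categories(1) f] by (auto simp: square_cat_obj)
  then show "\<exists>g. g \<in> Hom edge_cat (Tup (tfst x) Pt) (Tup (tfst y) Pt)"
    using f Ex_Hom_square[of a b c d] Ex_Hom_edge[of a c] by auto
qed (auto simp: square_cat_obj edge_cat_obj)

lemma edge_square_functors: "edge_square \<in> functors edge_cat square_cat"
  unfolding edge_square_def
proof (rule thin_fctr_functors[OF shape_categories(2,1) shape_thin(1)])
  fix f x y :: "'a code" assume f: "f \<in> Hom edge_cat x y"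
  then obtain a b where "x = Tup a Pt" "y = Tup b Pt"
    using hom_obj[OF shape_categories(2) f] by (auto simp: edge_cat_obj)
  then show "\<exists>g. g \<in> Hom square_cat (Tup (tfst x) v0) (Tup (tfst y) v0)"
    using f Ex_Hom_square[of a v0 b v0] Ex_Hom_edge[of a b] by (auto simp: interval_le_def)
qed (auto simp: square_cat_obj edge_cat_obj)

lemma edge_span_functors: "edge_span \<in> functors edge_cat span_cat"
  unfolding edge_span_def
proof (rule thin_fctr_functors[OF shape_categories(2,3) shape_thin(3)])
  fix f x y :: "'a code" assume f: "f \<in> Hom edge_cat x y"
  then obtain a b where "x = Tup a Pt" "y = Tup b Pt" "a \<in> {v0, v1}" "b \<in> {v0, v1}"
    using hom_obj[OF shape_categories(2) f] by (auto simp: edge_cat_obj)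
  then show "\<exists>g. g \<in> Hom span_cat (Tup (tfst x) v0) (Tup (tfst y) v0)"
    using f Ex_Hom_square[of a v0 b v0] Ex_Hom_edge[of a b] by (auto simp: interval_le_def Hom_full_subcat)
qed (auto simp: span_cat_obj edge_cat_obj)

lemma cospan_tip_functors: "cospan_tip \<in> functors cospan_cat edge_cat"
  unfolding cospan_tip_def
proof (rule thin_fctr_functors[OF shape_categories(4,2) shape_thin(2)])
  fix f x y :: "'a code" assume f: "f \<in> Hom cospan_cat x y"
  then obtain a b c d where "x = Tup a b" "y = Tup c d" "x \<in> Obj cospan_cat" "y \<in> Obj cospan_cat"
    using hom_obj[OF shape_categories(4) f] by (auto simp: cospan_cat_obj)
  then show "\<exists>g. g \<in> Hom edge_cat (Tup (if x = Tup v1 v1 then v1 else v0) Pt)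
      (Tup (if y = Tup v1 v1 then v1 else v0) Pt)"
    using f Ex_Hom_square[of a b c d]
    unfolding Ex_Hom_edge by (auto simp: interval_le_def Hom_full_subcat cospan_cat_obj)
qed (auto simp: cospan_cat_obj edge_cat_obj)

lemma span_incl_functors: "span_incl \<in> functors span_cat square_cat"
  unfolding span_incl_def by (rule inclusion_functors[OF shape_categories(1)])

lemma cospan_incl_functors: "cospan_incl \<in> functors cospan_cat square_cat"
  unfolding cospan_incl_def by (rule inclusion_functors[OF shape_categories(1)])

lemma span_incl_obj: "x \<in> Obj span_cat \<Longrightarrow> OMap span_incl x = x"
  by (simp add: span_incl_def inclusion_def mk_fctr_def)

lemma cospan_incl_obj: "x \<in> Obj cospan_cat \<Longrightarrow> OMap cospan_incl x = x"
  by (simp add: cospan_incl_def inclusion_def mk_fctr_def)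

lemma shape_fctr_obj:
  "x \<in> Obj square_cat \<Longrightarrow> OMap square_proj x = Tup (tfst x) Pt"
  "x \<in> Obj edge_cat \<Longrightarrow> OMap edge_square x = Tup (tfst x) v0"
  "x \<in> Obj edge_cat \<Longrightarrow> OMap edge_span x = Tup (tfst x) v0"
  "x \<in> Obj cospan_cat \<Longrightarrow> OMap cospan_tip x = Tup (if x = Tup v1 v1 then v1 else v0) Pt"
  by (simp_all only: square_proj_def edge_square_def edge_span_def cospan_tip_def thin_fctr_obj)

lemma square_proj_edge_square: "square_proj \<odot> edge_square = id_fctr edge_cat"
  by (rule thin_fctr_eqI[OF shape_thin(2) comp_fctr_functors[OF edge_square_functors square_proj_functors]
        id_fctr_functors[OF shape_categories(2)]])
    (auto simp: comp_fctr_obj fctr_src[OF edge_square_functors] edge_cat_obj square_cat_obj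
      shape_fctr_obj span_incl_obj)

lemma span_incl_edge_span: "span_incl \<odot> edge_span = edge_square"
  by (rule thin_fctr_eqI[OF shape_thin(1) comp_fctr_functors[OF edge_span_functors span_incl_functors]
        edge_square_functors])
    (auto simp: comp_fctr_obj fctr_src[OF edge_span_functors] edge_cat_obj span_cat_obj
      shape_fctr_obj span_incl_obj)

lemma edge_square_adjunction:
  obtains \<epsilon> where "adjunction edge_square square_proj (id_ntrans (id_fctr edge_cat)) \<epsilon>"
proof (rule thin_adjunction[OF shape_thin(2,1) edge_square_functors square_proj_functors
      square_proj_edge_square])
  fix y :: "'a code" assume y: "y \<in> Obj square_cat"
  then obtain a b where ab: "y = Tup a b" "a \<in> {v0, v1}" "b \<in> {v0, v1}" by (auto simp: square_cat_obj)
  have "OMap edge_square (OMap square_proj y) = Tup a v0"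
    using y ab by (auto simp: shape_fctr_obj edge_cat_obj)
  then show "\<exists>f. f \<in> Hom square_cat (OMap edge_square (OMap square_proj y)) y"
    using ab by (auto simp: Ex_Hom_square interval_le_def)
qed

lemma edge_span_adjunction:
  obtains \<epsilon> where "adjunction edge_span (square_proj \<odot> span_incl) (id_ntrans (id_fctr edge_cat)) \<epsilon>"
proof (rule thin_adjunction[OF shape_thin(2,3) edge_span_functors
      comp_fctr_functors[OF span_incl_functors square_proj_functors]])
  show "(square_proj \<odot> span_incl) \<odot> edge_span = id_fctr edge_cat"
    by (simp add: comp_fctr_assoc[OF edge_span_functors span_incl_functors square_proj_functors]
        span_incl_edge_span square_proj_edge_square)
  fix y :: "'a code" assume y: "y \<in> Obj span_cat"
  then obtain a b where ab: "y = Tup a b" "a \<in> {v0, v1}" "b \<in> {v0, v1}"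
    by (auto simp: span_cat_obj)
  have ysq: "y \<in> Obj square_cat" using y unfolding span_cat_obj square_cat_obj by blast
  have "OMap (square_proj \<odot> span_incl) y = OMap square_proj (OMap span_incl y)"
    using y by (intro comp_fctr_obj) (simp add: fctr_src(1)[OF span_incl_functors])
  also have "\<dots> = Tup a Pt" using span_incl_obj[OF y] shape_fctr_obj(1)[OF ysq] ab(1) by simp
  finally have "OMap edge_span (OMap (square_proj \<odot> span_incl) y) = Tup a v0"
    using shape_fctr_obj(3)[of "Tup a Pt"] ab(2) by (simp add: edge_cat_obj)
  moreover obtain f where "f \<in> Hom square_cat (Tup a v0) y"
    using Ex_Hom_square[of a v0 a b] ab by (auto simp: interval_le_def)
  moreover have "y \<in> {Tup v0 v0, Tup v1 v0, Tup v0 v1}" "Tup a v0 \<in> {Tup v0 v0, Tup v1 v0, Tup v0 v1}"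
    using y ab(2) unfolding span_cat_obj by blast+
  ultimately show "\<exists>f. f \<in> Hom span_cat (OMap edge_span (OMap (square_proj \<odot> span_incl) y)) y"
    unfolding Hom_full_subcat by auto
qed

section \<open>Semiadditivity at the point\<close>

text \<open>If the left adjoints of \<open>G\<close> and of \<open>G F\<close> are known at \<open>y\<close>, then the left adjoint of \<open>F\<close> is known
  at the value \<open>x\<close> of the former, because the left adjoint of \<open>G F\<close> is the composite.\<close>

lemma universal_arrow_cancel:
  assumes F: "F \<in> functors C D" and G: "G \<in> functors D E"
    and gf: "universal_arrow (G \<odot> F) y c w" and g: "universal_arrow G y x v"
    and u: "u \<in> Hom D x (OMap F c)" and eq: "Comp E (AMap G u) v = w"
  shows "universal_arrow F x c u"
proof -
  note GF = comp_fctr_functors[OF F G] and cat = fctr_cat[OF F] fctr_cat[OF G]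
  note Dc = universal_arrowD[OF GF gf] and Dx = universal_arrowD[OF G g]
  have GFm: "AMap (G \<odot> F) h = AMap G (AMap F h)" if "h \<in> Hom C a b" for h a b
    using HomD(1)[OF that] by (simp add: comp_fctr_arr fctr_src[OF F])
  have GFo: "OMap (G \<odot> F) a = OMap G (OMap F a)" if "a \<in> Obj C" for a
    using that by (simp add: comp_fctr_obj fctr_src[OF F])
  have key: "Comp E (AMap G (Comp D (AMap F h) u)) v = Comp E (AMap (G \<odot> F) h) w"
    if h: "h \<in> Hom C c d" for h d
    using fctr_comp[OF G u fctr_hom[OF F h]] GFm[OF h] eq
      comp_assoc[OF cat(4) Dx(2) fctr_hom[OF G u] fctr_hom[OF G fctr_hom[OF F h]]] by simp
  show ?thesis
  proof (rule universal_arrowI[OF F Dc(1) u])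
    fix d h assume d: "d \<in> Obj C" and h: "h \<in> Hom D x (OMap F d)"
    have "Comp E (AMap G h) v \<in> Hom E y (OMap (G \<odot> F) d)"
      using comp_hom[OF cat(4) Dx(2) fctr_hom[OF G h]] GFo[OF d] by simp
    then obtain k where k: "k \<in> Hom C c d" "Comp E (AMap (G \<odot> F) k) w = Comp E (AMap G h) v"
      using universal_arrow_ex[OF GF gf _ d] by blast
    have "Comp D (AMap F k) u = h"
      using key[OF k(1)] k(2)
      by (intro universal_arrow_eq[OF G g comp_hom[OF cat(2) u fctr_hom[OF F k(1)]] h]) simp
    then show "\<exists>k\<in>Hom C c d. Comp D (AMap F k) u = h" using k(1) by blast
  next
    fix d h h' assume h: "h \<in> Hom C c d" and h': "h' \<in> Hom C c d"
      and "Comp D (AMap F h) u = Comp D (AMap F h') u"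
    then show "h = h'"
      using key[OF h] key[OF h'] universal_arrow_eq[OF GF gf h h'] by simp
  qed
qed

lemma arrow_cat_isomorphicD:
  assumes C: "category C" and iso: "isomorphic (arrow_cat C) f g"
  shows "isomorphic C (Dom C f) (Dom C g)" "isomorphic C (Cod C f) (Cod C g)"
proof -
  obtain h where h: "h \<in> Hom (arrow_cat C) f g" "is_iso (arrow_cat C) h"
    using iso unfolding isomorphic_def by auto
  obtain k where k: "k \<in> Hom (arrow_cat C) g f" "Comp (arrow_cat C) k h = Ide (arrow_cat C) f"
      "Comp (arrow_cat C) h k = Ide (arrow_cat C) g"
    using h unfolding is_iso_def by (auto simp: HomD[OF h(1)])
  obtain a b where ab: "h = ((f, g), (a, b))" "a \<in> Hom C (Dom C f) (Dom C g)"
      "b \<in> Hom C (Cod C f) (Cod C g)"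
    using h(1) by (auto simp: Hom_def arrow_cat_def)
  obtain a' b' where ab': "k = ((g, f), (a', b'))" "a' \<in> Hom C (Dom C g) (Dom C f)"
      "b' \<in> Hom C (Cod C g) (Cod C f)"
    using k(1) by (auto simp: Hom_def arrow_cat_def)
  have "Comp C a' a = Ide C (Dom C f)" "Comp C a a' = Ide C (Dom C g)"
    "Comp C b' b = Ide C (Cod C f)" "Comp C b b' = Ide C (Cod C g)"
    using k(2,3) ab(1) ab'(1) by (auto simp: arrow_cat_def)
  then show "isomorphic C (Dom C f) (Dom C g)" "isomorphic C (Cod C f) (Cod C g)"
    using is_isoI[OF C ab(2) ab'(2)] is_isoI[OF C ab(3) ab'(3)] ab(2,3) unfolding isomorphic_def
    by blast+
qed

context
  fixes S :: "'a code set \<Rightarrow> bool" and \<D> :: "('a, 'o, 'm) prederiv"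
  assumes S: "smallness S" and st: "stable_derivator S \<D>"
begin

lemma stable_derivatorD:
  "derivator S \<D>" "strong S \<D>" "pointed \<D>"
  "X \<in> Obj (Val \<D> square_cat) \<Longrightarrow> coCartesian \<D> X \<longleftrightarrow> Cartesian \<D> X"
  using st unfolding stable_derivator_def by auto

lemmas der = stable_derivatorD(1)
lemmas pred = derivatorD(1)[OF der]
lemmas point = small_point[OF S der]
lemmas shapes = small_shapes[OF S]

abbreviation base where "base \<equiv> Val \<D> point_cat"

abbreviation at where "at J X j \<equiv> OMap (Pull \<D> (obj_fctr J j)) X"

lemma at_pull:
  assumes J: "small_cat S J" and K: "small_cat S K" and u: "u \<in> functors J K" and j: "j \<in> Obj J"
    and X: "X \<in> Obj (Val \<D> K)"
  shows "at J (OMap (Pull \<D> u) X) j = at K X (OMap u j)"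
  using pull_comp_obj[OF pred point J K obj_fctr_functors[OF fctr_cat(1)[OF u] j] u X]
    comp_obj_fctr[OF u j] by simp

text \<open>Strongness lifts the arrow \<open>0 \<rightarrow> x\<close> of \<open>\<D>(e)\<close> to an object of \<open>\<D>([1])\<close>.\<close>

lemma edge_exists:
  assumes z: "zero_object base z" and x: "x \<in> Obj base"
  obtains y where "y \<in> Obj (Val \<D> edge_cat)" "zero_object base (at edge_cat y (Tup v0 Pt))"
    "isomorphic base (at edge_cat y (Tup v1 Pt)) x"
proof -
  note catE = val_category[OF pred point]
  obtain f where f: "f \<in> Hom base z x" using zero_object_hom_ex(2)[OF z x] by auto
  have "essentially_surjective (dia_fctr \<D> point_cat)"
    using stable_derivatorD(2) point unfolding strong_def by blast
  then obtain y where y: "y \<in> Obj (Val \<D> edge_cat)"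
    "isomorphic (arrow_cat base) (OMap (dia_fctr \<D> point_cat) y) f"
    using HomD(1)[OF f] unfolding essentially_surjective_def
    by (auto simp: dia_fctr_def Let_def mk_fctr_def arrow_cat_def)
  have end_eq: "end_fctr v point_cat = obj_fctr edge_cat (Tup v Pt)" for v :: "'a code"
    by (simp add: end_fctr_def obj_fctr_def const_fctr_def mk_fctr_def sprod_cat_def fun_eq_iff
        restrict_def; simp add: point_cat_def poset_cat_def)
  have e0: "Tup v0 Pt \<in> Obj (edge_cat :: 'a scat)" and e1: "Tup v1 Pt \<in> Obj (edge_cat :: 'a scat)"
    unfolding edge_cat_obj by simp_all
  note o0 = obj_fctr_functors[OF shape_categories(2) e0] and o1 = obj_fctr_functors[OF shape_categories(2) e1]
  have cell: "(end_2cell point_cat :: 'a sntrans) \<in> ntranss (obj_fctr edge_cat (Tup v0 Pt)) (obj_fctr edge_cat (Tup v1 Pt))"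
    unfolding end_2cell_def end_eq
  proof (rule mk_ntrans_ntranss[OF o0 o1])
    have c: "Tup (Tup v0 v1) (Ide point_cat Pt) \<in> Hom (edge_cat :: 'a scat) (Tup v0 Pt) (Tup v1 Pt)"
      unfolding Hom_sprod_cat using ide_hom[OF category_point_cat, of Pt]
      by (auto simp: interval_cat_def Hom_poset_cat)
    show *: "Tup (Tup v0 v1) (Ide point_cat x) \<in> Hom edge_cat (OMap (obj_fctr edge_cat (Tup v0 Pt)) x)
          (OMap (obj_fctr edge_cat (Tup v1 Pt)) x)" if "x \<in> Obj point_cat" for x :: "'a code"
      using that c by simp
    fix f x y :: "'a code" assume f: "f \<in> Hom point_cat x y"
    note xy = hom_obj[OF category_point_cat f]
    show "Comp edge_cat (AMap (obj_fctr edge_cat (Tup v1 Pt)) f) (Tup (Tup v0 v1) (Ide point_cat x)) =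
       Comp edge_cat (Tup (Tup v0 v1) (Ide point_cat y)) (AMap (obj_fctr edge_cat (Tup v0 Pt)) f)"
      by (rule thinD[OF shape_thin(2) comp_hom[OF shape_categories(2) *[OF xy(1)] fctr_hom[OF o1 f]]
            comp_hom[OF shape_categories(2) fctr_hom[OF o0 f] *[OF xy(2)]]])
  qed
  have "OMap (dia_fctr \<D> point_cat) y = Cmp (Pull2 \<D> (end_2cell point_cat)) y"
    using y(1) by (simp add: dia_fctr_def Let_def mk_fctr_def)
  moreover have "Cmp (Pull2 \<D> (end_2cell point_cat)) y \<in> Hom base (at edge_cat y (Tup v0 Pt)) (at edge_cat y (Tup v1 Pt))"
    using ntrans_hom[OF pull2_ntranss[OF pred point shapes(2) o0 cell]
        pull_functors[OF pred point shapes(2) o0] y(1)] .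
  ultimately have "isomorphic base (at edge_cat y (Tup v0 Pt)) z" "isomorphic base (at edge_cat y (Tup v1 Pt)) x"
    using arrow_cat_isomorphicD[OF catE y(2)] HomD[OF f] by (auto simp: HomD)
  then show ?thesis
    using that y(1) zero_object_isomorphic[OF catE z isomorphic_sym[OF catE]] by blast
qed

lemma coCartesian_iff:
  "coCartesian \<D> X \<longleftrightarrow> (\<exists>x u. universal_arrow (Pull \<D> span_incl) x X u)"
  unfolding coCartesian_def
proof (rule in_image_left_adjoint_iff[OF pull_functors[OF pred shapes(3,1) span_incl_functors]])
  show "\<exists>L. left_adjoint_of L (Pull \<D> span_incl)"
    using left_adjoint_exists[OF S der shapes(3,1) span_incl_functors] unfolding left_adjoint_of_def by metis
qed

lemma Cartesian_iff:
  "Cartesian \<D> X \<longleftrightarrow> (\<exists>x u. universal_arrow (op_fctr (Pull \<D> cospan_incl)) x X u)"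
  unfolding Cartesian_def
proof (rule in_image_right_adjoint_iff[OF pull_functors[OF pred shapes(4,1) cospan_incl_functors]])
  show "\<exists>R. right_adjoint_of R (Pull \<D> cospan_incl)"
    using right_adjoint_exists[OF S der shapes(4,1) cospan_incl_functors] unfolding right_adjoint_of_def by metis
qed

text \<open>The inclusion of the span into the square is full and faithful.\<close>

lemma span_universal_iso:
  assumes xu: "universal_arrow (Pull \<D> span_incl) x X u" shows "is_iso (Val \<D> span_cat) u"
proof -
  note i = span_incl_functors and pi = pull_functors[OF pred shapes(3,1) span_incl_functors]
  obtain L \<eta> \<epsilon> where adj: "adjunction L (Pull \<D> span_incl) \<eta> \<epsilon>"
    using left_adjoint_exists[OF S der shapes(3,1) i] .
  note x = universal_arrowD(3)[OF pi xu]
  have "is_iso (Val \<D> span_cat) (Cmp \<eta> x)"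
    by (rule full_faithful_unit_iso[OF S der shapes(3,1) i _ adj x])
      (unfold span_incl_def, rule inclusion_reflects)
  then show ?thesis using universal_arrow_iso_unique[OF pi unit_universal[OF adj pi x] _ xu] by blast
qed

text \<open>The projection \<open>[1] \<times> [1] \<rightarrow> [1]\<close> is right adjoint to the inclusion of the edge, so restriction along it
  is left Kan extension from the edge. For the same reason the restriction of the result to the span
  is a left Kan extension from the edge. Kan extension from the edge to the square proceeds in two
  steps through the span, hence the square is extended from the span.\<close>

lemma projected_edge_coCartesian:
  assumes y: "y \<in> Obj (Val \<D> edge_cat)"
  shows "coCartesian \<D> (OMap (Pull \<D> square_proj) y)"
proof -
  let ?F = "Pull \<D> span_incl" and ?G = "Pull \<D> edge_span" and ?q = "square_proj \<odot> span_incl"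
  let ?y = "OMap (Pull \<D> square_proj) y" and ?x = "OMap (Pull \<D> ?q) y"
  note pr = square_proj_functors and i = span_incl_functors and s = edge_span_functors and t = edge_square_functors
  note q = comp_fctr_functors[OF i pr]
  note F = pull_functors[OF pred shapes(3,1) i] and G = pull_functors[OF pred shapes(2,3) s]
  note T = pull_functors[OF pred shapes(2,1) t] and Q = pull_functors[OF pred shapes(3,2) q]
  have GF: "?G \<odot> ?F = Pull \<D> edge_square"
    using pull_comp[OF pred shapes(2,3,1) s i] by (simp add: span_incl_edge_span)
  have unit: "Cmp (Pull2 \<D> (id_ntrans (id_fctr edge_cat))) y = Ide (Val \<D> edge_cat) y"
    using pull2_id[OF pred shapes(2,2) id_fctr_functors[OF shape_categories(2)]] pull_id[OF pred shapes(2)] y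
    by (simp add: id_ntrans_cmp)
  obtain \<epsilon> where "adjunction (edge_square :: 'a sfctr) square_proj (id_ntrans (id_fctr edge_cat)) \<epsilon>"
    by (rule edge_square_adjunction)
  from unit_universal[OF pull_adjunction[OF pred shapes(2,1) pr this] T y]
  have 1: "universal_arrow (?G \<odot> ?F) y ?y (Ide (Val \<D> edge_cat) y)" unfolding unit GF .
  obtain \<epsilon>' where "adjunction (edge_span :: 'a sfctr) ?q (id_ntrans (id_fctr edge_cat)) \<epsilon>'"
    by (rule edge_span_adjunction)
  from unit_universal[OF pull_adjunction[OF pred shapes(2,3) q this] G y]
  have 2: "universal_arrow ?G y ?x (Ide (Val \<D> edge_cat) y)" unfolding unit .
  have Fy: "OMap ?F ?y = ?x" using pull_comp_obj[OF pred shapes(3,1,2) i pr y] .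
  have xO: "?x \<in> Obj (Val \<D> span_cat)" using fctr_obj[OF Q y] .
  note ix = ide_hom[OF fctr_cat(2)[OF F] xO]
  have "Comp (Val \<D> edge_cat) (AMap ?G (Ide (Val \<D> span_cat) ?x)) (Ide (Val \<D> edge_cat) y) = Ide (Val \<D> edge_cat) y"
    using fctr_ide[OF G xO] comp_ide_left[OF fctr_cat(2)[OF G] universal_arrowD(2)[OF G 2]] by simp
  then have "universal_arrow ?F ?x ?y (Ide (Val \<D> span_cat) ?x)"
    using universal_arrow_cancel[OF F G 1 2, of "Ide (Val \<D> span_cat) ?x"] ix Fy by simp
  then show ?thesis unfolding coCartesian_iff by blast
qed

text \<open>The right Kan extension of the cospan with tip \<open>y\<^sub>1\<close> and both legs \<open>y\<^sub>0\<close>. Right Kan extension along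
  the inclusion keeps the values on the cospan: this follows from the same property of left Kan
  extension, because restriction sits between its two adjoints.\<close>

lemma cospan_Cartesian:
  assumes y: "y \<in> Obj (Val \<D> edge_cat)"
  obtains A where "A \<in> Obj (Val \<D> square_cat)" "Cartesian \<D> A"
    "\<And>k. k \<in> Obj cospan_cat \<Longrightarrow> isomorphic base (at square_cat A k) (at edge_cat y (OMap cospan_tip k))"
proof -
  note i = cospan_incl_functors and r = cospan_tip_functors
  note pi = pull_functors[OF pred shapes(4,1) i] and R = pull_functors[OF pred shapes(4,2) r]
  let ?b = "OMap (Pull \<D> cospan_tip) y"
  have b: "?b \<in> Obj (Val \<D> cospan_cat)" using fctr_obj[OF R y] .
  obtain T \<eta> \<epsilon> where adj: "adjunction (Pull \<D> cospan_incl) T \<eta> \<epsilon>"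
    using right_adjoint_exists[OF S der shapes(4,1) i] .
  note T = right_adjoint_functors[OF S der shapes(4,1) i adj]
  let ?A = "OMap T ?b"
  have A: "?A \<in> Obj (Val \<D> square_cat)" using fctr_obj[OF T b] .
  note univ = counit_couniversal[OF adj T b]
  have "is_iso (Val \<D> cospan_cat) (Cmp \<epsilon> ?b)"
  proof (rule adjoint_triple_counit_iso[OF pi _ univ])
    fix w assume w: "w \<in> Obj (Val \<D> cospan_cat)"
    obtain L \<eta>' \<epsilon>' where adj': "adjunction L (Pull \<D> cospan_incl) \<eta>' \<epsilon>'"
      using left_adjoint_exists[OF S der shapes(4,1) i] .
    have "is_iso (Val \<D> cospan_cat) (Cmp \<eta>' w)"
      by (rule full_faithful_unit_iso[OF S der shapes(4,1) i _ adj' w])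
        (unfold cospan_incl_def, rule inclusion_reflects)
    then show "\<exists>c u. universal_arrow (Pull \<D> cospan_incl) w c u \<and> is_iso (Val \<D> cospan_cat) u"
      using unit_universal[OF adj' pi w] by blast
  qed
  then have iso: "isomorphic (Val \<D> cospan_cat) (OMap (Pull \<D> cospan_incl) ?A) ?b"
    using counit_hom[OF adj T b] unfolding isomorphic_def by blast
  have "isomorphic base (at square_cat ?A k) (at edge_cat y (OMap cospan_tip k))" if k: "k \<in> Obj cospan_cat" for k
    using fctr_isomorphic[OF pull_functors[OF pred point shapes(4) obj_fctr_functors[OF shape_categories(4) k]] iso]
    unfolding at_pull[OF shapes(4,1) i k A] at_pull[OF shapes(4,2) r k y] cospan_incl_obj[OF k] .
  moreover have "Cartesian \<D> ?A" unfolding Cartesian_iff using univ by blast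
  ultimately show ?thesis using that A by blast
qed

text \<open>Coproducts of coCartesian squares are coCartesian, and products of Cartesian squares are Cartesian.
  By stability both ends of the canonical map are coCartesian, so it is invertible if its restriction
  to the span is, and the latter is tested on values. At a corner where all but one of the squares
  vanish, the canonical map is trivially invertible.\<close>

lemma biCartesian_canonical_iso:
  assumes X: "\<And>i. i < 2 \<Longrightarrow> coCartesian \<D> (X i)"
    and c: "is_coproduct (Val \<D> square_cat) 2 X c \<iota>" and p: "is_product (Val \<D> square_cat) 2 X p \<pi>"
    and f: "canonical_map (Val \<D> square_cat) 2 X c \<iota> p \<pi> f"
    and zero: "\<And>k. k \<in> Obj span_cat \<Longrightarrow> \<exists>j<2. \<forall>i<2. i \<noteq> j \<longrightarrow> zero_object base (at square_cat (X i) k)"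
  shows "is_iso (Val \<D> square_cat) f"
proof -
  let ?Q = "Val \<D> square_cat" and ?F = "Pull \<D> span_incl" and ?H = "Pull \<D> cospan_incl"
  note i = span_incl_functors and j = cospan_incl_functors
  note F = pull_functors[OF pred shapes(3,1) i] and H = pull_functors[OF pred shapes(4,1) j]
  note Dc = is_coproductD[OF c] and Dp = is_productD[OF p]
  have fh: "f \<in> Hom ?Q c p" using f unfolding canonical_map_def by simp
  have "\<forall>k. \<exists>x u. k < 2 \<longrightarrow> universal_arrow ?F x (X k) u" using X unfolding coCartesian_iff by blast
  then obtain x u where xu: "\<And>k. k < (2::nat) \<Longrightarrow> universal_arrow ?F (x k) (X k) (u k)" by metis
  have x: "x 0 \<in> Obj (Val \<D> span_cat)" "x 1 \<in> Obj (Val \<D> span_cat)"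
    using universal_arrowD(3)[OF F xu] by auto
  obtain d \<kappa> where d: "is_coproduct (Val \<D> span_cat) 2 x d \<kappa>"
    using binary_coproduct_exists[OF S der shapes(3) x] .
  obtain v where v: "universal_arrow ?F d c v" using coproduct_universal_arrow[OF F c xu d] by auto
  have "Cartesian \<D> (X k)" if "k < 2" for k
    using stable_derivatorD(4)[OF Dc(2)[OF that]] X[OF that] by simp
  then have "\<forall>k. \<exists>x u. k < 2 \<longrightarrow> universal_arrow (op_fctr ?H) x (X k) u" unfolding Cartesian_iff by blast
  then obtain y w where yw: "\<And>k. k < (2::nat) \<Longrightarrow> universal_arrow (op_fctr ?H) (y k) (X k) (w k)" by metis
  have y: "y 0 \<in> Obj (Val \<D> cospan_cat)" "y 1 \<in> Obj (Val \<D> cospan_cat)"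
    using universal_arrowD(3)[OF op_functors[OF H] yw] by auto
  obtain e \<rho> where e: "is_product (Val \<D> cospan_cat) 2 y e \<rho>"
    using binary_product_exists[OF S der shapes(4) y] .
  have "\<exists>v. universal_arrow (op_fctr ?H) e p v"
    using coproduct_universal_arrow[OF op_functors[OF H] p[unfolded is_product_op] yw e[unfolded is_product_op]] .
  then have "Cartesian \<D> p" unfolding Cartesian_iff by blast
  then have "coCartesian \<D> p" using stable_derivatorD(4)[OF Dp(1)] by simp
  then obtain d' v' where v': "universal_arrow ?F d' p v'" unfolding coCartesian_iff by auto
  have "is_iso base (AMap (Pull \<D> (obj_fctr span_cat k)) (AMap ?F f))" if k: "k \<in> Obj span_cat" for k
  proof -
    have ksq: "k \<in> Obj square_cat" using fctr_obj[OF i k] span_incl_obj[OF k] by simp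
    note o = obj_fctr_functors[OF shape_categories(1) ksq]
    have "AMap (Pull \<D> (obj_fctr span_cat k)) (AMap ?F f) = AMap (Pull \<D> (obj_fctr square_cat k)) f"
      using pull_comp_arr[OF pred point shapes(3,1) obj_fctr_functors[OF shape_categories(3) k] i HomD(1)[OF fh]]
        comp_obj_fctr[OF i k] span_incl_obj[OF k] by simp
    moreover obtain l where l: "l < 2" "\<And>i. i < 2 \<Longrightarrow> i \<noteq> l \<Longrightarrow> zero_object base (at square_cat (X i) k)"
      using zero[OF k] by blast
    moreover obtain z where z: "zero_object base z" using stable_derivatorD(3) unfolding pointed_def by auto
    ultimately show ?thesis
      using canonical_iso_if_zero[OF val_category[OF pred point] z
          pull_canonical_map[OF S der point shapes(1) o c p f] l] by simp
  qed
  moreover have "AMap ?F f \<in> Arr (Val \<D> span_cat)" using HomD(1)[OF fctr_hom[OF F fh]] .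
  ultimately have "is_iso (Val \<D> span_cat) (AMap ?F f)"
    using derivatorD(3)[OF der, unfolded Der2_def, rule_format, OF shapes(3)] by blast
  then show ?thesis
    using universal_arrow_reflects_iso[OF F v span_universal_iso[OF v] v' span_universal_iso[OF v'] fh] by simp
qed

text \<open>A biproduct of two given objects is obtained as the value at \<open>(1,1)\<close> of a coproduct of squares that
  have these objects at \<open>(1,1)\<close>, provided that at each of the other corners one of the squares vanishes.\<close>

lemma semiadditive_point: "semiadditive base"
proof -
  note catE = val_category[OF pred point]
  obtain z where z: "zero_object base z" using stable_derivatorD(3) unfolding pointed_def by auto
  show ?thesis
  proof (rule semiadditiveI[OF catE z])
    fix Y :: "nat \<Rightarrow> 'o" assume Y: "Y 0 \<in> Obj base" "Y 1 \<in> Obj base"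
    obtain y where y: "y \<in> Obj (Val \<D> edge_cat)" "zero_object base (at edge_cat y (Tup v0 Pt))"
      "isomorphic base (at edge_cat y (Tup v1 Pt)) (Y 0)" using edge_exists[OF z Y(1)] .
    obtain y' where y': "y' \<in> Obj (Val \<D> edge_cat)" "zero_object base (at edge_cat y' (Tup v0 Pt))"
      "isomorphic base (at edge_cat y' (Tup v1 Pt)) (Y 1)" using edge_exists[OF z Y(2)] .
    obtain A where A: "A \<in> Obj (Val \<D> square_cat)" "Cartesian \<D> A"
      "\<And>k. k \<in> Obj cospan_cat \<Longrightarrow> isomorphic base (at square_cat A k) (at edge_cat y' (OMap cospan_tip k))"
      using cospan_Cartesian[OF y'(1)] by blast
    \<comment> \<open>\<open>B\<close> vanishes at \<open>(0,0)\<close> and \<open>(0,1)\<close>, and \<open>A\<close> at \<open>(1,0)\<close> and \<open>(0,1)\<close>.\<close>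
    define B where "B = OMap (Pull \<D> square_proj) y"
    note pr = square_proj_functors
    have B: "B \<in> Obj (Val \<D> square_cat)" "coCartesian \<D> B"
      unfolding B_def using fctr_obj[OF pull_functors[OF pred shapes(1,2) pr] y(1)]
        projected_edge_coCartesian[OF y(1)] by auto
    have Bk: "at square_cat B k = at edge_cat y (Tup (tfst k) Pt)" if "k \<in> Obj square_cat" for k
      unfolding B_def at_pull[OF shapes(1,2) pr that y(1)] shape_fctr_obj(1)[OF that] ..
    have A0: "zero_object base (at square_cat A k)" if "k \<in> {Tup v1 v0, Tup v0 v1}" for k
    proof -
      have k: "k \<in> Obj cospan_cat" using that unfolding cospan_cat_obj by blast
      have "k \<noteq> Tup v1 v1" using that v0_neq_v1[OF S der] by auto
      then have "OMap cospan_tip k = Tup v0 Pt" using shape_fctr_obj(4)[OF k] by simp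
      then show ?thesis
        using zero_object_isomorphic[OF catE y'(2)] isomorphic_sym[OF catE A(3)[OF k]] by simp
    qed
    define X where "X i = (if i = 0 then B else A)" for i :: nat
    have X: "X 0 \<in> Obj (Val \<D> square_cat)" "X 1 \<in> Obj (Val \<D> square_cat)" using A B by (auto simp: X_def)
    obtain c \<iota> where c: "is_coproduct (Val \<D> square_cat) 2 X c \<iota>"
      using binary_coproduct_exists[OF S der shapes(1) X] .
    obtain p \<pi> where p: "is_product (Val \<D> square_cat) 2 X p \<pi>"
      using binary_product_exists[OF S der shapes(1) X] .
    obtain w where w: "zero_object (Val \<D> square_cat) w"
      using pointed_zero_object[OF S der stable_derivatorD(3) shapes(1)] by auto
    obtain f where f: "canonical_map (Val \<D> square_cat) 2 X c \<iota> p \<pi> f"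
      using canonical_map_exists[OF val_category[OF pred shapes(1)] w c p] .
    have iso: "is_iso (Val \<D> square_cat) f"
    proof (rule biCartesian_canonical_iso[OF _ c p f])
      show "coCartesian \<D> (X i)" for i using A(2) B(2) stable_derivatorD(4)[OF A(1)] by (simp add: X_def)
      fix k :: "'a code" assume k: "k \<in> Obj span_cat"
      show "\<exists>j<2. \<forall>i<2. i \<noteq> j \<longrightarrow> zero_object base (at square_cat (X i) k)"
      proof (cases "k = Tup v0 v0")
        case True
        have "k \<in> Obj square_cat" unfolding True square_cat_obj by simp
        then have "zero_object base (at square_cat B k)" using Bk y(2) True by simp
        then have "\<forall>i<2. i \<noteq> 1 \<longrightarrow> zero_object base (at square_cat (X i) k)" by (simp add: X_def less_2_cases_iff)
        then show ?thesis by (intro exI[of _ 1]) simp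
      next
        case False
        then have "zero_object base (at square_cat A k)" using A0 k unfolding span_cat_obj by blast
        then have "\<forall>i<2. i \<noteq> 0 \<longrightarrow> zero_object base (at square_cat (X i) k)" by (simp add: X_def)
        then show ?thesis by (intro exI[of _ 0]) simp
      qed
    qed
    let ?k = "Tup v1 v1 :: 'a code"
    have k: "?k \<in> Obj square_cat" "?k \<in> Obj cospan_cat" unfolding square_cat_obj cospan_cat_obj by simp_all
    note o = obj_fctr_functors[OF shape_categories(1) k(1)]
    note po = pull_functors[OF pred point shapes(1) o]
    have "is_biproduct base 2 (\<lambda>i. at square_cat (X i) ?k) (at square_cat c ?k)
        (\<lambda>i. AMap (Pull \<D> (obj_fctr square_cat ?k)) (\<iota> i))
        (\<lambda>i. Comp base (AMap (Pull \<D> (obj_fctr square_cat ?k)) (\<pi> i)) (AMap (Pull \<D> (obj_fctr square_cat ?k)) f))"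
      using biproduct_of_canonical_iso[OF catE z pull_canonical_map[OF S der point shapes(1) o c p f]
          fctr_iso[OF po iso]] .
    moreover have "isomorphic base (at square_cat (X i) ?k) (Y i)" if "i < 2" for i
    proof -
      have "isomorphic base (at square_cat B ?k) (Y 0)" using Bk[OF k(1)] y(3) by simp
      moreover have "isomorphic base (at square_cat A ?k) (Y 1)"
        using isomorphic_trans[OF catE A(3)[OF k(2)]] shape_fctr_obj(4)[OF k(2)] y'(3) by simp
      ultimately show ?thesis using that by (auto simp: X_def less_2_cases_iff)
    qed
    ultimately show "\<exists>b \<iota> \<pi>. is_biproduct base 2 Y b \<iota> \<pi>"
      using biproduct_change_family[OF catE z] by blast
  qed
qed

end

section \<open>Finite biproducts in a stable derivator\<close>

theorem proposition4p7:
  fixes S :: "'a code set \<Rightarrow> bool"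
    and \<D> :: "('a, 'o, 'm) prederiv"
    and J K :: "'a scat"
    and u :: "'a sfctr"
  assumes "smallness S"
    and "stable_derivator S \<D>"
    and "small_cat S J" and "small_cat S K"
    and "u \<in> functors J K"
  shows "semiadditive (Val \<D> J) \<and>
    coproducts_canonically_products (Val \<D> J) \<and>
    preserves_all_finite (Pull \<D> u) \<and>
    (\<forall>u_sh. left_adjoint_of u_sh (Pull \<D> u) \<longrightarrow> preserves_all_finite u_sh) \<and>
    (\<forall>u_lst. right_adjoint_of u_lst (Pull \<D> u) \<longrightarrow> preserves_all_finite u_lst)"
proof -
  note S = assms(1) and st = assms(2) and J = assms(3) and K = assms(4) and u = assms(5)
  note D = stable_derivatorD(1)[OF S st]
  note pu = pull_functors[OF derivatorD(1)[OF D] J K u]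
  note sa = semiadditive_from_point[OF S D stable_derivatorD(3)[OF S st] semiadditive_point[OF S st]]
  have "preserves_all_finite (Pull \<D> u)"
    using preserves_all_finite_of_coproducts[OF pu pull_preserves(1)[OF S D J K u] sa[OF K] sa[OF J]] .
  moreover have "preserves_all_finite u_sh" if l: "left_adjoint_of u_sh (Pull \<D> u)" for u_sh
  proof -
    obtain \<eta> \<epsilon> where adj: "adjunction u_sh (Pull \<D> u) \<eta> \<epsilon>" using l unfolding left_adjoint_of_def by auto
    show ?thesis
      using preserves_all_finite_of_coproducts[OF adjunctionD(1)[OF adj pu]
          left_adjoint_preserves_coproducts[OF adj pu] sa[OF J] sa[OF K]] .
  qed
  moreover have "preserves_all_finite u_lst" if r: "right_adjoint_of u_lst (Pull \<D> u)" for u_lst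
  proof -
    obtain \<eta> \<epsilon> where adj: "adjunction (Pull \<D> u) u_lst \<eta> \<epsilon>" using r unfolding right_adjoint_of_def by auto
    note R = right_adjoint_functors[OF S D J K u adj]
    show ?thesis
      using preserves_all_finite_of_products[OF R right_adjoint_preserves_products[OF adj R] sa[OF J] sa[OF K]] .
  qed
  ultimately show ?thesis using sa[OF J] semiadditive_canonically[OF sa[OF J]] by blast
qed

end
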